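(* Let $R(z)$ be an $m\times m$ rational matrix function with no poles and no zeros on the unit circle $\mathbb{T}$, and let $\Xi(z)$ be the left unitary factor of $R(z)$. Let $\Xi(z)=V(z)W^*(z)$, where $V(z)$ and $W(z)$ are rational bi-inner $m\times m$ matrix functions given by \[ V(z)=D_V+zC_V(I_{n_-}-zA_V)^{-1}B_V,\qquad W(z)=D_W+zC_W(I_{n_+}-zA_W)^{-1}B_W, \] with $A_V$ ($n_-\times n_-$) and $A_W$ ($n_+\times n_+$) stable, and with both realizations unitary, i.e. the matrices \[ \begin{bmatrix} A_V & B_V\\ C_V & D_V\end{bmatrix}\quad\text{and}\quad \begin{bmatrix} A_W & B_W\\ C_W & D_W\end{bmatrix} \] are both unitary. Let $X$ be the unique solution of the Stein equation $X-A_VXA_W^*=B_VB_W^*$. Then the number $s$ of negative right Wiener-Hopf indices of $\Xi(z)$ is \[ s=\dim\operatorname{Ker}X-\dim\operatorname{Ker}\begin{bmatrix} B_W^*\\ XA_W^*\end{bmatrix}, \] and the negative right Wiener-Hopf indices $-\alpha_j$, $j=1,\dots,s$, of $\Xi(z)$ are given by \[ \alpha_j=\#\Big\{k\in\mathbb{N}\ \Big|\ \dim\operatorname{Ker}_{k-1}\Big(\begin{bmatrix} B_W^*\\ XA_W^*\end{bmatrix},A_W^*\Big)-\dim\operatorname{Ker}_{k}\Big(\begin{bmatrix} B_W^*\\ XA_W^*\end{bmatrix},A_W^*\Big)\ge j\Big\}. \] Furthermore, the number $t$ of positive right Wiener-Hopf indices of $\Xi(z)$ is \[ t=\dim\operatorname{Im}\begin{bmatrix}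 B_V & A_VX\end{bmatrix}-\dim\operatorname{Im}X, \] and the positive right Wiener-Hopf indices $\omega_j$, $j=1,\dots,t$, of $\Xi(z)$ are given by \[ \omega_j=\#\Big\{k\in\mathbb{N}\ \Big|\ \dim\operatorname{Im}_k\big(A_V,\begin{bmatrix} B_V & A_VX\end{bmatrix}\big)-\dim\operatorname{Im}_{k-1}\big(A_V,\begin{bmatrix} B_V & A_VX\end{bmatrix}\big)\ge j\Big\}. \]
   Context: All matrices are complex. A square matrix is stable if all its eigenvalues lie in the open unit disc. For a rational matrix function $F(z)$, $F^*(z)=F(1/\bar z)^*$. A square rational matrix function is regular if its determinant is not identically zero; its zeros are the poles of its inverse. A rational $m\times m$ matrix function is bi-inner if it has unitary values on the unit circle $\mathbb{T}$ and no poles on the unit disc. An invertible outer function is a rational $m\times m$ matrix function with no poles and no zeros on the closed unit disc. Left unitary factor: if $R(z)$ is a rational $m\times m$ matrix function with no poles and no zeros on $\mathbb{T}$, there is an invertible outer function $\Psi(z)$ with $R^*(z)R(z)=\Psi^*(z)\Psi(z)$, unique up to multiplication on the left by a constant unitary matrix. The function $\Xi(z)=R(z)\Psi(z)^{-1}$ (unique up to multiplication on the right by a constant unitary matrix) is called the left unitary factor of $R(z)$. Right Wiener-Hopf indices: an $m\times m$ rational matrix function $F(z)$ with no poles and no zeros on $\mathbb{T}$ admits a right Wiener-Hopf factorization $F(z)=W_-(z)D(z)W_+(z)$, where $W_-$ and $W_+$ are rational $m\times m$ matrix functions, $W_-$ has no poles and no zeros outside the open unit disc including infinity, $W_+$ has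 no poles and no zeros on the closed unit disc, and \[ D(z)=\operatorname{diag}(z^{-\alpha_1},\dots,z^{-\alpha_s})\oplus I_k\oplus\operatorname{diag}(z^{\omega_t},\dots,z^{\omega_1}), \] with integers $-\alpha_1\le\cdots\le-\alpha_s<0$ and $0<\omega_t\le\cdots\le\omega_1$, $m=s+k+t$. The numbers $-\alpha_j$ are the negative, and the numbers $\omega_j$ the positive, right Wiener-Hopf indices of $F$; they are uniquely determined by $F$. Notation: $\operatorname{Ker}_k(C,A)=\bigcap_{j=0}^{k-1}\operatorname{Ker}CA^j$ and $\operatorname{Im}_k(A,B)=\bigvee_{j=0}^{k-1}\operatorname{Im}A^jB$ (linear span); for $k=0$ these are the full Euclidean space and the zero subspace, respectively. $\mathbb{N}=\{1,2,\dots\}$ and $\#$ denotes cardinality. *)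

theory Defs
  imports
    "Jordan_Normal_Form.Schur_Decomposition"
    "Jordan_Normal_Form.Matrix_Kernel"
    "Jordan_Normal_Form.Gauss_Jordan_Elimination"
    "HOL-Computational_Algebra.Field_as_Ring"
begin

text \<open>A scalar rational function is an element of the field of fractions of the polynomial
  ring over the complex numbers, and a rational matrix function is a matrix over that field.
  In particular equality, products, determinants and inverses of rational matrix functions are
  those of matrices over this field.\<close>

type_synonym ratfun = "complex poly fract"

definition rf_const :: "complex \<Rightarrow> ratfun" where
  "rf_const c = to_fract [:c:]"

definition rf_z :: ratfun where
  "rf_z = to_fract [:0, 1:]"

definition rf_num :: "ratfun \<Rightarrow> complex poly" where
  "rf_num f = fst (quot_of_fract f)"

definition rf_den :: "ratfun \<Rightarrow> complex poly" where
  "rf_den f = snd (quot_of_fract f)"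

text \<open>Numerator and denominator are coprime, so poles are exactly the roots of the denominator,
  and the value below is the value of the function at every point that is not a pole.\<close>

definition rf_value :: "ratfun \<Rightarrow> complex \<Rightarrow> complex" where
  "rf_value f z = poly (rf_num f) z / poly (rf_den f) z"

definition rf_pole :: "ratfun \<Rightarrow> complex \<Rightarrow> bool" where
  "rf_pole f z \<longleftrightarrow> poly (rf_den f) z = 0"

definition rf_pole_inf :: "ratfun \<Rightarrow> bool" where
  "rf_pole_inf f \<longleftrightarrow> degree (rf_num f) > degree (rf_den f)"

text \<open>The scalar function sending \<open>z\<close> to the conjugate of \<open>f (1 / cnj z)\<close>: conjugate all
  coefficients and substitute \<open>1 / z\<close> for \<open>z\<close>.\<close>

definition poly_star :: "complex poly \<Rightarrow> ratfun" where
  "poly_star p = poly (map_poly (\<lambda>c. rf_const (cnj c)) p) (inverse rf_z)"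

definition rf_star :: "ratfun \<Rightarrow> ratfun" where
  "rf_star f = poly_star (rf_num f) / poly_star (rf_den f)"


definition rmat_const :: "complex mat \<Rightarrow> ratfun mat" where
  "rmat_const = map_mat rf_const"

definition rmat_value :: "ratfun mat \<Rightarrow> complex \<Rightarrow> complex mat" where
  "rmat_value F z = map_mat (\<lambda>f. rf_value f z) F"

definition rmat_star :: "ratfun mat \<Rightarrow> ratfun mat" where
  "rmat_star F = map_mat rf_star (transpose_mat F)"

definition rmat_regular :: "ratfun mat \<Rightarrow> bool" where
  "rmat_regular F \<longleftrightarrow> det F \<noteq> 0"

text \<open>Only meaningful for regular \<open>F\<close>; likewise the zeros below.\<close>

definition rmat_inv :: "ratfun mat \<Rightarrow> ratfun mat" where
  "rmat_inv F = the (mat_inverse F)"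

definition rmat_pole :: "ratfun mat \<Rightarrow> complex \<Rightarrow> bool" where
  "rmat_pole F z \<longleftrightarrow> (\<exists>i < dim_row F. \<exists>j < dim_col F. rf_pole (F $$ (i, j)) z)"

definition rmat_pole_inf :: "ratfun mat \<Rightarrow> bool" where
  "rmat_pole_inf F \<longleftrightarrow> (\<exists>i < dim_row F. \<exists>j < dim_col F. rf_pole_inf (F $$ (i, j)))"

definition rmat_zero :: "ratfun mat \<Rightarrow> complex \<Rightarrow> bool" where
  "rmat_zero F z \<longleftrightarrow> rmat_pole (rmat_inv F) z"

definition rmat_zero_inf :: "ratfun mat \<Rightarrow> bool" where
  "rmat_zero_inf F \<longleftrightarrow> rmat_pole_inf (rmat_inv F)"

text \<open>Having no zeros includes regularity, since zeros are defined through the inverse.\<close>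

definition no_poles_zeros_on :: "complex set \<Rightarrow> ratfun mat \<Rightarrow> bool" where
  "no_poles_zeros_on S F \<longleftrightarrow>
     rmat_regular F \<and> (\<forall>z \<in> S. \<not> rmat_pole F z \<and> \<not> rmat_zero F z)"


definition unitary_mat :: "nat \<Rightarrow> complex mat \<Rightarrow> bool" where
  "unitary_mat n U \<longleftrightarrow>
     U \<in> carrier_mat n n \<and> mat_adjoint U * U = 1\<^sub>m n \<and> U * mat_adjoint U = 1\<^sub>m n"

definition stable_mat :: "complex mat \<Rightarrow> bool" where
  "stable_mat A \<longleftrightarrow> (\<forall>k. eigenvalue A k \<longrightarrow> cmod k < 1)"

definition bi_inner :: "nat \<Rightarrow> ratfun mat \<Rightarrow> bool" where
  "bi_inner m F \<longleftrightarrow> F \<in> carrier_mat m m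
     \<and> (\<forall>z. cmod z = 1 \<longrightarrow> \<not> rmat_pole F z \<and> unitary_mat m (rmat_value F z))
     \<and> (\<forall>z. cmod z < 1 \<longrightarrow> \<not> rmat_pole F z)"

definition invertible_outer :: "nat \<Rightarrow> ratfun mat \<Rightarrow> bool" where
  "invertible_outer m F \<longleftrightarrow> F \<in> carrier_mat m m \<and> no_poles_zeros_on {z. cmod z \<le> 1} F"

text \<open>\<open>\<Xi>\<close> is a left unitary factor of \<open>R\<close>; it is determined by \<open>R\<close> only up to a constant
  unitary factor on the right, whence a relation.\<close>

definition left_unitary_factor :: "nat \<Rightarrow> ratfun mat \<Rightarrow> ratfun mat \<Rightarrow> bool" where
  "left_unitary_factor m R \<Xi> \<longleftrightarrow>
     (\<exists>\<Psi>. invertible_outer m \<Psi> \<and> rmat_star R * R = rmat_star \<Psi> * \<Psi> \<and> \<Xi> = R * rmat_inv \<Psi>)"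

text \<open>The diagonal entries are \<open>z\<close> to the powers \<open>-\<alpha> 1, \<dots>, -\<alpha> s\<close>, then ones, then
  \<open>z\<close> to the powers \<open>\<omega> t, \<dots>, \<omega> 1\<close>; matrix indices start at \<open>0\<close>.\<close>

definition WH_diag :: "nat \<Rightarrow> nat \<Rightarrow> (nat \<Rightarrow> nat) \<Rightarrow> nat \<Rightarrow> (nat \<Rightarrow> nat) \<Rightarrow> ratfun mat" where
  "WH_diag m s \<alpha> t \<omega> = mat_diag m (\<lambda>i.
     if i < s then inverse rf_z ^ \<alpha> (i + 1)
     else if i < m - t then 1
     else rf_z ^ \<omega> (m - i))"

text \<open>The negative right Wiener-Hopf indices of \<open>F\<close> are \<open>-\<alpha> 1 \<le> \<dots> \<le> -\<alpha> s\<close> and the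
  positive ones are \<open>\<omega> t \<le> \<dots> \<le> \<omega> 1\<close>. The values of \<open>\<alpha>\<close> outside \<open>{1..s}\<close>
  and of \<open>\<omega>\<close> outside \<open>{1..t}\<close> are irrelevant.\<close>

definition right_WH_indices ::
  "nat \<Rightarrow> ratfun mat \<Rightarrow> nat \<Rightarrow> (nat \<Rightarrow> nat) \<Rightarrow> nat \<Rightarrow> (nat \<Rightarrow> nat) \<Rightarrow> bool" where
  "right_WH_indices m F s \<alpha> t \<omega> \<longleftrightarrow>
     s + t \<le> m
     \<and> (\<forall>j \<in> {1..s}. 0 < \<alpha> j) \<and> antimono_on {1..s} \<alpha>
     \<and> (\<forall>j \<in> {1..t}. 0 < \<omega> j) \<and> antimono_on {1..t} \<omega>
     \<and> (\<exists>Wm Wp. Wm \<in> carrier_mat m m \<and> Wp \<in> carrier_mat m m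
          \<and> no_poles_zeros_on {z. cmod z \<ge> 1} Wm \<and> \<not> rmat_pole_inf Wm \<and> \<not> rmat_zero_inf Wm
          \<and> no_poles_zeros_on {z. cmod z \<le> 1} Wp
          \<and> F = Wm * WH_diag m s \<alpha> t \<omega> * Wp)"

text \<open>The rational matrix function \<open>D + z C (I - z A)\<^sup>-\<^sup>1 B\<close> with \<open>A\<close> of size \<open>n\<close>.\<close>

definition realization ::
  "nat \<Rightarrow> complex mat \<Rightarrow> complex mat \<Rightarrow> complex mat \<Rightarrow> complex mat \<Rightarrow> ratfun mat" where
  "realization n A B C D = rmat_const D +
     rf_z \<cdot>\<^sub>m (rmat_const C * rmat_inv (1\<^sub>m n - rf_z \<cdot>\<^sub>m rmat_const A) * rmat_const B)"


definition append_cols :: "'a :: zero mat \<Rightarrow> 'a mat \<Rightarrow> 'a mat" (infixr \<open>@\<^sub>c\<close> 65) where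
  "A @\<^sub>c B = four_block_mat A B (0\<^sub>m 0 (dim_col A)) (0\<^sub>m 0 (dim_col B))"

text \<open>Dimension of a linear subspace \<open>S\<close> of \<open>carrier_vec n\<close>.\<close>

definition subspace_dim :: "nat \<Rightarrow> complex vec set \<Rightarrow> nat" where
  "subspace_dim n S = vectorspace.dim class_ring ((module_vec TYPE(complex) n)\<lparr>carrier := S\<rparr>)"

definition mat_im :: "complex mat \<Rightarrow> complex vec set" where
  "mat_im A = (\<lambda>x. A *\<^sub>v x) ` carrier_vec (dim_col A)"

text \<open>The intersection with \<open>carrier_vec\<close> matters only for \<open>k = 0\<close>.\<close>

definition Ker_k :: "nat \<Rightarrow> complex mat \<Rightarrow> complex mat \<Rightarrow> complex vec set" where
  "Ker_k k C A = carrier_vec (dim_col A) \<inter> (\<Inter>j < k. mat_kernel (C * A ^\<^sub>m j))"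

definition Im_k :: "nat \<Rightarrow> complex mat \<Rightarrow> complex mat \<Rightarrow> complex vec set" where
  "Im_k k A B =
     LinearCombinations.module.span class_ring (module_vec TYPE(complex) (dim_row A)) (\<Union>j < k. mat_im (A ^\<^sub>m j * B))"

end

theory Submission imports Defs "Jordan_Normal_Form.DL_Rank"
begin

text \<open>The Wiener-Hopf indices of \<open>\<Xi>\<close> are read off from the dimensions of the spaces
  \<open>M\<^sub>k = {f. f has no poles on the closed disc and z\<^sup>k \<Xi> f is strictly proper with all poles in the open disc}\<close>,
  which are the kernels of the Toeplitz operators with symbols \<open>z\<^sup>k \<Xi>\<close>. These dimensions are computed twice.

  From a factorization \<open>\<Xi> = W\<^sub>- D W\<^sub>+\<close>: the factors \<open>W\<^sub>-\<close>, \<open>W\<^sub>+\<close> and their inverses preserve the two kinds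
  of functions, so with \<open>D = diag (z\<^sup>d\<^sub>i)\<close> the substitution \<open>p = W\<^sub>+ f\<close> turns the condition on \<open>f\<close> into one on
  every single coordinate, \<open>z\<^sup>k\<^sup>+\<^sup>d\<^sub>i p\<^sub>i\<close> strictly proper: \<open>p\<^sub>i\<close> is a polynomial of degree less than \<open>- d\<^sub>i - k\<close>.
  Hence \<open>dim M\<^sub>k - dim M\<^sub>k\<^sub>+\<^sub>1\<close> is the number of exponents below \<open>- k\<close>; the isomorphism behind this sends \<open>f\<close> to
  the leading coefficients of those \<open>p\<^sub>i\<close> (\<open>wiener_hopf_dimension\<close>).

  From the realizations: if \<open>f \<in> M\<^sub>k\<close>, then \<open>W\<^sup>* f = z\<^sup>-\<^sup>k V\<^sup>* (z\<^sup>k \<Xi> f)\<close> is strictly proper, because \<open>V\<^sup>*\<close> is proper,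
  and this forces \<open>f = C\<^sub>W (I - z A\<^sub>W)\<^sup>-\<^sup>1 x\<close> for a constant vector \<open>x\<close> (\<open>model_space\<close>), with
  \<open>W\<^sup>* f = B\<^sub>W\<^sup>* (z I - A\<^sub>W\<^sup>*)\<^sup>-\<^sup>1 x\<close> (\<open>model_comodel\<close>). The Stein equation is exactly the partial fraction identity
  that splits \<open>\<Xi> f = V W\<^sup>* f\<close> into a strictly proper term and \<open>C\<^sub>V (I - z A\<^sub>V)\<^sup>-\<^sup>1 X x\<close> (\<open>V_comodel_image\<close>). By
  observability of the realization of \<open>V\<close>, \<open>M\<^sub>0\<close> corresponds to \<open>Ker X\<close>. Multiplying by \<open>z\<close> produces a constant term, and the
  unitarity of the realization matrix of \<open>V\<close> shows that this term and \<open>X x\<close> vanish together exactly when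
  \<open>B\<^sub>W\<^sup>* x = 0\<close> and \<open>X A\<^sub>W\<^sup>* x = 0\<close>; then \<open>z \<Xi> f\<close> is the function \<open>\<Xi> f\<close> belonging to \<open>A\<^sub>W\<^sup>* x\<close>. By
  induction \<open>M\<^sub>k\<close> corresponds to \<open>Ker\<^sub>k (K, A\<^sub>W\<^sup>*)\<close> for \<open>k \<ge> 1\<close> (\<open>strict_iff_N\<close>).

  Comparing the two, \<open>s = dim M\<^sub>0 - dim M\<^sub>1\<close>, and \<open>\<alpha>\<close> is the partition conjugate to
  \<open>k \<mapsto> dim M\<^sub>k\<^sub>-\<^sub>1 - dim M\<^sub>k\<close>. In the formula for \<open>\<alpha>\<^sub>j\<close> the term \<open>k = 1\<close> has the full space in place of \<open>Ker X\<close>; this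
  can only increase a difference that is otherwise equal to \<open>s \<ge> j\<close> (\<open>indices_from_dimensions\<close>).

  For the positive indices pass to \<open>\<Xi>\<^sup>* = W V\<^sup>* = W\<^sub>+\<^sup>* D\<^sup>* W\<^sub>-\<^sup>*\<close>: this is again a factorization of the same type, the
  exponents change sign, \<open>V\<close> and \<open>W\<close> are exchanged, and \<open>X\<^sup>*\<close> solves the corresponding Stein equation (\<open>dual\<close>).
  The kernels obtained there are the orthogonal complements of the images in the theorem.\<close>

section \<open>Poles of scalar rational functions\<close>

lemma rf_z_nonzero [simp]: "rf_z \<noteq> 0"
  by (simp add: rf_z_def)

lemma rf_eq_num_den: "f = to_fract (rf_num f) / to_fract (rf_den f)"
  unfolding rf_num_def rf_den_def by (metis Fract_conv_to_fract Fract_quot_of_fract)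

lemma rf_den_nonzero [simp]: "rf_den f \<noteq> 0"
  by (simp add: rf_den_def)

text \<open>Poles are defined through the normalized fraction; this identity transfers statements to an arbitrary representation
  \<open>p / d\<close>, which is what ring operations produce.\<close>

lemma rf_num_den_cross:
  assumes "f = to_fract p / to_fract d" "d \<noteq> 0"
  shows "rf_num f * d = p * rf_den f"
proof -
  have "to_fract (rf_num f) / to_fract (rf_den f) = to_fract p / to_fract d"
    using assms(1) rf_eq_num_den[of f] by simp
  then have "to_fract (rf_num f * d) = to_fract (p * rf_den f)"
    using assms(2) by (simp add: field_simps)
  then show ?thesis unfolding to_fract_eq_iff .
qed

lemma rf_den_dvd:
  assumes "f = to_fract p / to_fract d" "d \<noteq> 0"
  shows "rf_den f dvd d"
proof -
  have "coprime (rf_den f) (rf_num f)"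
    unfolding rf_den_def rf_num_def using coprime_quot_of_fract[of f] by (simp add: coprime_commute)
  moreover have "rf_den f dvd rf_num f * d"
    using rf_num_den_cross[OF assms] by simp
  ultimately show ?thesis by (simp add: coprime_dvd_mult_right_iff)
qed

text \<open>Any representation with a denominator that does not vanish at the point will do, so that sums and products need not be
  reduced to lowest terms.\<close>

lemma not_pole_iff:
  "\<not> rf_pole f z \<longleftrightarrow> (\<exists>p d. f = to_fract p / to_fract d \<and> poly d z \<noteq> 0)"
proof
  assume "\<not> rf_pole f z"
  then show "\<exists>p d. f = to_fract p / to_fract d \<and> poly d z \<noteq> 0"
    using rf_eq_num_den[of f] unfolding rf_pole_def by blast
next
  assume "\<exists>p d. f = to_fract p / to_fract d \<and> poly d z \<noteq> 0"
  then obtain p d where pd: "f = to_fract p / to_fract d" "poly d z \<noteq> 0" by blast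
  then have "rf_den f dvd d" by (intro rf_den_dvd) auto
  then show "\<not> rf_pole f z" unfolding rf_pole_def using pd(2) by (auto elim!: dvdE)
qed

lemma not_pole_inf_iff:
  "\<not> rf_pole_inf f \<longleftrightarrow>
     (\<exists>p d. f = to_fract p / to_fract d \<and> d \<noteq> 0 \<and> degree p \<le> degree d)"
proof
  assume "\<not> rf_pole_inf f"
  then show "\<exists>p d. f = to_fract p / to_fract d \<and> d \<noteq> 0 \<and> degree p \<le> degree d"
    using rf_eq_num_den[of f] rf_den_nonzero[of f] unfolding rf_pole_inf_def not_less by blast
next
  assume "\<exists>p d. f = to_fract p / to_fract d \<and> d \<noteq> 0 \<and> degree p \<le> degree d"
  then obtain p d where pd: "f = to_fract p / to_fract d" "d \<noteq> 0" "degree p \<le> degree d" by blast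
  have cross: "rf_num f * d = p * rf_den f" using rf_num_den_cross pd by blast
  show "\<not> rf_pole_inf f"
  proof (cases "rf_num f = 0")
    case True then show ?thesis by (simp add: rf_pole_inf_def)
  next
    case False
    then have "p \<noteq> 0" using cross pd(2) by auto
    then have "degree (rf_num f) + degree d = degree p + degree (rf_den f)"
      using arg_cong[OF cross, of degree] False pd(2) by (simp add: degree_mult_eq)
    then show ?thesis using pd(3) by (simp add: rf_pole_inf_def)
  qed
qed

lemma not_pole_to_fract [simp]: "\<not> rf_pole (to_fract p) z"
  unfolding not_pole_iff by (rule exI[of _ p], rule exI[of _ 1]) simp

lemma not_pole_add:
  assumes "\<not> rf_pole f z" "\<not> rf_pole g z"
  shows "\<not> rf_pole (f + g) z"
proof -
  obtain p d q e where *: "f = to_fract p / to_fract d" "poly d z \<noteq> 0"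
    "g = to_fract q / to_fract e" "poly e z \<noteq> 0"
    using assms unfolding not_pole_iff by blast
  then have "d \<noteq> 0" "e \<noteq> 0" by auto
  then have "f + g = to_fract (p * e + q * d) / to_fract (d * e)"
    unfolding *(1,3) by (simp add: field_simps)
  moreover have "poly (d * e) z \<noteq> 0" using * by simp
  ultimately show ?thesis unfolding not_pole_iff by blast
qed

lemma not_pole_mult:
  assumes "\<not> rf_pole f z" "\<not> rf_pole g z"
  shows "\<not> rf_pole (f * g) z"
proof -
  obtain p d q e where *: "f = to_fract p / to_fract d" "poly d z \<noteq> 0"
    "g = to_fract q / to_fract e" "poly e z \<noteq> 0"
    using assms unfolding not_pole_iff by blast
  then have "f * g = to_fract (p * q) / to_fract (d * e)" by simp
  moreover have "poly (d * e) z \<noteq> 0" using * by simp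
  ultimately show ?thesis unfolding not_pole_iff by blast
qed

lemma not_pole_inf_add:
  assumes "\<not> rf_pole_inf f" "\<not> rf_pole_inf g"
  shows "\<not> rf_pole_inf (f + g)"
proof -
  obtain p d q e where *: "f = to_fract p / to_fract d" "d \<noteq> 0" "degree p \<le> degree d"
    "g = to_fract q / to_fract e" "e \<noteq> 0" "degree q \<le> degree e"
    using assms unfolding not_pole_inf_iff by blast
  have "f + g = to_fract (p * e + q * d) / to_fract (d * e)"
    unfolding *(1,4) using *(2,5) by (simp add: field_simps)
  moreover have "degree (p * e + q * d) \<le> degree (d * e)"
  proof (rule degree_add_le)
    show "degree (p * e) \<le> degree (d * e)" "degree (q * d) \<le> degree (d * e)"
      using * by (auto simp: degree_mult_eq intro: order_trans[OF degree_mult_le])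
  qed
  ultimately show ?thesis unfolding not_pole_inf_iff using *(2,5) by (metis mult_eq_0_iff)
qed

lemma not_pole_inf_mult:
  assumes "\<not> rf_pole_inf f" "\<not> rf_pole_inf g"
  shows "\<not> rf_pole_inf (f * g)"
proof -
  obtain p d q e where *: "f = to_fract p / to_fract d" "d \<noteq> 0" "degree p \<le> degree d"
    "g = to_fract q / to_fract e" "e \<noteq> 0" "degree q \<le> degree e"
    using assms unfolding not_pole_inf_iff by blast
  have "f * g = to_fract (p * q) / to_fract (d * e)" unfolding *(1,4) by simp
  moreover have "degree (p * q) \<le> degree (d * e)"
    using * by (auto simp: degree_mult_eq intro: order_trans[OF degree_mult_le])
  ultimately show ?thesis unfolding not_pole_inf_iff using *(2,5) by (metis mult_eq_0_iff)
qed

section \<open>Functions analytic in the disc and functions analytic outside it\<close>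

text \<open>The rational functions split along the unit circle. \<open>Hplus\<close> are those of the Hardy space of the disc, \<open>Hminus\<close> the proper
  ones with all poles in the open disc, and \<open>Hstrict\<close> those of the latter that vanish at infinity.\<close>

definition Hplus :: "ratfun set" where
  "Hplus = {f. \<forall>z. cmod z \<le> 1 \<longrightarrow> \<not> rf_pole f z}"

definition Hminus :: "ratfun set" where
  "Hminus = {f. (\<forall>z. cmod z \<ge> 1 \<longrightarrow> \<not> rf_pole f z) \<and> \<not> rf_pole_inf f}"

definition Hstrict :: "ratfun set" where
  "Hstrict = {f. rf_z * f \<in> Hminus}"

definition ring_closed :: "ratfun set \<Rightarrow> bool" where
  "ring_closed S \<longleftrightarrow> range rf_const \<subseteq> S \<and> (\<forall>f \<in> S. \<forall>g \<in> S. f + g \<in> S \<and> f * g \<in> S)"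

lemma not_pole_inf_const [simp]: "\<not> rf_pole_inf (rf_const c)"
  unfolding not_pole_inf_iff rf_const_def
  by (rule exI[of _ "[:c:]"], rule exI[of _ 1]) simp

lemma ring_closed_Hplus: "ring_closed Hplus"
  unfolding ring_closed_def Hplus_def by (auto simp: not_pole_add not_pole_mult rf_const_def)

lemma ring_closed_Hminus: "ring_closed Hminus"
  unfolding ring_closed_def Hminus_def
  using not_pole_inf_add not_pole_inf_mult not_pole_add not_pole_mult not_pole_inf_const not_pole_to_fract
  by (auto simp: rf_const_def)

interpretation rf_const: field_hom rf_const
proof unfold_locales
  fix a b
  show "rf_const (a + b) = rf_const a + rf_const b"
    unfolding rf_const_def to_fract_add[symmetric] by simp
  show "rf_const (a * b) = rf_const a * rf_const b"
    unfolding rf_const_def to_fract_mult[symmetric] by simp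
qed (simp_all add: rf_const_def flip: one_pCons)

lemma ring_closedD:
  assumes "ring_closed S"
  shows "rf_const c \<in> S" "f \<in> S \<Longrightarrow> g \<in> S \<Longrightarrow> f + g \<in> S" "f \<in> S \<Longrightarrow> g \<in> S \<Longrightarrow> f * g \<in> S"
    "0 \<in> S" "1 \<in> S"
proof -
  show "rf_const c \<in> S" for c using assms by (auto simp: ring_closed_def)
  from this[of 0] this[of 1] show "0 \<in> S" "1 \<in> S" by simp_all
qed (use assms in \<open>auto simp: ring_closed_def\<close>)

lemmas Hplus_closed = ring_closedD[OF ring_closed_Hplus]

lemmas Hminus_closed = ring_closedD[OF ring_closed_Hminus]

lemma Hplus_minus: "f \<in> Hplus \<Longrightarrow> g \<in> Hplus \<Longrightarrow> f - g \<in> Hplus"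
  using Hplus_closed(2)[of f "rf_const (-1) * g"] Hplus_closed(1)[of "-1"] Hplus_closed(3)[of "-1" g]
  by (simp add: rf_const.hom_uminus)

lemma Hminus_minus: "f \<in> Hminus \<Longrightarrow> g \<in> Hminus \<Longrightarrow> f - g \<in> Hminus"
  using Hminus_closed(2)[of f "rf_const (-1) * g"] Hminus_closed(1)[of "-1"] Hminus_closed(3)[of "-1" g]
  by (simp add: rf_const.hom_uminus)

lemma rf_z_Hplus: "rf_z \<in> Hplus"
  by (simp add: Hplus_def rf_z_def)

lemma inverse_rf_z_Hminus: "inverse rf_z \<in> Hminus"
proof -
  have *: "inverse rf_z = to_fract 1 / to_fract [:0, 1:]" by (simp add: rf_z_def field_simps)
  have "\<not> rf_pole (inverse rf_z) z" if "cmod z \<ge> 1" for z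
    unfolding not_pole_iff using * that
    by (intro exI[of _ 1] exI[of _ "[:0,1:]"]) auto
  moreover have "\<not> rf_pole_inf (inverse rf_z)"
    unfolding not_pole_inf_iff using *
    by (intro exI[of _ 1] exI[of _ "[:0,1:]"]) auto
  ultimately show ?thesis by (simp add: Hminus_def)
qed

lemma rf_pole_inf_z: "rf_pole_inf rf_z"
  by (simp add: rf_pole_inf_def rf_z_def rf_num_def rf_den_def)

text \<open>Liouville's theorem for rational functions: a denominator without roots is constant, and properness then makes the
  numerator constant as well.\<close>

lemma Hplus_Hminus_const:
  assumes "f \<in> Hplus" "f \<in> Hminus"
  obtains c where "f = rf_const c"
proof -
  have np: "\<not> rf_pole f z" for z using assms by (cases "cmod z \<le> 1") (auto simp: Hplus_def Hminus_def)
  have "degree (rf_den f) = 0"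
    using np by (metis rf_pole_def fundamental_theorem_of_algebra constant_degree)
  then obtain b where b: "rf_den f = [:b:]" by (rule degree_eq_zeroE)
  have "degree (rf_num f) = 0" using assms(2) \<open>degree (rf_den f) = 0\<close> by (auto simp: Hminus_def rf_pole_inf_def)
  then obtain a where a: "rf_num f = [:a:]" by (rule degree_eq_zeroE)
  have "f = rf_const a / rf_const b" using rf_eq_num_den[of f] a b by (simp add: rf_const_def)
  then have "f = rf_const (a / b)" by (simp add: rf_const.hom_div)
  then show thesis by (rule that)
qed

lemma Hstrict_imp_Hminus: "f \<in> Hstrict \<Longrightarrow> f \<in> Hminus"
  using Hminus_closed(3)[OF inverse_rf_z_Hminus, of "rf_z * f"]
  by (simp add: Hstrict_def mult.assoc[symmetric])

lemma Hstrict_add: "f \<in> Hstrict \<Longrightarrow> g \<in> Hstrict \<Longrightarrow> f + g \<in> Hstrict"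
  by (simp add: Hstrict_def Hminus_closed distrib_left)

lemma Hstrict_minus: "f \<in> Hstrict \<Longrightarrow> g \<in> Hstrict \<Longrightarrow> f - g \<in> Hstrict"
  by (simp add: Hstrict_def Hminus_minus right_diff_distrib)

lemma Hstrict_zero [simp]: "0 \<in> Hstrict"
  by (simp add: Hstrict_def Hminus_closed)

lemma Hstrict_mult: "f \<in> Hminus \<Longrightarrow> g \<in> Hstrict \<Longrightarrow> f * g \<in> Hstrict"
  by (metis Hminus_closed(3) Hstrict_def mem_Collect_eq mult.left_commute)

lemma rf_const_Hstrict [simp]: "rf_const c \<in> Hstrict \<longleftrightarrow> c = 0"
proof
  assume "rf_const c \<in> Hstrict"
  show "c = 0"
  proof (rule ccontr)
    assume "c \<noteq> 0"
    have "rf_const (inverse c) * (rf_z * rf_const c) \<in> Hminus"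
      using \<open>rf_const c \<in> Hstrict\<close> by (intro Hminus_closed(3)[OF Hminus_closed(1)]) (simp add: Hstrict_def)
    also have "rf_const (inverse c) * (rf_z * rf_const c) = rf_z * rf_const (inverse c * c)"
      by (simp only: rf_const.hom_mult mult_ac)
    also have "\<dots> = rf_z" using \<open>c \<noteq> 0\<close> by simp
    finally show False using rf_pole_inf_z by (simp add: Hminus_def)
  qed
qed simp

lemma Hplus_Hstrict_zero:
  assumes "f \<in> Hplus" "f \<in> Hstrict"
  shows "f = 0"
  using Hplus_Hminus_const[OF assms(1) Hstrict_imp_Hminus[OF assms(2)]] assms(2)
  by (metis rf_const.hom_zero rf_const_Hstrict)

lemma rf_z_power_Hplus: "rf_z ^ k \<in> Hplus"
  by (induct k) (simp_all add: Hplus_closed rf_z_Hplus)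

lemma inverse_rf_z_power_Hminus: "inverse rf_z ^ k \<in> Hminus"
  by (induct k) (simp_all add: Hminus_closed inverse_rf_z_Hminus)

lemma rf_z_powi_Hplus: "k \<ge> 0 \<Longrightarrow> rf_z powi k \<in> Hplus"
  using rf_z_power_Hplus[of "nat k"] by (auto simp: power_int_def)

text \<open>Subtracting the quotient of the leading coefficients lowers the degree of the numerator.\<close>

lemma Hminus_value_at_infinity:
  assumes "f \<in> Hminus"
  obtains c where "f - rf_const c \<in> Hstrict"
proof -
  define p d where "p = rf_num f" and "d = rf_den f"
  have f: "f = to_fract p / to_fract d" and d: "d \<noteq> 0"
    using rf_eq_num_den[of f] by (simp_all add: p_def d_def)
  have deg: "degree p \<le> degree d" using assms by (simp add: Hminus_def rf_pole_inf_def p_def d_def)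
  define c where "c = coeff p (degree d) / lead_coeff d"
  define r where "r = p - smult c d"
  have "degree r \<le> degree d" unfolding r_def using deg by (intro degree_diff_le) auto
  moreover have "coeff r (degree d) = 0" using d by (simp add: r_def c_def)
  ultimately have r: "r = 0 \<or> degree r < degree d"
    by (metis le_neq_implies_less leading_coeff_0_iff)
  have "smult c d = [:c:] * d" by simp
  then have fc: "f - rf_const c = to_fract r / to_fract d"
    using d unfolding f r_def rf_const_def by (simp only: to_fract_diff to_fract_mult) (simp add: field_simps)
  have "degree ([:0, 1:] * r) \<le> degree d"
    using r by (cases "r = 0") (auto simp: degree_mult_eq)
  moreover have "rf_z * (f - rf_const c) = to_fract ([:0, 1:] * r) / to_fract d"
    by (simp only: fc to_fract_mult) (simp add: rf_z_def)
  ultimately have "\<not> rf_pole_inf (rf_z * (f - rf_const c))"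
    using d not_pole_inf_iff by blast
  moreover have "f - rf_const c \<in> Hminus" using assms by (simp add: Hminus_minus Hminus_closed)
  ultimately have "rf_z * (f - rf_const c) \<in> Hminus"
    unfolding Hminus_def using not_pole_mult[of rf_z _ "f - rf_const c"] by (auto simp: rf_z_def)
  then show thesis using that by (simp add: Hstrict_def)
qed

text \<open>On \<open>Hminus\<close> this is a linear functional with kernel \<open>Hstrict\<close>. It plays the part of "leading coefficient": for a polynomial
  \<open>p\<close> of degree at most \<open>n\<close> it maps \<open>z\<^sup>-\<^sup>n p\<close> to the coefficient of \<open>z\<^sup>n\<close>.\<close>

definition value_at_infinity :: "ratfun \<Rightarrow> complex" where
  "value_at_infinity f = (THE k. f - rf_const k \<in> Hstrict)"

lemma value_at_infinity_eqI:
  assumes "f - rf_const k \<in> Hstrict"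
  shows "value_at_infinity f = k"
  unfolding value_at_infinity_def
proof (rule the_equality)
  fix l assume "f - rf_const l \<in> Hstrict"
  then have "(f - rf_const k) - (f - rf_const l) \<in> Hstrict" using assms Hstrict_minus by blast
  then have "rf_const (l - k) \<in> Hstrict" by (simp add: rf_const.hom_minus)
  then show "l = k" by simp
qed fact

lemma value_at_infinity:
  assumes "f \<in> Hminus"
  shows "f - rf_const (value_at_infinity f) \<in> Hstrict"
proof -
  from Hminus_value_at_infinity[OF assms] obtain k where "f - rf_const k \<in> Hstrict" .
  with value_at_infinity_eqI[OF this] show ?thesis by simp
qed

lemma value_at_infinity_eq_0_iff:
  assumes "f \<in> Hminus"
  shows "value_at_infinity f = 0 \<longleftrightarrow> f \<in> Hstrict"
  using value_at_infinity[OF assms] value_at_infinity_eqI[of f 0] by auto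

lemma value_at_infinity_add:
  assumes "f \<in> Hminus" "g \<in> Hminus"
  shows "value_at_infinity (f + g) = value_at_infinity f + value_at_infinity g"
proof (rule value_at_infinity_eqI)
  have "(f - rf_const (value_at_infinity f)) + (g - rf_const (value_at_infinity g)) \<in> Hstrict"
    using assms by (intro Hstrict_add value_at_infinity)
  then show "f + g - rf_const (value_at_infinity f + value_at_infinity g) \<in> Hstrict"
    by (simp add: rf_const.hom_add algebra_simps)
qed

lemma value_at_infinity_mult:
  assumes "f \<in> Hminus"
  shows "value_at_infinity (rf_const k * f) = k * value_at_infinity f"
proof (rule value_at_infinity_eqI)
  have "rf_const k * (f - rf_const (value_at_infinity f)) \<in> Hstrict"
    using assms by (intro Hstrict_mult Hminus_closed(1) value_at_infinity)
  then show "rf_const k * f - rf_const (k * value_at_infinity f) \<in> Hstrict"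
    by (simp add: rf_const.hom_mult algebra_simps)
qed

text \<open>Partial fractions. The denominators of the two factors have no common root, because their roots are separated by
  the unit circle, so a Bezout identity splits the product.\<close>

lemma mult_Hplus_Hstrict_split:
  assumes "a \<in> Hplus" "b \<in> Hstrict"
  obtains f g where "f \<in> Hplus" "g \<in> Hstrict" "a * b = f + g"
proof -
  define p d where "p = rf_num a" and "d = rf_den a"
  have a: "a = to_fract p / to_fract d" and d: "d \<noteq> 0"
    using rf_eq_num_den[of a] by (simp_all add: p_def d_def)
  have d0: "cmod z \<le> 1 \<Longrightarrow> poly d z \<noteq> 0" for z
    using assms(1) by (simp add: Hplus_def rf_pole_def d_def)
  define q e where "q = rf_num b" and "e = rf_den b"
  have b: "b = to_fract q / to_fract e" and e: "e \<noteq> 0"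
    using rf_eq_num_den[of b] by (simp_all add: q_def e_def)
  have e0: "cmod z \<ge> 1 \<Longrightarrow> poly e z \<noteq> 0" for z
    using Hstrict_imp_Hminus[OF assms(2)] by (simp add: Hminus_def rf_pole_def e_def)
  have "coprime d e"
  proof (rule coprimeI)
    fix c assume "c dvd d" "c dvd e"
    then have "poly c z \<noteq> 0" for z
      using d0[of z] e0[of z] by (cases "cmod z \<le> 1") (auto elim!: dvdE)
    then have "degree c = 0" by (metis fundamental_theorem_of_algebra constant_degree)
    moreover have "c \<noteq> 0" using \<open>c dvd d\<close> d by auto
    ultimately show "is_unit c" by (simp add: is_unit_iff_degree)
  qed
  then obtain r s where rs: "r * d + s * e = 1"
    by (metis bezout_coefficients_fst_snd coprime_iff_gcd_eq_1)
  \<comment> \<open>The summand with denominator \<open>e\<close>, once made proper by division with remainder, is the strictly proper part.\<close>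
  define t where "t = p * q * r"
  define f where "f = to_fract (p * q * s) / to_fract d + to_fract (t div e)"
  define g where "g = to_fract (t mod e) / to_fract e"
  have "a * b = to_fract (p * q * (r * d + s * e)) / to_fract (d * e)"
    unfolding a b rs by simp
  also have "\<dots> = to_fract (p * q * s) / to_fract d + to_fract t / to_fract e"
    using d e by (simp add: t_def field_simps)
  also have "to_fract t = to_fract (e * (t div e) + t mod e)" by simp
  also have "\<dots> / to_fract e = to_fract (t div e) + g"
    unfolding g_def using e by (simp only: to_fract_add to_fract_mult) (simp add: field_simps)
  finally have split: "a * b = f + g" by (simp add: f_def)
  have "\<not> rf_pole (to_fract (p * q * s) / to_fract d) z" if "cmod z \<le> 1" for z
    unfolding not_pole_iff using d0[OF that] by blast
  then have "f \<in> Hplus" unfolding f_def Hplus_def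
    using not_pole_add not_pole_to_fract by (auto simp del: to_fract_mult)
  moreover have "g \<in> Hstrict"
  proof -
    have "rf_z * g = to_fract ([:0, 1:] * (t mod e)) / to_fract e"
      by (simp only: g_def to_fract_mult) (simp add: rf_z_def)
    moreover have "degree ([:0, 1:] * (t mod e)) \<le> degree e"
      using degree_mod_less[OF e, of t] by (cases "t mod e = 0") (auto simp: degree_mult_eq)
    ultimately have "\<not> rf_pole_inf (rf_z * g)" "cmod z \<ge> 1 \<Longrightarrow> \<not> rf_pole (rf_z * g) z" for z
      using e e0 not_pole_inf_iff not_pole_iff by blast+
    then show ?thesis by (simp add: Hstrict_def Hminus_def)
  qed
  ultimately show thesis using split that by blast
qed

section \<open>The adjoint of a scalar rational function\<close>

lemma poly_star_0 [simp]: "poly_star 0 = 0"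
  by (simp add: poly_star_def)

lemma poly_star_pCons: "poly_star (pCons a p) = rf_const (cnj a) + inverse rf_z * poly_star p"
  by (cases "a = 0 \<and> p = 0") (auto simp: poly_star_def map_poly_pCons)

lemma poly_star_add: "poly_star (p + q) = poly_star p + poly_star q"
  by (induct p q rule: poly_induct2) (simp_all add: poly_star_pCons rf_const.hom_add algebra_simps)

lemma poly_star_smult: "poly_star (Polynomial.smult c p) = rf_const (cnj c) * poly_star p"
  by (induct p) (simp_all add: poly_star_pCons rf_const.hom_mult algebra_simps)

lemma poly_star_mult: "poly_star (p * q) = poly_star p * poly_star q"
  by (induct p) (simp_all add: poly_star_pCons poly_star_add poly_star_smult algebra_simps)

lemma to_fract_pCons: "to_fract (pCons a p) = rf_const a + rf_z * to_fract p"
proof -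
  have "pCons a p = [:a:] + [:0, 1:] * p" by simp
  then show ?thesis unfolding rf_const_def rf_z_def by (metis to_fract_add to_fract_mult)
qed

text \<open>Clearing denominators in \<open>p (1 / z)\<close> reverses the order of the coefficients.\<close>

lemma poly_star_reflect:
  "rf_z ^ degree p * poly_star p = to_fract (reflect_poly (map_poly cnj p))"
proof -
  let ?h = "\<lambda>c. rf_const (cnj c)"
  have [simp]: "degree (map_poly ?h p) = degree p"  "degree (map_poly cnj p) = degree p"
    by (rule map_poly_degree_eq degree_map_poly, auto simp: )+
  have ev: "poly (map_poly rf_const r) rf_z = to_fract r" for r
    by (induct r) (simp_all add: map_poly_pCons to_fract_pCons)
  have "reflect_poly (map_poly ?h p) = map_poly rf_const (reflect_poly (map_poly cnj p))"
    by (rule poly_eqI) (auto simp: coeff_reflect_poly coeff_map_poly)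
  then have "rf_z ^ degree p * poly (map_poly ?h p) (inverse rf_z)
      = poly (map_poly rf_const (reflect_poly (map_poly cnj p))) rf_z"
    using poly_reflect_poly_nz[of rf_z "map_poly ?h p"] by simp
  then show ?thesis by (simp add: poly_star_def ev)
qed

lemma poly_star_eq_0 [simp]: "poly_star p = 0 \<longleftrightarrow> p = 0"
proof
  assume "poly_star p = 0"
  then have "reflect_poly (map_poly cnj p) = 0" using poly_star_reflect[of p] by simp
  then have "map_poly cnj p = 0" by simp
  then show "p = 0" by (metis coeff_map_poly complex_cnj_zero complex_cnj_zero_iff leading_coeff_0_iff coeff_0)
qed simp

lemma rf_star_fract:
  assumes "d \<noteq> 0"
  shows "rf_star (to_fract p / to_fract d) = poly_star p / poly_star d"
proof -
  define f where "f = to_fract p / to_fract d"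
  have "rf_num f * d = p * rf_den f" using rf_num_den_cross[OF f_def assms] .
  then have "poly_star (rf_num f) * poly_star d = poly_star p * poly_star (rf_den f)"
    by (metis poly_star_mult)
  then show ?thesis using assms unfolding f_def[symmetric] rf_star_def by (simp add: field_simps)
qed

lemma rf_star_to_fract: "rf_star (to_fract p) = poly_star p"
  using rf_star_fract[of 1 p] by (simp add: poly_star_pCons[of 1 0, folded one_pCons])

lemma rf_star_const [simp]: "rf_star (rf_const c) = rf_const (cnj c)"
  unfolding rf_const_def[of c] rf_star_to_fract by (simp add: poly_star_pCons)

lemma rf_star_z [simp]: "rf_star rf_z = inverse rf_z"
  unfolding rf_z_def[unfolded atomize_eq] rf_star_to_fract by (simp add: poly_star_pCons rf_z_def)

lemma rf_star_add: "rf_star (f + g) = rf_star f + rf_star g"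
proof -
  obtain p d q e where *: "f = to_fract p / to_fract d" "d \<noteq> 0" "g = to_fract q / to_fract e" "e \<noteq> 0"
    using rf_eq_num_den rf_den_nonzero by metis
  have "f + g = to_fract (p * e + q * d) / to_fract (d * e)"
    unfolding *(1,3) using *(2,4) by (simp add: field_simps)
  then have "rf_star (f + g) = poly_star (p * e + q * d) / poly_star (d * e)"
    using *(2,4) by (simp only: rf_star_fract mult_eq_0_iff simp_thms)
  also have "\<dots> = poly_star p / poly_star d + poly_star q / poly_star e"
    using *(2,4) by (simp add: poly_star_add poly_star_mult field_simps)
  finally show ?thesis using * by (simp add: rf_star_fract)
qed

lemma rf_star_mult: "rf_star (f * g) = rf_star f * rf_star g"
proof -
  obtain p d q e where *: "f = to_fract p / to_fract d" "d \<noteq> 0" "g = to_fract q / to_fract e" "e \<noteq> 0"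
    using rf_eq_num_den rf_den_nonzero by metis
  have "f * g = to_fract (p * q) / to_fract (d * e)"
    unfolding *(1,3) by simp
  then show ?thesis using * rf_star_fract[of "d * e" "p * q"]
    by (simp add: rf_star_fract poly_star_mult)
qed

interpretation rf_star: field_hom rf_star
  by unfold_locales (use rf_star_const[of 0] rf_star_const[of 1] in \<open>simp_all add: rf_star_add rf_star_mult\<close>)

lemma rf_star_star [simp]: "rf_star (rf_star f) = f"
proof -
  have *: "rf_star (poly_star p) = to_fract p" for p
    by (induct p) (simp_all add: poly_star_pCons to_fract_pCons rf_star.hom_add rf_star.hom_mult rf_star.hom_inverse)
  have "rf_star (rf_star f) = rf_star (poly_star (rf_num f) / poly_star (rf_den f))"
    by (simp only: rf_star_def[of f])
  also have "\<dots> = f" by (simp only: rf_star.hom_div * flip: rf_eq_num_den)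
  finally show ?thesis .
qed

text \<open>This form of the adjoint is again a quotient of polynomials, so that its poles can be read off.\<close>

lemma rf_star_fract_reflect:
  assumes "d \<noteq> 0"
  shows "rf_star (to_fract p / to_fract d) =
    to_fract (monom 1 (degree d) * reflect_poly (map_poly cnj p)) /
    to_fract (monom 1 (degree p) * reflect_poly (map_poly cnj d))"
proof -
  have "to_fract (monom 1 n) = rf_z ^ n" for n
    by (induct n) (simp_all add: monom_Suc to_fract_pCons)
  then show ?thesis using assms
    by (simp add: rf_star_fract field_simps flip: poly_star_reflect)
qed

lemma degree_map_poly_cnj [simp]: "degree (map_poly cnj p) = degree p"
  by (rule degree_map_poly) auto

lemma poly_reflect_cnj:
  assumes "z \<noteq> 0"
  shows "poly (reflect_poly (map_poly cnj d)) z = z ^ degree d * cnj (poly d (1 / cnj z))"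
proof -
  have "poly (map_poly cnj d) w = cnj (poly d (cnj w))" for w
    by (induct d) (simp_all add: map_poly_pCons)
  then show ?thesis using poly_reflect_poly_nz[OF assms, of "map_poly cnj d"]
    by (simp add: inverse_eq_divide)
qed

text \<open>The reflection \<open>z \<mapsto> 1 / cnj z\<close> in the unit circle maps poles of the adjoint to poles of the function; the following
  two lemmas are the cases where the point or its reflection is infinity.\<close>

lemma rf_star_not_pole:
  assumes "\<not> rf_pole f (1 / cnj z)" "z \<noteq> 0"
  shows "\<not> rf_pole (rf_star f) z"
proof -
  obtain p d where *: "f = to_fract p / to_fract d" "poly d (1 / cnj z) \<noteq> 0"
    using assms unfolding not_pole_iff by blast
  then have "d \<noteq> 0" by auto
  show ?thesis unfolding not_pole_iff *(1) rf_star_fract_reflect[OF \<open>d \<noteq> 0\<close>]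
    by (intro exI conjI, rule refl) (use * assms(2) in \<open>simp add: poly_monom poly_reflect_cnj\<close>)
qed

lemma rf_star_not_pole_0:
  assumes "\<not> rf_pole_inf f"
  shows "\<not> rf_pole (rf_star f) 0"
proof -
  obtain p d where *: "f = to_fract p / to_fract d" "d \<noteq> 0" "degree p \<le> degree d"
    using assms unfolding not_pole_inf_iff by blast
  have "monom (1::complex) (degree d) = monom 1 (degree p) * monom 1 (degree d - degree p)"
    using *(3) by (simp add: mult_monom)
  then have "rf_star f = to_fract (monom 1 (degree d - degree p) * reflect_poly (map_poly cnj p)) /
      to_fract (reflect_poly (map_poly cnj d))"
    unfolding *(1) rf_star_fract_reflect[OF *(2)] by (simp add: monom_eq_0_iff)
  moreover have "poly (reflect_poly (map_poly cnj d)) 0 \<noteq> 0"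
    using *(2) by (simp add: coeff_map_poly)
  ultimately show ?thesis unfolding not_pole_iff by blast
qed

lemma rf_star_not_pole_inf:
  assumes "\<not> rf_pole f 0"
  shows "\<not> rf_pole_inf (rf_star f)"
proof -
  obtain p d where *: "f = to_fract p / to_fract d" "poly d 0 \<noteq> 0"
    using assms unfolding not_pole_iff by blast
  then have "d \<noteq> 0" by auto
  have "coeff (map_poly cnj d) 0 \<noteq> 0" using *(2) by (simp add: coeff_map_poly poly_0_coeff_0)
  then have "degree (monom 1 (degree p) * reflect_poly (map_poly cnj d)) = degree p + degree d"
    by (subst degree_mult_eq) (auto simp: degree_monom_eq monom_eq_0_iff)
  moreover have "degree (monom 1 (degree d) * reflect_poly (map_poly cnj p)) \<le> degree d + degree p"
    by (rule order_trans[OF degree_mult_le])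
       (use degree_reflect_poly_le[of "map_poly cnj p"] in \<open>simp add: degree_monom_eq\<close>)
  moreover have "monom 1 (degree p) * reflect_poly (map_poly cnj d) \<noteq> 0"
    using \<open>coeff (map_poly cnj d) 0 \<noteq> 0\<close> by (auto simp: monom_eq_0_iff)
  ultimately show ?thesis unfolding not_pole_inf_iff *(1) rf_star_fract_reflect[OF \<open>d \<noteq> 0\<close>]
    by (metis add.commute)
qed

lemma rf_star_Hplus:
  assumes "f \<in> Hplus"
  shows "rf_star f \<in> Hminus"
proof -
  have "\<not> rf_pole (rf_star f) z" if "cmod z \<ge> 1" for z
  proof (rule rf_star_not_pole)
    have "cmod (1 / cnj z) \<le> 1" using that by (simp add: norm_divide divide_le_eq)
    then show "\<not> rf_pole f (1 / cnj z)" using assms by (simp add: Hplus_def)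
  qed (use that in auto)
  moreover have "\<not> rf_pole_inf (rf_star f)"
    using assms by (intro rf_star_not_pole_inf) (simp add: Hplus_def)
  ultimately show ?thesis by (simp add: Hminus_def)
qed

lemma rf_star_Hminus:
  assumes "f \<in> Hminus"
  shows "rf_star f \<in> Hplus"
proof -
  have "\<not> rf_pole (rf_star f) z" if "cmod z \<le> 1" for z
  proof (cases "z = 0")
    case True
    then show ?thesis using assms by (simp add: rf_star_not_pole_0 Hminus_def)
  next
    case False
    then have "cmod (1 / cnj z) \<ge> 1" using that by (simp add: norm_divide)
    then show ?thesis using assms False by (intro rf_star_not_pole) (auto simp: Hminus_def)
  qed
  then show ?thesis by (simp add: Hplus_def)
qed

section \<open>Dimensions of subspaces of complex n-space\<close>

definition linear_subspace :: "nat \<Rightarrow> complex vec set \<Rightarrow> bool" where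
  "linear_subspace n S \<longleftrightarrow> VectorSpace.subspace class_ring S (module_vec TYPE(complex) n)"

lemma linear_subspaceI:
  assumes "S \<subseteq> carrier_vec n" "0\<^sub>v n \<in> S"
    "\<And>x y. x \<in> S \<Longrightarrow> y \<in> S \<Longrightarrow> x + y \<in> S" "\<And>a x. x \<in> S \<Longrightarrow> a \<cdot>\<^sub>v x \<in> S"
  shows "linear_subspace n S"
proof -
  interpret vec_space "TYPE(complex)" n .
  show ?thesis
    unfolding linear_subspace_def VectorSpace.subspace_def submodule_def
    using assms vec_module vec_vs by (auto simp: module_vec_simps)
qed

lemma linear_subspaceD:
  assumes "linear_subspace n S"
  shows "S \<subseteq> carrier_vec n" "0\<^sub>v n \<in> S"
    "\<And>x y. x \<in> S \<Longrightarrow> y \<in> S \<Longrightarrow> x + y \<in> S" "\<And>a x. x \<in> S \<Longrightarrow> a \<cdot>\<^sub>v x \<in> S"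
  using assms unfolding linear_subspace_def VectorSpace.subspace_def submodule_def
  by (auto simp: module_vec_simps)

text \<open>A maximal linearly independent subset generates, and the dimension of the ambient space bounds its size.\<close>

lemma linear_subspace_fin_dim:
  assumes "linear_subspace n S"
  shows "vectorspace.fin_dim class_ring ((module_vec TYPE(complex) n)\<lparr>carrier := S\<rparr>)"
proof -
  interpret vec_space "TYPE(complex)" n .
  have sub: "VectorSpace.subspace class_ring S V"
    using assms by (simp add: linear_subspace_def)
  interpret S: vectorspace class_ring "vs S" using sub by (rule subspace_is_vs)
  have SV: "S \<subseteq> carrier V" using linear_subspaceD(1)[OF assms] by simp
  have li: "finite A \<and> card A \<le> n" if "A \<subseteq> S \<and> S.lin_indpt A" for A
  proof -
    have "lin_indpt A"
      using that span_li_not_depend(2)[OF _ sub[unfolded VectorSpace.subspace_def, THEN conjunct2]] by auto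
    moreover have "A \<subseteq> carrier V" using that SV by (auto simp: subset_iff)
    ultimately show ?thesis using li_le_dim[OF fin_dim, of A] unfolding dim_is_n by simp
  qed
  have "S.lin_indpt {}" by (simp add: S.lin_dep_def)
  then obtain A where A: "finite A" "maximal A (\<lambda>A. A \<subseteq> S \<and> S.lin_indpt A)"
    using maximal_exists[of "\<lambda>A. A \<subseteq> S \<and> S.lin_indpt A" n "{}"] li by auto
  then have "S.gen_set A" using S.max_li_is_gen[of A] by auto
  moreover have "A \<subseteq> S" using A by (auto simp: maximal_def)
  ultimately show ?thesis unfolding S.fin_dim_def using A(1) by auto
qed

lemma subspace_dim_mono:
  assumes "linear_subspace n S" "linear_subspace n T" "T \<subseteq> S"
  shows "subspace_dim n T \<le> subspace_dim n S"
proof -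
  interpret vec_space "TYPE(complex)" n .
  have sub: "VectorSpace.subspace class_ring S V" "VectorSpace.subspace class_ring T V"
    using assms by (auto simp: linear_subspace_def)
  interpret S: vectorspace class_ring "vs S" using sub(1) by (rule subspace_is_vs)
  have TS: "VectorSpace.subspace class_ring T (vs S)"
    using nested_subspaces[OF sub assms(3)] .
  have "vectorspace.fin_dim class_ring (vs S\<lparr>carrier := T\<rparr>)"
    using linear_subspace_fin_dim[OF assms(2)] by simp
  from S.subspace_dim[OF TS linear_subspace_fin_dim[OF assms(1)] this]
  show ?thesis by (simp add: subspace_dim_def)
qed

lemma subspace_dim_carrier: "subspace_dim n (carrier_vec n) = n"
proof -
  interpret vec_space "TYPE(complex)" n .
  have "vs (carrier_vec n) = V" by (simp add: module_vec_def)
  then show ?thesis using dim_is_n unfolding subspace_dim_def by (simp only:)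
qed

text \<open>Every dimension in this development is compared through this form of the rank-nullity theorem.\<close>

lemma subspace_dim_rank_nullity:
  assumes S: "linear_subspace n S"
    and add: "\<And>x y. x \<in> S \<Longrightarrow> y \<in> S \<Longrightarrow> f (x + y) = f x + f y"
    and smult: "\<And>a x. x \<in> S \<Longrightarrow> f (a \<cdot>\<^sub>v x) = a \<cdot>\<^sub>v f x"
    and surj: "f ` S = carrier_vec c"
  shows "subspace_dim n S = subspace_dim n {x \<in> S. f x = 0\<^sub>v c} + c"
proof -
  interpret vec_space "TYPE(complex)" n .
  interpret C: vec_space "TYPE(complex)" c .
  have sub: "VectorSpace.subspace class_ring S V"
    using S by (simp add: linear_subspace_def)
  interpret S: vectorspace class_ring "vs S" using sub by (rule subspace_is_vs)
  have hom: "f \<in> LinearCombinations.module_hom class_ring (vs S) C.V"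
    unfolding LinearCombinations.module_hom_def using surj add smult by (auto simp: module_vec_simps)
  interpret L: linear_map class_ring "vs S" C.V f
    unfolding linear_map_def mod_hom_def mod_hom_axioms_def
    using hom S.vectorspace_axioms C.vectorspace_axioms S.module_axioms C.module_axioms by blast
  have "L.imT = carrier_vec c" using L.surj_imp_imT_carrier surj by simp
  then have "subspace_dim c (carrier_vec c) + vectorspace.dim class_ring (vs L.kerT) = S.dim"
    using L.rank_nullity[OF linear_subspace_fin_dim[OF S]] by (simp add: subspace_dim_def)
  moreover have "L.kerT = {x \<in> S. f x = 0\<^sub>v c}"
    by (auto simp: L.ker_def module_vec_simps)
  ultimately show ?thesis by (simp add: subspace_dim_carrier subspace_dim_def[of n])
qed

definition orth :: "nat \<Rightarrow> complex vec set \<Rightarrow> complex vec set" where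
  "orth n S = {x \<in> carrier_vec n. \<forall>y \<in> S. x \<bullet>c y = 0}"

lemma orth_subspace:
  assumes "S \<subseteq> carrier_vec n"
  shows "linear_subspace n (orth n S)"
  using assms unfolding orth_def
  by (intro linear_subspaceI) (auto simp: subset_iff add_scalar_prod_distrib[of _ n])

lemma subspace_dim_hyperplane:
  assumes S: "linear_subspace n S" and b: "b \<in> S" "b \<noteq> 0\<^sub>v n"
  shows "subspace_dim n S = subspace_dim n {x \<in> S. x \<bullet>c b = 0} + 1"
proof -
  note D = linear_subspaceD[OF S]
  have bc: "b \<in> carrier_vec n" using D(1) b(1) by auto
  then have nz: "b \<bullet>c b \<noteq> 0" using b(2) conjugate_square_eq_0_vec by blast
  let ?f = "\<lambda>x. vec 1 (\<lambda>_. x \<bullet>c b)"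
  have "subspace_dim n S = subspace_dim n {x \<in> S. ?f x = 0\<^sub>v 1} + 1"
  proof (rule subspace_dim_rank_nullity[OF S])
    show "?f (x + y) = ?f x + ?f y" if "x \<in> S" "y \<in> S" for x y
      using that D(1) bc by (intro eq_vecI) (auto intro!: add_scalar_prod_distrib[of _ n])
    show "?f (a \<cdot>\<^sub>v x) = a \<cdot>\<^sub>v ?f x" if "x \<in> S" for a x
      using that D(1) bc by (intro eq_vecI) (auto intro!: scalar_prod_smult_left)
    have "v \<in> ?f ` S" if "v \<in> carrier_vec 1" for v
    proof (rule image_eqI)
      let ?x = "(v $ 0 / (b \<bullet>c b)) \<cdot>\<^sub>v b"
      show "?x \<in> S" using D(4) b(1) by auto
      show "v = ?f ?x" using that nz bc by (intro eq_vecI) auto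
    qed
    then show "?f ` S = carrier_vec 1" by auto
  qed
  also have "{x \<in> S. ?f x = 0\<^sub>v 1} = {x \<in> S. x \<bullet>c b = 0}"
    by (auto simp: vec_eq_iff)
  finally show ?thesis .
qed

text \<open>Induction on the dimension: removing a vector \<open>b\<close> from \<open>S\<close>, by passing to \<open>{x \<in> S. x \<bottom> b}\<close>, lowers the dimension of \<open>S\<close>
  by one and adds the direction \<open>b\<close> to the orthogonal complement.\<close>

lemma subspace_dim_orth:
  assumes "linear_subspace n S"
  shows "subspace_dim n S + subspace_dim n (orth n S) = n"
  using assms
proof (induct "subspace_dim n S" arbitrary: S rule: less_induct)
  case less
  note D = linear_subspaceD[OF less.prems]
  show ?case
  proof (cases "S = {0\<^sub>v n}")
    case True
    have "orth n S = carrier_vec n" by (auto simp: True orth_def)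
    moreover have "subspace_dim n S = 0"
    proof -
      have "linear_subspace n (carrier_vec n)" by (rule linear_subspaceI) auto
      from subspace_dim_rank_nullity[OF this, of "\<lambda>x. x" n]
      have "subspace_dim n {x \<in> carrier_vec n. x = 0\<^sub>v n} = 0"
        by (simp add: subspace_dim_carrier)
      moreover have "{x \<in> carrier_vec n. x = 0\<^sub>v n} = S" using True by auto
      ultimately show ?thesis by simp
    qed
    ultimately show ?thesis by (simp add: subspace_dim_carrier)
  next
    case False
    then obtain b where b: "b \<in> S" "b \<noteq> 0\<^sub>v n" using D(2) by auto
    have bc: "b \<in> carrier_vec n" using D(1) b(1) by auto
    then have nz: "b \<bullet>c b \<noteq> 0" using b(2) conjugate_square_eq_0_vec by blast
    define S' where "S' = {x \<in> S. x \<bullet>c b = 0}"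
    have S': "linear_subspace n S'"
      unfolding S'_def using D bc
      by (intro linear_subspaceI) (auto simp: add_scalar_prod_distrib[of _ n] subset_iff)
    have d1: "subspace_dim n S = subspace_dim n S' + 1"
      unfolding S'_def using less.prems b by (rule subspace_dim_hyperplane)
    have S'c: "S' \<subseteq> carrier_vec n" using D(1) by (auto simp: S'_def)
    have flip: "x \<bullet>c y = 0 \<longleftrightarrow> y \<bullet>c x = 0"
      if "x \<in> carrier_vec n" "y \<in> carrier_vec n" for x y :: "complex vec"
    proof -
      have "y \<bullet>c x = conjugate (x \<bullet>c y)"
        using that by (simp add: scalar_prod_def mult.commute)
      then show ?thesis by simp
    qed
    have "b \<in> orth n S'" using bc S'c flip by (auto simp: orth_def S'_def)
    then have d2: "subspace_dim n (orth n S') = subspace_dim n {x \<in> orth n S'. x \<bullet>c b = 0} + 1"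
      using orth_subspace[OF S'c] b(2) by (intro subspace_dim_hyperplane)
    have "{x \<in> orth n S'. x \<bullet>c b = 0} = orth n S"
    proof (intro equalityI subsetI)
      fix x assume "x \<in> orth n S"
      then show "x \<in> {x \<in> orth n S'. x \<bullet>c b = 0}" using b by (auto simp: orth_def S'_def)
    next
      fix x assume x: "x \<in> {x \<in> orth n S'. x \<bullet>c b = 0}"
      then have xc: "x \<in> carrier_vec n" by (auto simp: orth_def)
      have "x \<bullet>c y = 0" if y: "y \<in> S" for y
      proof -
        have yc: "y \<in> carrier_vec n" using y D(1) by auto
        \<comment> \<open>The component of \<open>y\<close> orthogonal to \<open>b\<close> lies in \<open>S'\<close>.\<close>
        define a where "a = (y \<bullet>c b) / (b \<bullet>c b)"
        define y' where "y' = y + (- a) \<cdot>\<^sub>v b"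
        have "y' \<bullet>c b = y \<bullet>c b + (- a) * (b \<bullet>c b)"
          unfolding y'_def using yc bc by (subst add_scalar_prod_distrib[of _ n]) auto
        also have "\<dots> = 0" using nz by (simp add: a_def)
        finally have "y' \<in> S'" using y b D by (auto simp: S'_def y'_def)
        then have "x \<bullet>c y' = 0" using x by (auto simp: orth_def)
        have yd: "y = y' + a \<cdot>\<^sub>v b" unfolding y'_def using yc bc by (intro eq_vecI) auto
        have y'c: "y' \<in> carrier_vec n" using yc bc by (simp add: y'_def)
        have "x \<bullet>c y = x \<bullet>c y' + cnj a * (x \<bullet>c b)"
          unfolding yd using xc y'c bc
          by (simp add: conjugate_add_vec[of _ n] scalar_prod_add_distrib[of _ n] conjugate_smult_vec)
        then show ?thesis using \<open>x \<bullet>c y' = 0\<close> x by simp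
      qed
      then show "x \<in> orth n S" using xc by (auto simp: orth_def)
    qed
    then show ?thesis using less.hyps[OF _ S'] d1 d2 by simp
  qed
qed

lemma linear_subspace_kernel:
  assumes "A \<in> carrier_mat nr n"
  shows "linear_subspace n (mat_kernel A)"
  using assms by (intro linear_subspaceI) (auto simp: mat_kernel mult_add_distrib_mat_vec mult_mat_vec)

lemma linear_subspace_Ker_k:
  assumes "A \<in> carrier_mat n n" "C \<in> carrier_mat nr n"
  shows "linear_subspace n (Ker_k k C A)"
proof -
  have "C * A ^\<^sub>m j \<in> carrier_mat nr n" for j using assms by simp
  note K = linear_subspaceD[OF linear_subspace_kernel[OF this]]
  show ?thesis unfolding Ker_k_def using assms K by (intro linear_subspaceI) auto
qed

lemma mult_append_rows_eq_0:
  assumes P: "P \<in> carrier_mat r1 n" and S: "S \<in> carrier_mat r2 n" and x: "x \<in> carrier_vec n"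
  shows "x \<in> mat_kernel (P @\<^sub>r S) \<longleftrightarrow> P *\<^sub>v x = 0\<^sub>v r1 \<and> S *\<^sub>v x = 0\<^sub>v r2"
proof -
  have "P @\<^sub>r S \<in> carrier_mat (r1 + r2) n" using P S by (rule carrier_append_rows)
  moreover have "(P @\<^sub>r S) *\<^sub>v x = P *\<^sub>v x @\<^sub>v S *\<^sub>v x" using P S x by (rule mat_mult_append)
  moreover have "0\<^sub>v (r1 + r2) = 0\<^sub>v r1 @\<^sub>v (0\<^sub>v r2 :: 'a vec)" by (intro eq_vecI) auto
  moreover have "P *\<^sub>v x @\<^sub>v S *\<^sub>v x = 0\<^sub>v r1 @\<^sub>v 0\<^sub>v r2 \<longleftrightarrow> P *\<^sub>v x = 0\<^sub>v r1 \<and> S *\<^sub>v x = 0\<^sub>v r2"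
    using P by (intro append_vec_eq[of _ r1]) (auto simp: carrier_dim_vec)
  ultimately show ?thesis using x by (simp add: mat_kernel del: zero_vec_def)
qed

lemma Ker_k_0: "Ker_k 0 K E = carrier_vec (dim_col E)"
  by (simp add: Ker_k_def)

text \<open>A recursion on \<open>k\<close> that shifts the vector instead of the power of the matrix; it matches multiplication by \<open>z\<close> below.\<close>

lemma Ker_k_Suc:
  assumes K: "K \<in> carrier_mat r n" and E: "E \<in> carrier_mat n n"
  shows "x \<in> Ker_k (Suc k) K E \<longleftrightarrow> x \<in> mat_kernel K \<and> E *\<^sub>v x \<in> Ker_k k K E"
proof (cases "x \<in> carrier_vec n")
  case False
  then show ?thesis using K E by (auto simp: Ker_k_def mat_kernel)
next
  case x: True
  have KE: "K * E ^\<^sub>m j \<in> carrier_mat r n" for j using K E by (intro mult_carrier_mat[of _ r n]) simp_all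
  have Ex: "E *\<^sub>v x \<in> carrier_vec n" using E x by (rule mult_mat_vec_carrier)
  have step: "x \<in> mat_kernel (K * E ^\<^sub>m Suc j) \<longleftrightarrow> E *\<^sub>v x \<in> mat_kernel (K * E ^\<^sub>m j)" for j
  proof -
    have "K * E ^\<^sub>m Suc j = K * E ^\<^sub>m j * E" using K E by (simp add: assoc_mult_mat[of _ r n _ n _ n])
    then have "(K * E ^\<^sub>m Suc j) *\<^sub>v x = (K * E ^\<^sub>m j) *\<^sub>v (E *\<^sub>v x)"
      using assoc_mult_mat_vec[OF KE E x] by simp
    then show ?thesis using x Ex unfolding mat_kernel[OF KE] mem_Collect_eq by simp
  qed
  have "x \<in> Ker_k (Suc k) K E \<longleftrightarrow> (\<forall>j < Suc k. x \<in> mat_kernel (K * E ^\<^sub>m j))"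
    using x E by (auto simp: Ker_k_def)
  also have "\<dots> \<longleftrightarrow> x \<in> mat_kernel (K * E ^\<^sub>m 0) \<and> (\<forall>j < k. x \<in> mat_kernel (K * E ^\<^sub>m Suc j))"
    using less_Suc_eq_0_disj by auto
  also have "K * E ^\<^sub>m 0 = K" using K E by simp
  finally show ?thesis unfolding step using Ex E by (auto simp: Ker_k_def)
qed

lemma mat_adjoint_index [simp]:
  "i < dim_col A \<Longrightarrow> j < dim_row A \<Longrightarrow> mat_adjoint A $$ (i, j) = conjugate (A $$ (j, i))"
  unfolding mat_adjoint_def by (simp add: mat_of_rows_index)

lemma mat_adjoint_dim [simp]:
  "dim_row (mat_adjoint A) = dim_col A" "dim_col (mat_adjoint A) = dim_row A"
  unfolding mat_adjoint_def by auto

lemma mat_adjoint_carrier [simp]: "mat_adjoint A \<in> carrier_mat nr nc \<longleftrightarrow> A \<in> carrier_mat nc nr"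
  unfolding carrier_mat_def mem_Collect_eq mat_adjoint_dim by (rule conj_commute)

lemma mat_adjoint_adjoint [simp]: "mat_adjoint (mat_adjoint P) = (P :: complex mat)"
  by (rule eq_matI) simp_all

lemma mat_adjoint_mult:
  assumes "P \<in> carrier_mat nr n" "S \<in> carrier_mat n nc"
  shows "mat_adjoint (P * S) = mat_adjoint S * (mat_adjoint P :: complex mat)"
proof (rule eq_matI)
  fix i j assume ij: "i < dim_row (mat_adjoint S * mat_adjoint P)" "j < dim_col (mat_adjoint S * mat_adjoint P)"
  note d = carrier_matD[OF assms(1)] carrier_matD[OF assms(2)]
  have "mat_adjoint (P * S) $$ (i, j) = cnj (\<Sum>k<n. P $$ (j, k) * S $$ (k, i))"
    using ij d by (simp add: scalar_prod_def atLeast0LessThan)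
  also have "\<dots> = (\<Sum>k<n. cnj (S $$ (k, i)) * cnj (P $$ (j, k)))"
    by (simp add: mult.commute)
  finally show "mat_adjoint (P * S) $$ (i, j) = (mat_adjoint S * mat_adjoint P) $$ (i, j)"
    using ij d by (simp add: scalar_prod_def atLeast0LessThan)
qed (use assms in simp_all)

lemma mat_adjoint_minus:
  assumes "P \<in> carrier_mat nr nc" "S \<in> carrier_mat nr nc"
  shows "mat_adjoint (P - S) = mat_adjoint P - (mat_adjoint S :: complex mat)"
  using carrier_matD[OF assms(1)] carrier_matD[OF assms(2)] by (intro eq_matI) simp_all

lemma mat_adjoint_pow:
  fixes A :: "complex mat"
  assumes A: "A \<in> carrier_mat n n"
  shows "mat_adjoint (A ^\<^sub>m j) = mat_adjoint A ^\<^sub>m j"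
proof (induct j)
  case 0
  show ?case using carrier_matD[OF A] by (intro eq_matI) auto
next
  case (Suc j)
  have comm: "P * P ^\<^sub>m j = P ^\<^sub>m j * P" if P: "P \<in> carrier_mat n n" for P :: "complex mat"
  proof (induct j)
    case 0
    show ?case using P by simp
  next
    case (Suc j)
    have "P * P ^\<^sub>m Suc j = P * P ^\<^sub>m j * P"
      using assoc_mult_mat[OF P pow_carrier_mat[OF P] P] by simp
    then show ?case by (simp add: Suc)
  qed
  have A': "mat_adjoint A \<in> carrier_mat n n" using A by simp
  have "mat_adjoint (A ^\<^sub>m Suc j) = mat_adjoint A * mat_adjoint (A ^\<^sub>m j)"
    using mat_adjoint_mult[OF pow_carrier_mat[OF A] A] by simp
  then show ?case using comm[OF A'] Suc by simp
qed

lemma mat_adjoint_append_cols: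
  assumes "P \<in> carrier_mat n c1" "S \<in> carrier_mat n c2"
  shows "mat_adjoint (P @\<^sub>c S) = mat_adjoint P @\<^sub>r (mat_adjoint S :: complex mat)"
  using carrier_matD[OF assms(1)] carrier_matD[OF assms(2)]
  by (intro eq_matI) (auto simp: append_cols_def append_rows_def)

lemma four_block_mat_inject:
  assumes "four_block_mat A B C D = four_block_mat A' B' C' D'"
    "A \<in> carrier_mat r1 c1" "B \<in> carrier_mat r1 c2" "C \<in> carrier_mat r2 c1" "D \<in> carrier_mat r2 c2"
    "A' \<in> carrier_mat r1 c1" "B' \<in> carrier_mat r1 c2" "C' \<in> carrier_mat r2 c1" "D' \<in> carrier_mat r2 c2"
  shows "A = A'" "B = B'" "C = C'" "D = D'"
proof -
  have eq: "four_block_mat A B C D $$ (i, j) = four_block_mat A' B' C' D' $$ (i, j)" for i j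
    using assms(1) by simp
  note car = assms(2-)
  note dm = car[THEN carrier_matD(1)] car[THEN carrier_matD(2)]
  show "A = A'"
  proof (rule eq_matI)
    fix i j assume "i < dim_row A'" "j < dim_col A'"
    then show "A $$ (i, j) = A' $$ (i, j)" using eq[of i j] by (simp add: dm)
  qed (simp_all add: dm)
  show "B = B'"
  proof (rule eq_matI)
    fix i j assume "i < dim_row B'" "j < dim_col B'"
    then show "B $$ (i, j) = B' $$ (i, j)" using eq[of i "c1 + j"] by (simp add: dm)
  qed (simp_all add: dm)
  show "C = C'"
  proof (rule eq_matI)
    fix i j assume "i < dim_row C'" "j < dim_col C'"
    then show "C $$ (i, j) = C' $$ (i, j)" using eq[of "r1 + i" j] by (simp add: dm)
  qed (simp_all add: dm)
  show "D = D'"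
  proof (rule eq_matI)
    fix i j assume "i < dim_row D'" "j < dim_col D'"
    then show "D $$ (i, j) = D' $$ (i, j)" using eq[of "r1 + i" "c1 + j"] by (simp add: dm)
  qed (simp_all add: dm)
qed

lemma smult_mat_mult_vec:
  fixes A :: "'a :: comm_ring_1 mat"
  assumes "A \<in> carrier_mat nr nc" "v \<in> carrier_vec nc"
  shows "(k \<cdot>\<^sub>m A) *\<^sub>v v = k \<cdot>\<^sub>v (A *\<^sub>v v)"
  using assms by (intro eq_vecI) (auto simp: scalar_prod_def sum_distrib_left mult.assoc)

lemma zero_mat_mult_vec [simp]:
  "v \<in> carrier_vec nc \<Longrightarrow> 0\<^sub>m nr nc *\<^sub>v v = (0\<^sub>v nr :: 'a :: comm_ring_1 vec)"
  by (intro eq_vecI) (auto simp: scalar_prod_def)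

lemma carrier_mat_dims: "M \<in> carrier_mat nr nc \<longleftrightarrow> dim_row M = nr \<and> dim_col M = nc"
  unfolding carrier_mat_def mem_Collect_eq ..

text \<open>Distributivity with side conditions on dimensions only, so that rewriting needs no carrier sets.\<close>

lemma mat_vec_simps:
  fixes M N :: "'a :: field mat"
  shows "dim_vec u = dim_col M \<Longrightarrow> dim_vec v = dim_col M \<Longrightarrow> M *\<^sub>v (u + v) = M *\<^sub>v u + M *\<^sub>v v"
    "dim_vec u = dim_col M \<Longrightarrow> dim_vec v = dim_col M \<Longrightarrow> M *\<^sub>v (u - v) = M *\<^sub>v u - M *\<^sub>v v"
    "dim_vec v = dim_col M \<Longrightarrow> M *\<^sub>v (k \<cdot>\<^sub>v v) = k \<cdot>\<^sub>v (M *\<^sub>v v)"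
    "dim_vec v = dim_col M \<Longrightarrow> (k \<cdot>\<^sub>m M) *\<^sub>v v = k \<cdot>\<^sub>v (M *\<^sub>v v)"
    "dim_row M = dim_row N \<Longrightarrow> dim_col M = dim_col N \<Longrightarrow> dim_vec v = dim_col N \<Longrightarrow>
      (M + N) *\<^sub>v v = M *\<^sub>v v + N *\<^sub>v v"
    "dim_row M = dim_row N \<Longrightarrow> dim_col M = dim_col N \<Longrightarrow> dim_vec v = dim_col N \<Longrightarrow>
      (M - N) *\<^sub>v v = M *\<^sub>v v - N *\<^sub>v v"
    "dim_col M = dim_row N \<Longrightarrow> dim_vec v = dim_col N \<Longrightarrow> (M * N) *\<^sub>v v = M *\<^sub>v (N *\<^sub>v v)"
proof -
  let ?r = "dim_row M" and ?c = "dim_col M"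
  note cc = carrier_matI carrier_vecI
  show "dim_vec u = ?c \<Longrightarrow> dim_vec v = ?c \<Longrightarrow> M *\<^sub>v (u + v) = M *\<^sub>v u + M *\<^sub>v v"
    using mult_add_distrib_mat_vec[of M ?r ?c u v] by (blast intro: cc)
  show "dim_vec u = ?c \<Longrightarrow> dim_vec v = ?c \<Longrightarrow> M *\<^sub>v (u - v) = M *\<^sub>v u - M *\<^sub>v v"
    using mult_minus_distrib_mat_vec[of M ?r ?c u v] by (blast intro: cc)
  show "dim_vec v = ?c \<Longrightarrow> M *\<^sub>v (k \<cdot>\<^sub>v v) = k \<cdot>\<^sub>v (M *\<^sub>v v)"
    using mult_mat_vec[of M ?r ?c v k] by (blast intro: cc)
  show "dim_vec v = ?c \<Longrightarrow> (k \<cdot>\<^sub>m M) *\<^sub>v v = k \<cdot>\<^sub>v (M *\<^sub>v v)"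
    using smult_mat_mult_vec[of M ?r ?c v k] by (blast intro: cc)
  show "?r = dim_row N \<Longrightarrow> ?c = dim_col N \<Longrightarrow> dim_vec v = dim_col N \<Longrightarrow>
      (M + N) *\<^sub>v v = M *\<^sub>v v + N *\<^sub>v v"
    using add_mult_distrib_mat_vec[of M "dim_row N" "dim_col N" N v] by (blast intro: cc)
  show "?r = dim_row N \<Longrightarrow> ?c = dim_col N \<Longrightarrow> dim_vec v = dim_col N \<Longrightarrow>
      (M - N) *\<^sub>v v = M *\<^sub>v v - N *\<^sub>v v"
    using minus_mult_distrib_mat_vec[of M "dim_row N" "dim_col N" N v] by (blast intro: cc)
  show "?c = dim_row N \<Longrightarrow> dim_vec v = dim_col N \<Longrightarrow> (M * N) *\<^sub>v v = M *\<^sub>v (N *\<^sub>v v)"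
    using assoc_mult_mat_vec[of M ?r "dim_row N" N "dim_col N" v] by (blast intro: cc)
qed

lemma mat_diag_vec:
  fixes v :: "'a :: comm_ring_1 vec"
  assumes "dim_vec v = m" "i < m"
  shows "(mat_diag m f *\<^sub>v v) $ i = f i * v $ i"
proof -
  have "(mat_diag m f *\<^sub>v v) $ i = (\<Sum>j\<in>{0..<m}. (if i = j then f j else 0) * v $ j)"
    using assms by (auto simp: mat_diag_def scalar_prod_def intro!: sum.cong)
  also have "\<dots> = (\<Sum>j\<in>{0..<m}. if i = j then f j * v $ j else 0)"
    by (intro sum.cong) auto
  finally show ?thesis using assms by simp
qed

lemma scalar_prod_adjoint:
  fixes M :: "complex mat"
  assumes "M \<in> carrier_mat nr nc" "x \<in> carrier_vec nr" "v \<in> carrier_vec nc"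
  shows "x \<bullet>c (M *\<^sub>v v) = (mat_adjoint M *\<^sub>v x) \<bullet>c v"
proof -
  have "x \<bullet>c (M *\<^sub>v v) = (\<Sum>i<nr. \<Sum>j<nc. x $ i * (cnj (M $$ (i, j)) * cnj (v $ j)))"
    using assms by (simp add: scalar_prod_def sum_distrib_left atLeast0LessThan row_def)
  also have "\<dots> = (\<Sum>j<nc. \<Sum>i<nr. x $ i * (cnj (M $$ (i, j)) * cnj (v $ j)))"
    by (rule sum.swap)
  also have "\<dots> = (mat_adjoint M *\<^sub>v x) \<bullet>c v"
    using assms by (simp add: scalar_prod_def sum_distrib_left sum_distrib_right atLeast0LessThan row_def mult_ac)
  finally show ?thesis .
qed

lemma orth_mat_im:
  assumes M: "M \<in> carrier_mat n nc"
  shows "orth n (mat_im M) = mat_kernel (mat_adjoint M)"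
proof -
  have "(\<forall>v \<in> carrier_vec nc. x \<bullet>c (M *\<^sub>v v) = 0) \<longleftrightarrow> mat_adjoint M *\<^sub>v x = 0\<^sub>v nc"
    if x: "x \<in> carrier_vec n" for x
  proof
    assume *: "\<forall>v \<in> carrier_vec nc. x \<bullet>c (M *\<^sub>v v) = 0"
    let ?v = "mat_adjoint M *\<^sub>v x"
    have c: "?v \<in> carrier_vec nc" using M x by (intro mult_mat_vec_carrier[of _ nc n]) auto
    then have "?v \<bullet>c ?v = 0" using * scalar_prod_adjoint[OF M x c] by simp
    then show "?v = 0\<^sub>v nc" using c conjugate_square_eq_0_vec by blast
  next
    assume "mat_adjoint M *\<^sub>v x = 0\<^sub>v nc"
    then show "\<forall>v \<in> carrier_vec nc. x \<bullet>c (M *\<^sub>v v) = 0"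
      using scalar_prod_adjoint[OF M x] by simp
  qed
  then show ?thesis using M by (auto simp: orth_def mat_im_def mat_kernel_def)
qed

lemma linear_subspace_mat_im:
  assumes "M \<in> carrier_mat n nc"
  shows "linear_subspace n (mat_im M)"
proof (rule linear_subspaceI)
  show "mat_im M \<subseteq> carrier_vec n" using assms by (auto simp: mat_im_def)
  have "M *\<^sub>v 0\<^sub>v nc = 0\<^sub>v n" using assms by auto
  then show "0\<^sub>v n \<in> mat_im M" using assms unfolding mat_im_def
    by (metis carrier_matD(2) imageI zero_carrier_vec)
  show "x + y \<in> mat_im M" if "x \<in> mat_im M" "y \<in> mat_im M" for x y
    using that assms unfolding mat_im_def
    by (auto simp flip: mult_add_distrib_mat_vec[of _ n nc])
  show "a \<cdot>\<^sub>v x \<in> mat_im M" if "x \<in> mat_im M" for a x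
    using that assms unfolding mat_im_def
    by (auto simp flip: mult_mat_vec[of _ n nc])
qed

lemma linear_subspace_span:
  assumes "G \<subseteq> carrier_vec n"
  shows "linear_subspace n (LinearCombinations.module.span class_ring (module_vec TYPE(complex) n) G)"
proof -
  interpret vec_space "TYPE(complex)" n .
  show ?thesis unfolding linear_subspace_def using assms by (intro span_is_subspace) auto
qed

lemma orth_span:
  assumes "G \<subseteq> carrier_vec n"
  shows "orth n (LinearCombinations.module.span class_ring (module_vec TYPE(complex) n) G) = orth n G"
proof -
  interpret vec_space "TYPE(complex)" n .
  have "span G \<subseteq> {y \<in> carrier_vec n. x \<bullet>c y = 0}"
    if x: "x \<in> carrier_vec n" "\<forall>y \<in> G. x \<bullet>c y = 0" for x
  proof (rule span_is_subset)
    show "G \<subseteq> {y \<in> carrier_vec n. x \<bullet>c y = 0}" using x assms by auto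
    have "linear_subspace n {y \<in> carrier_vec n. x \<bullet>c y = 0}"
      using x by (intro linear_subspaceI)
        (auto simp: conjugate_add_vec[of _ n] scalar_prod_add_distrib[of _ n] conjugate_smult_vec)
    then show "submodule class_ring {y \<in> carrier_vec n. x \<bullet>c y = 0} V"
      by (simp add: linear_subspace_def VectorSpace.subspace_def)
  qed
  moreover have "G \<subseteq> span G" using assms by (intro in_own_span) auto
  ultimately show ?thesis unfolding orth_def by blast
qed

lemma orth_Im_k:
  assumes A: "A \<in> carrier_mat n n" and J: "J \<in> carrier_mat n l"
  shows "orth n (Im_k k A J) = Ker_k k (mat_adjoint J) (mat_adjoint A)"
proof -
  have AJ: "A ^\<^sub>m j * J \<in> carrier_mat n l" for j by (rule mult_carrier_mat[OF pow_carrier_mat[OF A] J])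
  have sub: "(\<Union>j < k. mat_im (A ^\<^sub>m j * J)) \<subseteq> carrier_vec n"
    using linear_subspaceD(1)[OF linear_subspace_mat_im[OF AJ]] by blast
  have orth_j: "orth n (mat_im (A ^\<^sub>m j * J)) = mat_kernel (mat_adjoint J * mat_adjoint A ^\<^sub>m j)" for j
    unfolding orth_mat_im[OF AJ] mat_adjoint_mult[OF pow_carrier_mat[OF A] J] mat_adjoint_pow[OF A] ..
  have "orth n (Im_k k A J) = orth n (\<Union>j < k. mat_im (A ^\<^sub>m j * J))"
    unfolding Im_k_def carrier_matD(1)[OF A] by (rule orth_span[OF sub])
  also have "\<dots> = carrier_vec n \<inter> (\<Inter>j < k. orth n (mat_im (A ^\<^sub>m j * J)))"
    by (auto simp: orth_def)
  finally show ?thesis by (simp add: orth_j Ker_k_def carrier_matD(1)[OF A])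
qed

text \<open>Converts the kernels that arise for the adjoint function into the images of the theorem.\<close>

lemma subspace_dim_Im_k:
  assumes A: "A \<in> carrier_mat n n" and J: "J \<in> carrier_mat n l"
  shows "subspace_dim n (Im_k k A J) + subspace_dim n (Ker_k k (mat_adjoint J) (mat_adjoint A)) = n"
proof -
  have AJ: "A ^\<^sub>m j * J \<in> carrier_mat n l" for j by (rule mult_carrier_mat[OF pow_carrier_mat[OF A] J])
  have "linear_subspace n (Im_k k A J)"
    unfolding Im_k_def carrier_matD(1)[OF A]
    using linear_subspaceD(1)[OF linear_subspace_mat_im[OF AJ]] by (intro linear_subspace_span) blast
  from subspace_dim_orth[OF this] show ?thesis by (simp add: orth_Im_k[OF A J])
qed

lemma subspace_dim_mat_im:
  assumes "P \<in> carrier_mat n l"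
  shows "subspace_dim n (mat_im P) + subspace_dim n (mat_kernel (mat_adjoint P)) = n"
  using subspace_dim_orth[OF linear_subspace_mat_im[OF assms]] by (simp add: orth_mat_im[OF assms])

section \<open>Rational matrix functions with entries in a given class\<close>

definition entries_in :: "ratfun set \<Rightarrow> ratfun mat \<Rightarrow> bool" where
  "entries_in S A \<longleftrightarrow> (\<forall>i < dim_row A. \<forall>j < dim_col A. A $$ (i, j) \<in> S)"

definition vec_in :: "ratfun set \<Rightarrow> ratfun vec \<Rightarrow> bool" where
  "vec_in S v \<longleftrightarrow> (\<forall>i < dim_vec v. v $ i \<in> S)"

lemma sum_closed:
  assumes "0 \<in> M" "\<And>f g. f \<in> M \<Longrightarrow> g \<in> M \<Longrightarrow> f + g \<in> M" "\<And>i. i \<in> I \<Longrightarrow> h i \<in> M"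
  shows "sum h I \<in> M"
  using assms(3) by (induct I rule: infinite_finite_induct) (auto intro: assms(1,2))

text \<open>One closure lemma for all combinations: entries of the matrix, entries of the vector, and a class of results that
  absorbs their products and is closed under sums.\<close>

lemma vec_in_mult_gen:
  assumes "entries_in S A" "vec_in T v" "dim_col A = dim_vec v"
    and "0 \<in> M" "\<And>f g. f \<in> M \<Longrightarrow> g \<in> M \<Longrightarrow> f + g \<in> M"
    and "\<And>a b. a \<in> S \<Longrightarrow> b \<in> T \<Longrightarrow> a * b \<in> M"
  shows "vec_in M (A *\<^sub>v v)"
  unfolding vec_in_def
proof (intro allI impI)
  fix i assume i: "i < dim_vec (A *\<^sub>v v)"
  have "(\<Sum>j\<in>{0..<dim_vec v}. A $$ (i, j) * v $ j) \<in> M"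
    using assms i by (intro sum_closed[OF assms(4,5)] assms(6)) (auto simp: entries_in_def vec_in_def)
  then show "(A *\<^sub>v v) $ i \<in> M" using i assms(3) by (simp add: scalar_prod_def)
qed

lemma entries_in_mult:
  assumes "ring_closed S" "entries_in S A" "entries_in S B" "dim_col A = dim_row B"
  shows "entries_in S (A * B)"
  unfolding entries_in_def
proof (intro allI impI)
  fix i j assume ij: "i < dim_row (A * B)" "j < dim_col (A * B)"
  have "(\<Sum>k\<in>{0..<dim_row B}. A $$ (i, k) * B $$ (k, j)) \<in> S"
    using assms ij ring_closedD[OF assms(1)]
    by (intro sum_closed) (auto simp: entries_in_def)
  then show "(A * B) $$ (i, j) \<in> S" using ij assms(4) by (simp add: scalar_prod_def)
qed

lemma vec_in_Hplus_mult:
  "entries_in Hplus A \<Longrightarrow> vec_in Hplus v \<Longrightarrow> dim_col A = dim_vec v \<Longrightarrow> vec_in Hplus (A *\<^sub>v v)"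
  by (rule vec_in_mult_gen) (blast intro: Hplus_closed)+

lemma vec_in_Hminus_mult:
  "entries_in Hminus A \<Longrightarrow> vec_in Hminus v \<Longrightarrow> dim_col A = dim_vec v \<Longrightarrow> vec_in Hminus (A *\<^sub>v v)"
  by (rule vec_in_mult_gen) (blast intro: Hminus_closed)+

lemma vec_in_Hstrict_mult:
  "entries_in Hminus A \<Longrightarrow> vec_in Hstrict v \<Longrightarrow> dim_col A = dim_vec v \<Longrightarrow> vec_in Hstrict (A *\<^sub>v v)"
  by (rule vec_in_mult_gen) (blast intro: Hstrict_zero Hstrict_add Hstrict_mult)+

text \<open>Componentwise form of the partial fraction decomposition.\<close>

lemma vec_split:
  assumes "entries_in Hplus M" "vec_in Hstrict v" "dim_col M = dim_vec v"
  obtains f g where "M *\<^sub>v v = f + g" "vec_in Hplus f" "vec_in Hstrict g"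
    "dim_vec f = dim_row M" "dim_vec g = dim_row M"
proof -
  let ?S = "{h. \<exists>f \<in> Hplus. \<exists>g \<in> Hstrict. h = f + g}"
  have "vec_in ?S (M *\<^sub>v v)"
  proof (rule vec_in_mult_gen[OF assms])
    show "0 \<in> ?S" using Hplus_closed(4) Hstrict_zero by force
    show "h + h' \<in> ?S" if hh: "h \<in> ?S" "h' \<in> ?S" for h h'
    proof -
      obtain f g f' g' where *: "f \<in> Hplus" "g \<in> Hstrict" "h = f + g" "f' \<in> Hplus" "g' \<in> Hstrict" "h' = f' + g'"
        using hh by blast
      have "h + h' = (f + f') + (g + g')" using * by simp
      moreover have "f + f' \<in> Hplus" "g + g' \<in> Hstrict" using * Hplus_closed(2) Hstrict_add by blast+
      ultimately show ?thesis by blast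
    qed
    show "k * h \<in> ?S" if "k \<in> Hplus" "h \<in> Hstrict" for k h
      using mult_Hplus_Hstrict_split[OF that] by blast
  qed
  then have "\<forall>i. \<exists>f g. i < dim_row M \<longrightarrow> f \<in> Hplus \<and> g \<in> Hstrict \<and> (M *\<^sub>v v) $ i = f + g"
    by (simp add: vec_in_def del: index_mult_mat_vec) blast
  then obtain f g where fg: "i < dim_row M \<Longrightarrow> f i \<in> Hplus \<and> g i \<in> Hstrict \<and> (M *\<^sub>v v) $ i = f i + g i" for i
    by metis
  show thesis
  proof (rule that[of "vec (dim_row M) f" "vec (dim_row M) g"])
    show "M *\<^sub>v v = vec (dim_row M) f + vec (dim_row M) g"
      using fg by (intro eq_vecI) (simp_all del: index_mult_mat_vec)
  qed (use fg in \<open>simp_all add: vec_in_def\<close>)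
qed

lemma vec_in_add:
  assumes "\<And>f g. f \<in> M \<Longrightarrow> g \<in> M \<Longrightarrow> f + g \<in> M" "vec_in M u" "vec_in M v" "dim_vec u = dim_vec v"
  shows "vec_in M (u + v)"
  using assms by (auto simp: vec_in_def)

lemma entries_in_const: "ring_closed S \<Longrightarrow> entries_in S (rmat_const A)"
  by (auto simp: entries_in_def rmat_const_def ring_closedD)

lemma vec_in_const: "ring_closed S \<Longrightarrow> vec_in S (map_vec rf_const x)"
  by (auto simp: vec_in_def ring_closedD)

lemma vec_in_Hstrict_smult:
  "k \<in> Hminus \<Longrightarrow> vec_in Hstrict v \<Longrightarrow> vec_in Hstrict (k \<cdot>\<^sub>v v)"
  by (simp add: vec_in_def Hstrict_mult)

lemma entries_in_add: "ring_closed S \<Longrightarrow> entries_in S A \<Longrightarrow> entries_in S B \<Longrightarrow>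
  dim_row A = dim_row B \<Longrightarrow> dim_col A = dim_col B \<Longrightarrow> entries_in S (A + B)"
  by (auto simp: entries_in_def ring_closedD)

lemma entries_in_smult: "ring_closed S \<Longrightarrow> a \<in> S \<Longrightarrow> entries_in S A \<Longrightarrow> entries_in S (a \<cdot>\<^sub>m A)"
  by (auto simp: entries_in_def ring_closedD)

lemma rmat_const_dim [simp]:
  "dim_row (rmat_const A) = dim_row A" "dim_col (rmat_const A) = dim_col A"
  by (simp_all add: rmat_const_def)

lemma rmat_const_carrier [simp]: "rmat_const A \<in> carrier_mat nr nc \<longleftrightarrow> A \<in> carrier_mat nr nc"
  by (auto simp: rmat_const_def)

lemma rmat_const_mult:
  "A \<in> carrier_mat nr n \<Longrightarrow> B \<in> carrier_mat n nc \<Longrightarrow> rmat_const (A * B) = rmat_const A * rmat_const B"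
  unfolding rmat_const_def by (rule rf_const.mat_hom_mult)

lemma rmat_const_mult_vec:
  "A \<in> carrier_mat nr n \<Longrightarrow> x \<in> carrier_vec n \<Longrightarrow>
    rmat_const A *\<^sub>v map_vec rf_const x = map_vec rf_const (A *\<^sub>v x)"
  unfolding rmat_const_def by (simp add: rf_const.mult_mat_vec_hom)

lemma rmat_const_add:
  assumes "A \<in> carrier_mat nr nc" "B \<in> carrier_mat nr nc"
  shows "rmat_const (A + B) = rmat_const A + rmat_const B"
  using assms by (intro eq_matI) (auto simp: rmat_const_def rf_const.hom_add)

lemma rmat_const_one [simp]: "rmat_const (1\<^sub>m n) = 1\<^sub>m n"
  by (rule eq_matI) (auto simp: rmat_const_def)

lemma rmat_const_zero [simp]: "rmat_const (0\<^sub>m nr nc) = 0\<^sub>m nr nc"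
  by (rule eq_matI) (auto simp: rmat_const_def)

lemma rmat_star_dim [simp]:
  "dim_row (rmat_star A) = dim_col A" "dim_col (rmat_star A) = dim_row A"
  by (simp_all add: rmat_star_def)

lemma rmat_star_index [simp]:
  "i < dim_col A \<Longrightarrow> j < dim_row A \<Longrightarrow> rmat_star A $$ (i, j) = rf_star (A $$ (j, i))"
  by (simp add: rmat_star_def)

lemma rmat_star_carrier [simp]: "rmat_star A \<in> carrier_mat nr nc \<longleftrightarrow> A \<in> carrier_mat nc nr"
  unfolding carrier_mat_def mem_Collect_eq rmat_star_dim by (rule conj_commute)

lemma rmat_star_star [simp]: "rmat_star (rmat_star A) = A"
  by (rule eq_matI) auto

lemma rmat_star_mult:
  assumes "A \<in> carrier_mat nr n" "B \<in> carrier_mat n nc"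
  shows "rmat_star (A * B) = rmat_star B * rmat_star A"
  unfolding rmat_star_def using assms
  by (simp add: transpose_mult[OF assms] rf_star.mat_hom_mult[of _ nc n _ nr])

lemma rmat_star_one [simp]: "rmat_star (1\<^sub>m n) = 1\<^sub>m n"
  by (rule eq_matI) auto

lemma rmat_star_add:
  assumes "A \<in> carrier_mat nr nc" "B \<in> carrier_mat nr nc"
  shows "rmat_star (A + B) = rmat_star A + rmat_star B"
  using assms by (intro eq_matI) (auto simp: rf_star.hom_add)

lemma rmat_star_minus:
  assumes "A \<in> carrier_mat nr nc" "B \<in> carrier_mat nr nc"
  shows "rmat_star (A - B) = rmat_star A - rmat_star B"
  using assms by (intro eq_matI) (auto simp: rf_star.hom_minus)

lemma rmat_star_smult: "rmat_star (a \<cdot>\<^sub>m A) = rf_star a \<cdot>\<^sub>m rmat_star A"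
  by (rule eq_matI) (auto simp: rf_star.hom_mult)

lemma rmat_star_const: "rmat_star (rmat_const A) = rmat_const (mat_adjoint A)"
  by (rule eq_matI) (auto simp: rmat_const_def)

lemma rmat_star_mat_diag_powi:
  "rmat_star (mat_diag m (\<lambda>i. rf_z powi d i)) = mat_diag m (\<lambda>i. rf_z powi (- d i))"
proof -
  have "rf_star (rf_z powi k) = rf_z powi (- k)" for k
    by (auto simp: power_int_def rf_star.hom_power rf_star.hom_inverse)
  then show ?thesis by (intro eq_matI) (auto simp: mat_diag_def)
qed

lemma entries_in_star_Hplus: "entries_in Hplus A \<Longrightarrow> entries_in Hminus (rmat_star A)"
  by (auto simp: entries_in_def rf_star_Hplus)

lemma entries_in_star_Hminus: "entries_in Hminus A \<Longrightarrow> entries_in Hplus (rmat_star A)"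
  by (auto simp: entries_in_def rf_star_Hminus)

lemma rmat_inv:
  assumes "F \<in> carrier_mat n n" "rmat_regular F"
  shows "rmat_inv F \<in> carrier_mat n n" "F * rmat_inv F = 1\<^sub>m n" "rmat_inv F * F = 1\<^sub>m n"
proof -
  have "F \<in> Units (ring_mat TYPE(ratfun) n ())"
    using det_non_zero_imp_unit[OF assms(1)] assms(2) by (simp add: rmat_regular_def)
  then obtain G where "mat_inverse F = Some G"
    using mat_inverse(1)[OF assms(1), where b = "()"] by (cases "mat_inverse F") auto
  from mat_inverse(2)[OF assms(1) this] this
  show "rmat_inv F \<in> carrier_mat n n" "F * rmat_inv F = 1\<^sub>m n" "rmat_inv F * F = 1\<^sub>m n"
    by (auto simp: rmat_inv_def)
qed

lemma no_poles_zeros_disc: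
  assumes "no_poles_zeros_on {z. cmod z \<le> 1} F"
  shows "entries_in Hplus F" "entries_in Hplus (rmat_inv F)"
  using assms unfolding no_poles_zeros_on_def rmat_zero_def rmat_pole_def entries_in_def Hplus_def
  by blast+

lemma no_poles_zeros_exterior:
  assumes "no_poles_zeros_on {z. cmod z \<ge> 1} F" "\<not> rmat_pole_inf F" "\<not> rmat_zero_inf F"
  shows "entries_in Hminus F" "entries_in Hminus (rmat_inv F)"
  using assms unfolding no_poles_zeros_on_def rmat_zero_def rmat_pole_def entries_in_def Hminus_def
    rmat_zero_inf_def rmat_pole_inf_def
  by blast+

definition resolvent :: "complex mat \<Rightarrow> ratfun mat" where
  "resolvent A = rmat_inv (1\<^sub>m (dim_row A) - rf_z \<cdot>\<^sub>m rmat_const A)"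

text \<open>A vector in the kernel of \<open>I - z A\<close> is an eigenvector for \<open>1 / z\<close>, which does not lie in the open disc.\<close>

lemma det_one_minus_nonzero:
  assumes A: "A \<in> carrier_mat n n" "stable_mat A" and z: "cmod z \<le> 1"
  shows "det (1\<^sub>m n - z \<cdot>\<^sub>m A) \<noteq> 0"
proof
  assume det0: "det (1\<^sub>m n - z \<cdot>\<^sub>m A) = 0"
  have "1\<^sub>m n - z \<cdot>\<^sub>m A \<in> carrier_mat n n" using A by auto
  from iffD1[OF det_0_iff_vec_prod_zero[OF this] det0]
  obtain v where v: "v \<in> carrier_vec n" "v \<noteq> 0\<^sub>v n" "(1\<^sub>m n - z \<cdot>\<^sub>m A) *\<^sub>v v = 0\<^sub>v n" by blast
  have "v - z \<cdot>\<^sub>v (A *\<^sub>v v) = 0\<^sub>v n"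
    using v A by (simp add: minus_mult_distrib_mat_vec[of _ n n] smult_mat_mult_vec[of _ n n])
  then have vz: "v = z \<cdot>\<^sub>v (A *\<^sub>v v)"
    using v(1) A(1) by (auto simp: vec_eq_iff)
  have "z \<noteq> 0"
  proof
    assume "z = 0"
    then have "v = 0\<^sub>v n" using vz A(1) v(1) by (auto simp: vec_eq_iff)
    then show False using v(2) by simp
  qed
  have "A *\<^sub>v v = (1 / z) \<cdot>\<^sub>v (z \<cdot>\<^sub>v (A *\<^sub>v v))"
    using \<open>z \<noteq> 0\<close> by (simp add: smult_smult_assoc)
  also have "\<dots> = (1 / z) \<cdot>\<^sub>v v" using vz by simp
  finally have "eigenvalue A (1 / z)" unfolding eigenvalue_def eigenvector_def
    using v A(1) by auto
  then have "cmod (1 / z) < 1" using A(2) by (auto simp: stable_mat_def)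
  then show False using z \<open>z \<noteq> 0\<close> by (simp add: norm_divide divide_less_eq)
qed

text \<open>The adjugate matrix expresses the entries as polynomials divided by \<open>det (I - z A)\<close>, and this polynomial has no roots in the
  closed disc.\<close>

lemma resolvent:
  assumes A: "A \<in> carrier_mat n n" "stable_mat A"
  shows "resolvent A \<in> carrier_mat n n"
    "(1\<^sub>m n - rf_z \<cdot>\<^sub>m rmat_const A) * resolvent A = 1\<^sub>m n"
    "resolvent A * (1\<^sub>m n - rf_z \<cdot>\<^sub>m rmat_const A) = 1\<^sub>m n"
    "entries_in Hplus (resolvent A)"
proof -
  interpret h: comm_ring_hom "to_fract :: complex poly \<Rightarrow> ratfun" by unfold_locales auto
  let ?M = "1\<^sub>m n - rf_z \<cdot>\<^sub>m rmat_const A"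
  \<comment> \<open>The matrix \<open>I - z A\<close> over the polynomials.\<close>
  define P where "P = mat n n (\<lambda>(i, j). [:if i = j then 1 else 0, - (A $$ (i, j)):])"
  have P: "P \<in> carrier_mat n n" by (simp add: P_def)
  have MP: "?M = map_mat to_fract P"
  proof (rule eq_matI)
    fix i j assume "i < dim_row (map_mat to_fract P)" "j < dim_col (map_mat to_fract P)"
    then show "?M $$ (i, j) = map_mat to_fract P $$ (i, j)"
      using A(1) by (auto simp: P_def to_fract_pCons rmat_const_def rf_const.hom_uminus)
  qed (use A in \<open>auto simp: P_def\<close>)
  have detz: "poly (det P) z \<noteq> 0" if "cmod z \<le> 1" for z
  proof -
    have "comm_ring_hom (\<lambda>p. poly p z)" by unfold_locales auto
    then have "det (map_mat (\<lambda>p. poly p z) P) = poly (det P) z" by (rule comm_ring_hom.hom_det)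
    moreover
    have "map_mat (\<lambda>p. poly p z) P = 1\<^sub>m n - z \<cdot>\<^sub>m A"
      using A(1) by (intro eq_matI) (auto simp: P_def)
    ultimately show ?thesis using det_one_minus_nonzero[OF A that] by simp
  qed
  then have "det P \<noteq> 0" by (metis norm_zero poly_0 zero_le_one)
  then have reg: "rmat_regular ?M" unfolding rmat_regular_def MP by (simp add: h.hom_det)
  have M: "?M \<in> carrier_mat n n" using A by auto
  have res: "resolvent A = rmat_inv ?M" using A(1) by (auto simp: resolvent_def)
  note inv = rmat_inv[OF M reg, folded res]
  then show "resolvent A \<in> carrier_mat n n" "?M * resolvent A = 1\<^sub>m n" "resolvent A * ?M = 1\<^sub>m n"
    by auto
  let ?J = "map_mat to_fract (adj_mat P)"
  have J: "?J \<in> carrier_mat n n" using adj_mat(1)[OF P] by simp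
  have "?M * ?J = map_mat to_fract (P * adj_mat P)"
    unfolding MP by (simp add: h.mat_hom_mult[OF P adj_mat(1)[OF P]])
  also have "\<dots> = to_fract (det P) \<cdot>\<^sub>m 1\<^sub>m n"
    unfolding adj_mat(2)[OF P] by (intro eq_matI) auto
  finally have MJ: "?M * ?J = to_fract (det P) \<cdot>\<^sub>m 1\<^sub>m n" .
  have "?J = resolvent A * (?M * ?J)"
    using inv M J by (simp flip: assoc_mult_mat[of _ n n _ n _ n])
  also have "\<dots> = to_fract (det P) \<cdot>\<^sub>m resolvent A"
    unfolding MJ using inv(1) by (simp add: mult_smult_distrib[of _ n n _ n])
  finally have JR: "?J = to_fract (det P) \<cdot>\<^sub>m resolvent A" .
  show "entries_in Hplus (resolvent A)"
    unfolding entries_in_def Hplus_def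
  proof (intro allI impI CollectI)
    fix i j z assume ij: "i < dim_row (resolvent A)" "j < dim_col (resolvent A)" and z: "cmod z \<le> 1"
    have "to_fract (adj_mat P $$ (i, j)) = to_fract (det P) * resolvent A $$ (i, j)"
      using arg_cong[OF JR, of "\<lambda>M. M $$ (i, j)"] ij inv(1) adj_mat(1)[OF P] by auto
    then have "resolvent A $$ (i, j) = to_fract (adj_mat P $$ (i, j)) / to_fract (det P)"
      using \<open>det P \<noteq> 0\<close> by simp
    then show "\<not> rf_pole (resolvent A $$ (i, j)) z"
      using detz[OF z] not_pole_iff by blast
  qed
qed

section \<open>Realizations with a unitary system matrix\<close>

locale unitary_realization =
  fixes n m :: nat and A B C D :: "complex mat"
  assumes dims: "A \<in> carrier_mat n n" "B \<in> carrier_mat n m" "C \<in> carrier_mat m n" "D \<in> carrier_mat m m"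
    and stable: "stable_mat A"
    and unitary: "unitary_mat (n + m) (four_block_mat A B C D)"
begin

lemma unitary_blocks:
  "mat_adjoint A * A + mat_adjoint C * C = 1\<^sub>m n"
  "mat_adjoint A * B + mat_adjoint C * D = 0\<^sub>m n m"
  "mat_adjoint B * A + mat_adjoint D * C = 0\<^sub>m m n"
  "mat_adjoint B * B + mat_adjoint D * D = 1\<^sub>m m"
  "A * mat_adjoint A + B * mat_adjoint B = 1\<^sub>m n"
  "C * mat_adjoint A + D * mat_adjoint B = 0\<^sub>m m n"
proof -
  let ?U = "four_block_mat A B C D"
  let ?U' = "four_block_mat (mat_adjoint A) (mat_adjoint C) (mat_adjoint B) (mat_adjoint D)"
  have U': "mat_adjoint ?U = ?U'"
    using dims by (intro eq_matI) auto
  have adj: "mat_adjoint A \<in> carrier_mat n n" "mat_adjoint C \<in> carrier_mat n m"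
    "mat_adjoint B \<in> carrier_mat m n" "mat_adjoint D \<in> carrier_mat m m" using dims by auto
  have one: "1\<^sub>m (n + m) = four_block_mat (1\<^sub>m n) (0\<^sub>m n m) (0\<^sub>m m n) (1\<^sub>m m)"
    by (simp add: four_block_one_mat)
  have 1: "?U' * ?U = 1\<^sub>m (n + m)" and 2: "?U * ?U' = 1\<^sub>m (n + m)"
    using unitary U' by (simp_all add: unitary_mat_def)
  note I1 = four_block_mat_inject[OF 1[unfolded mult_four_block_mat[OF adj dims] one]]
  show "mat_adjoint A * A + mat_adjoint C * C = 1\<^sub>m n" by (rule I1(1)) (use dims in auto)
  show "mat_adjoint A * B + mat_adjoint C * D = 0\<^sub>m n m" by (rule I1(2)) (use dims in auto)
  show "mat_adjoint B * A + mat_adjoint D * C = 0\<^sub>m m n" by (rule I1(3)) (use dims in auto)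
  show "mat_adjoint B * B + mat_adjoint D * D = 1\<^sub>m m" by (rule I1(4)) (use dims in auto)
  note I2 = four_block_mat_inject[OF 2[unfolded mult_four_block_mat[OF dims adj] one]]
  show "A * mat_adjoint A + B * mat_adjoint B = 1\<^sub>m n" by (rule I2(1)) (use dims in auto)
  show "C * mat_adjoint A + D * mat_adjoint B = 0\<^sub>m m n" by (rule I2(3)) (use dims in auto)
qed

text \<open>Lower case letters denote the constant matrices as rational matrix functions, \<open>Q\<close> is \<open>(I - z A)\<^sup>-\<^sup>1\<close> and \<open>G\<close> is the transfer function.\<close>

definition "a = rmat_const A"

definition "b = rmat_const B"

definition "c = rmat_const C"

definition "d = rmat_const D"

definition "Q = resolvent A"

definition "G = realization n A B C D"

lemma carr [simp]:
  "a \<in> carrier_mat n n" "b \<in> carrier_mat n m" "c \<in> carrier_mat m n" "d \<in> carrier_mat m m"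
  "Q \<in> carrier_mat n n"
  using dims resolvent(1)[OF dims(1) stable] by (simp_all add: a_def b_def c_def d_def Q_def)

lemma dim_carr [simp]:
  "dim_row a = n" "dim_col a = n" "dim_row b = n" "dim_col b = m" "dim_row c = m" "dim_col c = n"
  "dim_row d = m" "dim_col d = m" "dim_row Q = n" "dim_col Q = n"
  by (rule carrier_matD, rule carr)+

text \<open>The block identities of the unitary system matrix, applied to vectors of rational functions.\<close>

lemma unitary_vec:
  assumes q: "q \<in> carrier_vec n" and u: "u \<in> carrier_vec m"
  shows "rmat_star a *\<^sub>v (a *\<^sub>v q) + rmat_star c *\<^sub>v (c *\<^sub>v q) = q"
    "rmat_star a *\<^sub>v (b *\<^sub>v u) + rmat_star c *\<^sub>v (d *\<^sub>v u) = 0\<^sub>v n"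
    "rmat_star b *\<^sub>v (a *\<^sub>v q) + rmat_star d *\<^sub>v (c *\<^sub>v q) = 0\<^sub>v m"
    "rmat_star b *\<^sub>v (b *\<^sub>v u) + rmat_star d *\<^sub>v (d *\<^sub>v u) = u"
    "a *\<^sub>v (rmat_star a *\<^sub>v q) + b *\<^sub>v (rmat_star b *\<^sub>v q) = q"
    "c *\<^sub>v (rmat_star a *\<^sub>v q) + d *\<^sub>v (rmat_star b *\<^sub>v q) = 0\<^sub>v m"
proof -
  have *: "P *\<^sub>v (P' *\<^sub>v x) + S *\<^sub>v (S' *\<^sub>v x) = (P * P' + S * S') *\<^sub>v x"
    if "P \<in> carrier_mat i k" "P' \<in> carrier_mat k j" "S \<in> carrier_mat i l" "S' \<in> carrier_mat l j"
       "x \<in> carrier_vec j" for P P' S S' :: "ratfun mat" and i k j l x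
    using that by (simp add: add_mult_distrib_mat_vec[of _ i j])
  have **: "rmat_const P * rmat_const P' + rmat_const S * rmat_const S' = rmat_const (P * P' + S * S')"
    if "P \<in> carrier_mat i k" "P' \<in> carrier_mat k j" "S \<in> carrier_mat i l" "S' \<in> carrier_mat l j"
    for P P' S S' :: "complex mat" and i k j l
    using that rmat_const_mult[of P i k P' j] rmat_const_mult[of S i l S' j]
      rmat_const_add[of "P * P'" i j "S * S'"] by simp
  note st = a_def b_def c_def d_def rmat_star_const
  show "rmat_star a *\<^sub>v (a *\<^sub>v q) + rmat_star c *\<^sub>v (c *\<^sub>v q) = q"
    unfolding st using dims q by (simp add: *[of _ n n _ n _ m] **[of _ n n _ n _ m] unitary_blocks)
  show "rmat_star a *\<^sub>v (b *\<^sub>v u) + rmat_star c *\<^sub>v (d *\<^sub>v u) = 0\<^sub>v n"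
    unfolding st using dims u by (simp add: *[of _ n n _ m _ m] **[of _ n n _ m _ m] unitary_blocks)
  show "rmat_star b *\<^sub>v (a *\<^sub>v q) + rmat_star d *\<^sub>v (c *\<^sub>v q) = 0\<^sub>v m"
    unfolding st using dims q by (simp add: *[of _ m n _ n _ m] **[of _ m n _ n _ m] unitary_blocks)
  show "rmat_star b *\<^sub>v (b *\<^sub>v u) + rmat_star d *\<^sub>v (d *\<^sub>v u) = u"
    unfolding st using dims u by (simp add: *[of _ m n _ m _ m] **[of _ m n _ m _ m] unitary_blocks)
  show "a *\<^sub>v (rmat_star a *\<^sub>v q) + b *\<^sub>v (rmat_star b *\<^sub>v q) = q"
    unfolding st using dims q by (simp add: *[of _ n n _ n _ m] **[of _ n n _ n _ m] unitary_blocks)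
  show "c *\<^sub>v (rmat_star a *\<^sub>v q) + d *\<^sub>v (rmat_star b *\<^sub>v q) = 0\<^sub>v m"
    unfolding st using dims q by (simp add: *[of _ m n _ n _ m] **[of _ m n _ n _ m] unitary_blocks)
qed

lemma one_minus_za_carrier [simp]: "1\<^sub>m n - rf_z \<cdot>\<^sub>m a \<in> carrier_mat n n"
  by (intro minus_carrier_mat smult_carrier_mat carr)

lemma one_minus_za_vec:
  assumes "x \<in> carrier_vec n"
  shows "(1\<^sub>m n - rf_z \<cdot>\<^sub>m a) *\<^sub>v x = x - rf_z \<cdot>\<^sub>v (a *\<^sub>v x)"
    "rmat_star (1\<^sub>m n - rf_z \<cdot>\<^sub>m a) *\<^sub>v x = x - inverse rf_z \<cdot>\<^sub>v (rmat_star a *\<^sub>v x)"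
proof -
  show "(1\<^sub>m n - rf_z \<cdot>\<^sub>m a) *\<^sub>v x = x - rf_z \<cdot>\<^sub>v (a *\<^sub>v x)"
    using assms by (simp add: minus_mult_distrib_mat_vec[of _ n n] smult_mat_mult_vec[of _ n n])
  have "rmat_star (1\<^sub>m n - rf_z \<cdot>\<^sub>m a) = 1\<^sub>m n - inverse rf_z \<cdot>\<^sub>m rmat_star a"
    by (simp add: rmat_star_minus[of _ n n] rmat_star_smult)
  then show "rmat_star (1\<^sub>m n - rf_z \<cdot>\<^sub>m a) *\<^sub>v x = x - inverse rf_z \<cdot>\<^sub>v (rmat_star a *\<^sub>v x)"
    using assms by (simp add: minus_mult_distrib_mat_vec[of _ n n] smult_mat_mult_vec[of _ n n])
qed

lemma resolvent_inverse:
  "Q * (1\<^sub>m n - rf_z \<cdot>\<^sub>m a) = 1\<^sub>m n" "(1\<^sub>m n - rf_z \<cdot>\<^sub>m a) * Q = 1\<^sub>m n"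
  using resolvent(2,3)[OF dims(1) stable] by (simp_all add: Q_def a_def)

lemma resolvent_vec:
  assumes "x \<in> carrier_vec n"
  shows "Q *\<^sub>v (x - rf_z \<cdot>\<^sub>v (a *\<^sub>v x)) = x"
    "Q *\<^sub>v x - rf_z \<cdot>\<^sub>v (a *\<^sub>v (Q *\<^sub>v x)) = x"
proof -
  let ?M = "1\<^sub>m n - rf_z \<cdot>\<^sub>m a"
  have "Q *\<^sub>v (?M *\<^sub>v x) = (Q * ?M) *\<^sub>v x"
    by (rule assoc_mult_mat_vec[symmetric, of _ n n _ n]) (use assms in simp_all)
  then show "Q *\<^sub>v (x - rf_z \<cdot>\<^sub>v (a *\<^sub>v x)) = x"
    using assms by (simp only: resolvent_inverse one_minus_za_vec one_mult_mat_vec)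
  have "?M *\<^sub>v (Q *\<^sub>v x) = (?M * Q) *\<^sub>v x"
    by (rule assoc_mult_mat_vec[symmetric, of _ n n _ n]) (use assms in simp_all)
  moreover have "Q *\<^sub>v x \<in> carrier_vec n" using assms by (intro mult_mat_vec_carrier[of _ n n]) auto
  ultimately show "Q *\<^sub>v x - rf_z \<cdot>\<^sub>v (a *\<^sub>v (Q *\<^sub>v x)) = x"
    using assms by (simp only: resolvent_inverse one_minus_za_vec one_mult_mat_vec)
qed

lemma resolvent_star_vec:
  assumes "x \<in> carrier_vec n"
  shows "rmat_star Q *\<^sub>v (x - inverse rf_z \<cdot>\<^sub>v (rmat_star a *\<^sub>v x)) = x"
    "rmat_star Q *\<^sub>v x - inverse rf_z \<cdot>\<^sub>v (rmat_star a *\<^sub>v (rmat_star Q *\<^sub>v x)) = x"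
proof -
  let ?M = "rmat_star (1\<^sub>m n - rf_z \<cdot>\<^sub>m a)"
  have inv: "rmat_star Q * ?M = 1\<^sub>m n" "?M * rmat_star Q = 1\<^sub>m n"
    by (simp_all only: resolvent_inverse rmat_star_one one_minus_za_carrier carr
        rmat_star_mult[of _ n n _ n, symmetric])
  have "rmat_star Q *\<^sub>v (?M *\<^sub>v x) = (rmat_star Q * ?M) *\<^sub>v x"
    by (rule assoc_mult_mat_vec[symmetric, of _ n n _ n]) (use assms in simp_all)
  then show "rmat_star Q *\<^sub>v (x - inverse rf_z \<cdot>\<^sub>v (rmat_star a *\<^sub>v x)) = x"
    using assms by (simp only: inv one_minus_za_vec one_mult_mat_vec)
  have "?M *\<^sub>v (rmat_star Q *\<^sub>v x) = (?M * rmat_star Q) *\<^sub>v x"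
    by (rule assoc_mult_mat_vec[symmetric, of _ n n _ n]) (use assms in simp_all)
  moreover have "rmat_star Q *\<^sub>v x \<in> carrier_vec n" using assms by (intro mult_mat_vec_carrier[of _ n n]) auto
  ultimately show "rmat_star Q *\<^sub>v x - inverse rf_z \<cdot>\<^sub>v (rmat_star a *\<^sub>v (rmat_star Q *\<^sub>v x)) = x"
    using assms by (simp only: inv one_minus_za_vec one_mult_mat_vec)
qed

lemma G_eq: "G = d + rf_z \<cdot>\<^sub>m (c * Q * b)"
  using dims by (auto simp: G_def realization_def resolvent_def Q_def a_def b_def c_def d_def)

lemma G_dim [simp]: "dim_row G = m" "dim_col G = m"
  by (simp_all add: G_eq)

lemma G_carrier [simp]: "G \<in> carrier_mat m m"
  by (simp add: carrier_mat_dims)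

lemma entries_Q: "entries_in Hplus Q" "entries_in Hminus (rmat_star Q)"
  using resolvent(4)[OF dims(1) stable] by (simp_all add: Q_def entries_in_star_Hplus)

lemma entries_const:
  assumes "ring_closed S"
  shows "entries_in S a" "entries_in S b" "entries_in S c" "entries_in S d"
  using assms by (simp_all add: a_def b_def c_def d_def entries_in_const)

lemma entries_G: "entries_in Hplus G" "entries_in Hminus (rmat_star G)"
proof -
  show "entries_in Hplus G" unfolding G_eq
    by (intro entries_in_add entries_in_smult entries_in_mult ring_closed_Hplus rf_z_Hplus
        entries_Q entries_const) simp_all
  then show "entries_in Hminus (rmat_star G)" by (rule entries_in_star_Hplus)
qed

text \<open>The system point of view: \<open>y = G u\<close> as soon as some state \<open>q\<close> satisfies \<open>q = z (A q + B u)\<close> and \<open>y = C q + D u\<close>. All later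
  products with \<open>G\<close> are computed by exhibiting a state.\<close>

lemma G_mult_vec:
  assumes u: "u \<in> carrier_vec m" and q: "q \<in> carrier_vec n"
    and eq: "q - rf_z \<cdot>\<^sub>v (a *\<^sub>v q) = rf_z \<cdot>\<^sub>v (b *\<^sub>v u)"
  shows "G *\<^sub>v u = c *\<^sub>v q + d *\<^sub>v u"
proof -
  note [simp] = u[unfolded carrier_dim_vec] q[unfolded carrier_dim_vec] mat_vec_simps
  have q: "q = rf_z \<cdot>\<^sub>v (Q *\<^sub>v (b *\<^sub>v u))"
    using resolvent_vec(1)[OF q] unfolding eq by simp
  have "c *\<^sub>v q = rf_z \<cdot>\<^sub>v (c *\<^sub>v (Q *\<^sub>v (b *\<^sub>v u)))"
    using arg_cong[OF q, of "\<lambda>v. c *\<^sub>v v"] by simp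
  moreover have "G *\<^sub>v u = d *\<^sub>v u + rf_z \<cdot>\<^sub>v (c *\<^sub>v (Q *\<^sub>v (b *\<^sub>v u)))"
    unfolding G_eq by simp
  ultimately show ?thesis by (simp add: comm_add_vec[of _ m] carrier_dim_vec)
qed

lemma star_G_mult_vec:
  assumes y: "y \<in> carrier_vec m" and q: "q \<in> carrier_vec n"
    and eq: "q - inverse rf_z \<cdot>\<^sub>v (rmat_star a *\<^sub>v q) = rmat_star c *\<^sub>v y"
  shows "rmat_star G *\<^sub>v y = rmat_star d *\<^sub>v y + inverse rf_z \<cdot>\<^sub>v (rmat_star b *\<^sub>v q)"
proof -
  note [simp] = y[unfolded carrier_dim_vec] q[unfolded carrier_dim_vec] mat_vec_simps
  have q: "rmat_star Q *\<^sub>v (rmat_star c *\<^sub>v y) = q"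
    using resolvent_star_vec(1)[OF q] unfolding eq .
  have "rmat_star G = rmat_star d + inverse rf_z \<cdot>\<^sub>m (rmat_star b * (rmat_star Q * rmat_star c))"
    unfolding G_eq
    by (simp add: rmat_star_add[of _ m m] rmat_star_smult rmat_star_mult[of _ m n _ m]
        rmat_star_mult[of _ n n _ m] assoc_mult_mat[of _ m n _ n _ m] carrier_mat_dims)
  then show ?thesis by (simp add: q)
qed

text \<open>With a state \<open>q\<close> for \<open>y = G u\<close>, the system matrix maps \<open>(q, u)\<close> to \<open>(z\<^sup>-\<^sup>1 q, y)\<close>. Its adjoint maps back, which says that \<open>q\<close> is
  also a state for \<open>u = G\<^sup>* y\<close>.\<close>

lemma star_G_G_vec:
  assumes u: "u \<in> carrier_vec m"
  shows "rmat_star G *\<^sub>v (G *\<^sub>v u) = u"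
proof -
  define q where "q = Q *\<^sub>v (rf_z \<cdot>\<^sub>v (b *\<^sub>v u))"
  have q: "q \<in> carrier_vec n" by (simp add: q_def carrier_dim_vec)
  note [simp] = u[unfolded carrier_dim_vec] q[unfolded carrier_dim_vec]
  have e: "q - rf_z \<cdot>\<^sub>v (a *\<^sub>v q) = rf_z \<cdot>\<^sub>v (b *\<^sub>v u)"
    unfolding q_def by (intro resolvent_vec(2)) (simp add: carrier_dim_vec)
  have y: "G *\<^sub>v u = c *\<^sub>v q + d *\<^sub>v u" using G_mult_vec[OF u q e] .
  have s: "inverse rf_z \<cdot>\<^sub>v q = a *\<^sub>v q + b *\<^sub>v u"
  proof (rule eq_vecI)
    fix i assume "i < dim_vec (a *\<^sub>v q + b *\<^sub>v u)"
    then have i: "i < n" by simp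
    have "q $ i - rf_z * (a *\<^sub>v q) $ i = rf_z * (b *\<^sub>v u) $ i"
      using arg_cong[OF e, of "\<lambda>v. v $ i"] i by (simp del: index_mult_mat_vec)
    then have "q $ i = rf_z * ((a *\<^sub>v q) $ i + (b *\<^sub>v u) $ i)"
      by (simp add: algebra_simps del: index_mult_mat_vec)
    then show "(inverse rf_z \<cdot>\<^sub>v q) $ i = (a *\<^sub>v q + b *\<^sub>v u) $ i"
      using i by (simp add: field_simps del: index_mult_mat_vec)
  qed simp
  have s': "inverse rf_z \<cdot>\<^sub>v (M *\<^sub>v q) = M *\<^sub>v (a *\<^sub>v q) + M *\<^sub>v (b *\<^sub>v u)" if "dim_col M = n" for M
    using arg_cong[OF s, of "\<lambda>v. M *\<^sub>v v"] that by (simp add: mat_vec_simps)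
  have lin1: "q - (x + y) = w + v" if "x + w = q" "y + v = 0" for q x y w v :: ratfun
  proof -
    have "w + v = (x + w) + (y + v) - (x + y)" by simp
    then show ?thesis using that by simp
  qed
  have lin2: "w + v + (x + y) = u" if "x + w = 0" "y + v = u" for u x y w v :: ratfun
  proof -
    have "w + v + (x + y) = (x + w) + (y + v)" by (simp only: ac_simps)
    then show ?thesis using that by simp
  qed
  have "q - inverse rf_z \<cdot>\<^sub>v (rmat_star a *\<^sub>v q) = rmat_star c *\<^sub>v (c *\<^sub>v q + d *\<^sub>v u)"
  proof (rule eq_vecI)
    fix i assume "i < dim_vec (rmat_star c *\<^sub>v (c *\<^sub>v q + d *\<^sub>v u))"
    then have i: "i < n" by simp
    note 1 = arg_cong[OF unitary_vec(1)[OF q u], of "\<lambda>v. v $ i"]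
    note 2 = arg_cong[OF unitary_vec(2)[OF q u], of "\<lambda>v. v $ i"]
    show "(q - inverse rf_z \<cdot>\<^sub>v (rmat_star a *\<^sub>v q)) $ i = (rmat_star c *\<^sub>v (c *\<^sub>v q + d *\<^sub>v u)) $ i"
      using 1 2 i unfolding s'[of "rmat_star a", simplified]
      by (simp add: mat_vec_simps lin1 del: index_mult_mat_vec)
  qed simp
  from star_G_mult_vec[OF _ q this] have "rmat_star G *\<^sub>v (G *\<^sub>v u) =
      rmat_star d *\<^sub>v (c *\<^sub>v q + d *\<^sub>v u) + inverse rf_z \<cdot>\<^sub>v (rmat_star b *\<^sub>v q)"
    unfolding y by (simp add: carrier_dim_vec)
  also have "\<dots> = u"
  proof (rule eq_vecI)
    fix i assume "i < dim_vec u"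
    then have i: "i < m" by simp
    note 1 = arg_cong[OF unitary_vec(3)[OF q u], of "\<lambda>v. v $ i"]
    note 2 = arg_cong[OF unitary_vec(4)[OF q u], of "\<lambda>v. v $ i"]
    show "(rmat_star d *\<^sub>v (c *\<^sub>v q + d *\<^sub>v u) + inverse rf_z \<cdot>\<^sub>v (rmat_star b *\<^sub>v q)) $ i = u $ i"
      using 1 2 i unfolding s'[of "rmat_star b", simplified]
      by (simp add: mat_vec_simps lin2 del: index_mult_mat_vec)
  qed simp
  finally show ?thesis .
qed

lemma star_G_G: "rmat_star G * G = 1\<^sub>m m"
proof (rule eq_matI)
  define H where "H = rmat_star G * G"
  have H: "dim_row H = m" "dim_col H = m" by (simp_all add: H_def)
  have Hu: "H *\<^sub>v unit_vec m j = unit_vec m j" for j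
    using star_G_G_vec[of "unit_vec m j"] by (simp add: H_def mat_vec_simps)
  fix i j assume "i < dim_row (1\<^sub>m m :: ratfun mat)" "j < dim_col (1\<^sub>m m :: ratfun mat)"
  then have ij: "i < m" "j < m" by auto
  have "row H i \<in> carrier_vec m" using H by (simp add: carrier_dim_vec)
  then have "row H i \<bullet> unit_vec m j = row H i $ j" using ij by (intro scalar_prod_right_unit)
  moreover have "(H *\<^sub>v unit_vec m j) $ i = row H i \<bullet> unit_vec m j" using H ij by simp
  ultimately have "H $$ (i, j) = unit_vec m j $ i" using Hu H ij by simp
  then show "(rmat_star G * G) $$ (i, j) = 1\<^sub>m m $$ (i, j)"
    unfolding H_def[symmetric] using ij by simp
qed simp_all

lemma G_star_G: "G * rmat_star G = 1\<^sub>m m"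
  by (rule mat_mult_left_right_inverse[OF _ _ star_G_G]) (simp_all only: rmat_star_carrier G_carrier)

lemma G_star_G_vec:
  assumes y: "y \<in> carrier_vec m"
  shows "G *\<^sub>v (rmat_star G *\<^sub>v y) = y"
proof -
  have "(G * rmat_star G) *\<^sub>v y = G *\<^sub>v (rmat_star G *\<^sub>v y)"
    by (rule mat_vec_simps) (use y in simp_all)
  then show ?thesis unfolding G_star_G one_mult_mat_vec[OF y] ..
qed

text \<open>The functions \<open>C (I - z A)\<^sup>-\<^sup>1 x\<close> and \<open>(z I - A\<^sup>*)\<^sup>-\<^sup>1 x\<close>. The first ones form the model space of \<open>G\<close>, that is, the functions
  without poles on the closed disc which \<open>G\<^sup>*\<close> maps to strictly proper ones; the second ones, multiplied by \<open>B\<^sup>*\<close>, are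
  their images under \<open>G\<^sup>*\<close>.\<close>

definition model :: "complex vec \<Rightarrow> ratfun vec" where
  "model x = c *\<^sub>v (Q *\<^sub>v map_vec rf_const x)"

definition comodel :: "complex vec \<Rightarrow> ratfun vec" where
  "comodel x = inverse rf_z \<cdot>\<^sub>v (rmat_star Q *\<^sub>v map_vec rf_const x)"

lemma model_dim [simp]: "dim_vec (model x) = m" "dim_vec (comodel x) = n"
  by (simp_all add: model_def comodel_def)

lemma resolvent_const_Hplus:
  assumes "x \<in> carrier_vec n"
  shows "vec_in Hplus (Q *\<^sub>v map_vec rf_const x)"
  by (rule vec_in_Hplus_mult[OF entries_Q(1) vec_in_const[OF ring_closed_Hplus]])
    (use assms in simp_all)

lemma model_Hplus:
  assumes "x \<in> carrier_vec n"
  shows "vec_in Hplus (model x)"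
  unfolding model_def
  by (rule vec_in_Hplus_mult[OF entries_const(3)[OF ring_closed_Hplus] resolvent_const_Hplus[OF assms]]) simp_all

lemma comodel_Hstrict:
  assumes "x \<in> carrier_vec n"
  shows "vec_in Hstrict (comodel x)"
proof -
  have "vec_in Hminus (rmat_star Q *\<^sub>v map_vec rf_const x)"
    by (rule vec_in_Hminus_mult[OF entries_Q(2) vec_in_const[OF ring_closed_Hminus]]) (use assms in simp_all)
  then show ?thesis
    by (simp add: vec_in_def comodel_def Hstrict_def mult.assoc[symmetric] del: index_mult_mat_vec)
qed

lemma z_comodel:
  assumes "x \<in> carrier_vec n"
  shows "rf_z \<cdot>\<^sub>v comodel x = rmat_star a *\<^sub>v comodel x + map_vec rf_const x"
proof -
  define y where "y = rmat_star Q *\<^sub>v map_vec rf_const x"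
  have [simp]: "dim_vec y = n" "dim_vec x = n" using assms by (simp_all add: y_def)
  have e: "y - inverse rf_z \<cdot>\<^sub>v (rmat_star a *\<^sub>v y) = map_vec rf_const x"
    unfolding y_def by (rule resolvent_star_vec(2)) (simp add: carrier_dim_vec)
  show ?thesis unfolding comodel_def y_def[symmetric]
  proof (rule eq_vecI)
    fix i assume "i < dim_vec (rmat_star a *\<^sub>v (inverse rf_z \<cdot>\<^sub>v y) + map_vec rf_const x)"
    then have i: "i < n" by simp
    have "y $ i - inverse rf_z * (rmat_star a *\<^sub>v y) $ i = map_vec rf_const x $ i"
      using arg_cong[OF e, of "\<lambda>v. v $ i"] i by (simp del: index_mult_mat_vec)
    then show "(rf_z \<cdot>\<^sub>v (inverse rf_z \<cdot>\<^sub>v y)) $ i =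
        (rmat_star a *\<^sub>v (inverse rf_z \<cdot>\<^sub>v y) + map_vec rf_const x) $ i"
      using i by (simp add: mat_vec_simps mult.assoc[symmetric] diff_eq_eq add.commute
          del: index_mult_mat_vec index_map_vec index_add_vec) (simp del: index_mult_mat_vec)
  qed simp
qed

lemma comodel_unique:
  assumes "x \<in> carrier_vec n" "w \<in> carrier_vec n"
    and "rf_z \<cdot>\<^sub>v w = rmat_star a *\<^sub>v w + map_vec rf_const x"
  shows "comodel x = w"
proof -
  have [simp]: "dim_vec w = n" "dim_vec x = n" using assms by simp_all
  have "rf_z \<cdot>\<^sub>v w - inverse rf_z \<cdot>\<^sub>v (rmat_star a *\<^sub>v (rf_z \<cdot>\<^sub>v w)) = map_vec rf_const x"
  proof (rule eq_vecI)
    fix i assume "i < dim_vec (map_vec rf_const x)"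
    then have i: "i < n" by simp
    have "rf_z * w $ i = (rmat_star a *\<^sub>v w) $ i + map_vec rf_const x $ i"
      using arg_cong[OF assms(3), of "\<lambda>v. v $ i"] i by (simp del: index_mult_mat_vec)
    then show "(rf_z \<cdot>\<^sub>v w - inverse rf_z \<cdot>\<^sub>v (rmat_star a *\<^sub>v (rf_z \<cdot>\<^sub>v w))) $ i = map_vec rf_const x $ i"
      using i by (simp add: mat_vec_simps mult.assoc[symmetric] del: index_mult_mat_vec index_map_vec)
  qed simp
  then have "rmat_star Q *\<^sub>v map_vec rf_const x = rf_z \<cdot>\<^sub>v w"
    using resolvent_star_vec(1)[of "rf_z \<cdot>\<^sub>v w"] by (simp add: carrier_dim_vec)
  then show ?thesis by (simp add: comodel_def smult_smult_assoc)
qed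

lemma star_a_const:
  assumes "x \<in> carrier_vec n"
  shows "rmat_star a *\<^sub>v map_vec rf_const x = map_vec rf_const (mat_adjoint A *\<^sub>v x)"
  unfolding a_def rmat_star_const using assms dims by (intro rmat_const_mult_vec) simp_all

text \<open>Multiplication by \<open>z\<close> acts on these functions as \<open>A\<^sup>*\<close> acts on the parameter, up to a constant.\<close>

lemma comodel_shift:
  assumes x: "x \<in> carrier_vec n"
  shows "comodel (mat_adjoint A *\<^sub>v x) = rmat_star a *\<^sub>v comodel x"
proof (rule comodel_unique)
  have [simp]: "dim_vec x = n" using assms by simp
  show "mat_adjoint A *\<^sub>v x \<in> carrier_vec n" using dims by (simp add: carrier_dim_vec)
  show "rmat_star a *\<^sub>v comodel x \<in> carrier_vec n" by (simp add: carrier_dim_vec)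
  have "rmat_star a *\<^sub>v (rf_z \<cdot>\<^sub>v comodel x) =
      rmat_star a *\<^sub>v (rmat_star a *\<^sub>v comodel x + map_vec rf_const x)"
    by (simp only: z_comodel[OF x])
  then show "rf_z \<cdot>\<^sub>v (rmat_star a *\<^sub>v comodel x) =
      rmat_star a *\<^sub>v (rmat_star a *\<^sub>v comodel x) + map_vec rf_const (mat_adjoint A *\<^sub>v x)"
    using x by (simp add: mat_vec_simps star_a_const)
qed

text \<open>With \<open>w = (z I - A\<^sup>*)\<^sup>-\<^sup>1 x\<close>, a state for the input \<open>B\<^sup>* w\<close> is \<open>(I - z A)\<^sup>-\<^sup>1 x + A\<^sup>* w\<close>; the contributions of \<open>w\<close> to the
  state equation and to the output cancel by \<open>A A\<^sup>* + B B\<^sup>* = I\<close> and \<open>C A\<^sup>* + D B\<^sup>* = 0\<close>.\<close>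

lemma model_comodel:
  assumes x: "x \<in> carrier_vec n"
  shows "G *\<^sub>v (rmat_star b *\<^sub>v comodel x) = model x"
proof -
  define q where "q = Q *\<^sub>v map_vec rf_const x"
  define w where "w = comodel x"
  have [simp]: "dim_vec x = n" "dim_vec q = n" "dim_vec w = n"
    using assms by (simp_all add: q_def w_def)
  have wc: "w \<in> carrier_vec n" and qc: "q \<in> carrier_vec n" by (simp_all add: carrier_dim_vec)
  have zw: "rf_z \<cdot>\<^sub>v w = rmat_star a *\<^sub>v w + map_vec rf_const x"
    unfolding w_def using x by (rule z_comodel)
  have e: "q - rf_z \<cdot>\<^sub>v (a *\<^sub>v q) = map_vec rf_const x"
    unfolding q_def by (rule resolvent_vec(2)) (simp add: carrier_dim_vec)
  note u5 = unitary_vec(5)[OF wc zero_carrier_vec] and u6 = unitary_vec(6)[OF wc zero_carrier_vec]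
  have "G *\<^sub>v (rmat_star b *\<^sub>v w) = c *\<^sub>v (q + rmat_star a *\<^sub>v w) + d *\<^sub>v (rmat_star b *\<^sub>v w)"
  proof (rule G_mult_vec)
    show "q + rmat_star a *\<^sub>v w - rf_z \<cdot>\<^sub>v (a *\<^sub>v (q + rmat_star a *\<^sub>v w)) = rf_z \<cdot>\<^sub>v (b *\<^sub>v (rmat_star b *\<^sub>v w))"
    proof (rule eq_vecI)
      fix i assume "i < dim_vec (rf_z \<cdot>\<^sub>v (b *\<^sub>v (rmat_star b *\<^sub>v w)))"
      then have i: "i < n" by simp
      have 1: "q $ i - rf_z * (a *\<^sub>v q) $ i = map_vec rf_const x $ i"
        using arg_cong[OF e, of "\<lambda>v. v $ i"] i by (simp del: index_mult_mat_vec)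
      have 2: "rf_z * w $ i = (rmat_star a *\<^sub>v w) $ i + map_vec rf_const x $ i"
        using arg_cong[OF zw, of "\<lambda>v. v $ i"] i by (simp del: index_mult_mat_vec)
      have 3: "(a *\<^sub>v (rmat_star a *\<^sub>v w)) $ i + (b *\<^sub>v (rmat_star b *\<^sub>v w)) $ i = w $ i"
        using arg_cong[OF u5, of "\<lambda>v. v $ i"] i by (simp del: index_mult_mat_vec)
      have lin: "q + s - z * (aq + as) = z * bs"
        if "q - z * aq = x" "z * w = s + x" "as + bs = w" for q s z aq as bs w x :: ratfun
      proof -
        have "q + s - z * (aq + as) = (q - z * aq) + s - z * as" by (simp add: algebra_simps)
        also have "\<dots> = z * w - z * as" using that by (simp add: algebra_simps)
        also have "\<dots> = z * (as + bs) - z * as" using that(3) by simp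
        finally show ?thesis by (simp add: algebra_simps)
      qed
      show "(q + rmat_star a *\<^sub>v w - rf_z \<cdot>\<^sub>v (a *\<^sub>v (q + rmat_star a *\<^sub>v w))) $ i =
          (rf_z \<cdot>\<^sub>v (b *\<^sub>v (rmat_star b *\<^sub>v w))) $ i"
        using i lin[OF 1 2 3] by (simp add: mat_vec_simps del: index_mult_mat_vec index_map_vec)
    qed simp
  qed (simp_all add: carrier_dim_vec)
  also have "\<dots> = c *\<^sub>v q"
  proof (rule eq_vecI)
    fix i assume "i < dim_vec (c *\<^sub>v q)"
    then have i: "i < m" by simp
    have "(c *\<^sub>v (rmat_star a *\<^sub>v w)) $ i + (d *\<^sub>v (rmat_star b *\<^sub>v w)) $ i = 0"
      using arg_cong[OF u6, of "\<lambda>v. v $ i"] i by (simp del: index_mult_mat_vec)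
    then show "(c *\<^sub>v (q + rmat_star a *\<^sub>v w) + d *\<^sub>v (rmat_star b *\<^sub>v w)) $ i = (c *\<^sub>v q) $ i"
      using i by (simp add: mat_vec_simps add.assoc del: index_mult_mat_vec)
  qed simp
  finally show ?thesis by (simp add: model_def q_def w_def)
qed

text \<open>Observability. If \<open>C q = 0\<close> for \<open>q = (I - z A)\<^sup>-\<^sup>1 x\<close>, then \<open>q = A\<^sup>* A q\<close> by \<open>A\<^sup>* A + C\<^sup>* C = I\<close>. Together with \<open>z A q = q - x\<close>
  this identifies \<open>q\<close> with \<open>- (z I - A\<^sup>*)\<^sup>-\<^sup>1 A\<^sup>* x\<close>, which is strictly proper, while \<open>q\<close> has no poles on the closed disc. So \<open>q = 0\<close>.\<close>

lemma model_observable: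
  assumes x: "x \<in> carrier_vec n" and s: "vec_in Hstrict (model x)"
  shows "x = 0\<^sub>v n"
proof -
  have [simp]: "dim_vec x = n" using x by simp
  define q where "q = Q *\<^sub>v map_vec rf_const x"
  have [simp]: "dim_vec q = n" by (simp add: q_def)
  have qc: "q \<in> carrier_vec n" by (simp add: carrier_dim_vec)
  have q_plus: "vec_in Hplus q" unfolding q_def by (rule resolvent_const_Hplus[OF x])
  have e: "q - rf_z \<cdot>\<^sub>v (a *\<^sub>v q) = map_vec rf_const x"
    unfolding q_def by (rule resolvent_vec(2)) (simp add: carrier_dim_vec)
  have "model x $ i = 0" if "i < m" for i
    using model_Hplus[OF x] s that Hplus_Hstrict_zero by (simp add: vec_in_def)
  then have "model x = 0\<^sub>v m" by (intro eq_vecI) simp_all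
  then have "c *\<^sub>v q = 0\<^sub>v m" by (simp add: model_def q_def)
  moreover have "rmat_star c *\<^sub>v 0\<^sub>v m = 0\<^sub>v n" by (intro eq_vecI) (simp_all add: scalar_prod_def)
  ultimately have aq: "rmat_star a *\<^sub>v (a *\<^sub>v q) = q"
    using unitary_vec(1)[OF qc zero_carrier_vec] by (metis dim_mult_mat_vec carrier_vecI right_zero_vec rmat_star_dim(1) dim_carr(2))
  \<comment> \<open>The parameter with \<open>q = (z I - A\<^sup>*)\<^sup>-\<^sup>1 x'\<close>.\<close>
  define x' where "x' = (-1) \<cdot>\<^sub>v (mat_adjoint A *\<^sub>v x)"
  have [simp]: "dim_vec x' = n" using dims by (simp add: x'_def)
  have x'c: "x' \<in> carrier_vec n" by (simp add: carrier_dim_vec)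
  have "rf_z \<cdot>\<^sub>v q = rmat_star a *\<^sub>v q + map_vec rf_const x'"
  proof (rule eq_vecI)
    fix i assume "i < dim_vec (rmat_star a *\<^sub>v q + map_vec rf_const x')"
    then have i: "i < n" by simp
    have "rmat_star a *\<^sub>v q - rf_z \<cdot>\<^sub>v q = map_vec rf_const (mat_adjoint A *\<^sub>v x)"
      using arg_cong[OF e, of "\<lambda>v. rmat_star a *\<^sub>v v"] by (simp add: mat_vec_simps aq star_a_const[OF x])
    then have "(rmat_star a *\<^sub>v q) $ i - rf_z * q $ i = rf_const ((mat_adjoint A *\<^sub>v x) $ i)"
      using i dims by (metis index_map_vec(1) index_minus_vec(1) index_smult_vec(1,2) \<open>dim_vec q = n\<close>
          carrier_matD(2) dim_mult_mat_vec mat_adjoint_dim(1))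
    moreover have "map_vec rf_const x' $ i = - rf_const ((mat_adjoint A *\<^sub>v x) $ i)"
      using i dims by (simp add: x'_def rf_const.hom_uminus del: index_mult_mat_vec)
    ultimately show "(rf_z \<cdot>\<^sub>v q) $ i = (rmat_star a *\<^sub>v q + map_vec rf_const x') $ i"
      using i by (simp del: index_mult_mat_vec index_map_vec) (simp add: algebra_simps)
  qed simp
  from comodel_unique[OF x'c qc this] have "vec_in Hstrict q"
    using comodel_Hstrict[OF x'c] by simp
  then have "q $ i = 0" if "i < n" for i
    using q_plus that Hplus_Hstrict_zero by (simp add: vec_in_def)
  then have "q = 0\<^sub>v n" by (intro eq_vecI) simp_all
  then have "map_vec rf_const x $ i = 0" if "i < n" for i
    using arg_cong[OF e, of "\<lambda>v. v $ i"] that by (simp add: scalar_prod_def)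
  then show ?thesis by (intro eq_vecI) simp_all
qed

text \<open>Split the state into a part \<open>qp\<close> without poles on the closed disc and a strictly proper part \<open>qm\<close>. In the state equation the
  terms with \<open>qp\<close> and the remaining ones agree, hence are a constant vector \<open>x\<close> by Liouville's theorem. So
  \<open>qp = (I - z A)\<^sup>-\<^sup>1 x\<close>, and in the output equation the strictly proper remainder must vanish.\<close>

lemma model_space:
  assumes u: "u \<in> carrier_vec m" "vec_in Hstrict u" and f: "vec_in Hplus (G *\<^sub>v u)"
  obtains x where "x \<in> carrier_vec n" "G *\<^sub>v u = model x"
proof -
  have [simp]: "dim_vec u = m" using u by simp
  define bu where "bu = b *\<^sub>v u"
  have [simp]: "dim_vec bu = n" by (simp add: bu_def)
  have bu: "vec_in Hstrict bu" unfolding bu_def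
    by (rule vec_in_Hstrict_mult[OF entries_const(2)[OF ring_closed_Hminus] u(2)]) simp
  have zQ: "entries_in Hplus (rf_z \<cdot>\<^sub>m Q)"
    by (intro entries_in_smult ring_closed_Hplus rf_z_Hplus entries_Q)
  have dd: "dim_col (rf_z \<cdot>\<^sub>m Q) = dim_vec bu" by simp
  from vec_split[OF zQ bu dd] obtain qp qm
    where q: "(rf_z \<cdot>\<^sub>m Q) *\<^sub>v bu = qp + qm" "vec_in Hplus qp" "vec_in Hstrict qm"
      and dq: "dim_vec qp = dim_row (rf_z \<cdot>\<^sub>m Q)" "dim_vec qm = dim_row (rf_z \<cdot>\<^sub>m Q)" by blast
  have [simp]: "dim_vec qp = n" "dim_vec qm = n" using dq by simp_all
  have "Q *\<^sub>v (rf_z \<cdot>\<^sub>v bu) - rf_z \<cdot>\<^sub>v (a *\<^sub>v (Q *\<^sub>v (rf_z \<cdot>\<^sub>v bu))) = rf_z \<cdot>\<^sub>v bu"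
    by (rule resolvent_vec(2)) (simp add: carrier_dim_vec)
  moreover have "Q *\<^sub>v (rf_z \<cdot>\<^sub>v bu) = qp + qm" using q(1) by (simp add: mat_vec_simps)
  ultimately have e: "(qp + qm) - rf_z \<cdot>\<^sub>v (a *\<^sub>v (qp + qm)) = rf_z \<cdot>\<^sub>v bu" by simp
  have Gu: "G *\<^sub>v u = c *\<^sub>v (qp + qm) + d *\<^sub>v u"
    by (rule G_mult_vec) (use e u in \<open>simp_all add: carrier_dim_vec bu_def\<close>)
  \<comment> \<open>The side of the state equation without poles on the closed disc.\<close>
  define r where "r = qp - rf_z \<cdot>\<^sub>v (a *\<^sub>v qp)"
  have [simp]: "dim_vec r = n" by (simp add: r_def)
  have r: "r $ i \<in> Hplus" "r $ i \<in> Hminus" if i: "i < n" for i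
  proof -
    have aqp: "vec_in Hplus (a *\<^sub>v qp)"
      by (rule vec_in_Hplus_mult[OF entries_const(1)[OF ring_closed_Hplus] q(2)]) simp_all
    have aqm: "vec_in Hstrict (a *\<^sub>v qm)"
      by (rule vec_in_Hstrict_mult[OF entries_const(1)[OF ring_closed_Hminus] q(3)]) simp_all
    show "r $ i \<in> Hplus"
      using aqp q(2) i Hplus_minus Hplus_closed(3) rf_z_Hplus by (simp add: r_def vec_in_def del: index_mult_mat_vec)
    have 1: "qp $ i + qm $ i - rf_z * ((a *\<^sub>v qp) $ i + (a *\<^sub>v qm) $ i) = rf_z * bu $ i"
      using arg_cong[OF e, of "\<lambda>v. v $ i"] i by (simp add: mat_vec_simps del: index_mult_mat_vec)
    have lin: "p - z * ap = z * aq + bu - q" if "p + q - z * (ap + aq) = bu"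
      for p q z ap aq bu :: ratfun
      unfolding that[symmetric] by (simp add: distrib_left)
    have "r $ i = rf_z * (a *\<^sub>v qm) $ i + rf_z * bu $ i - qm $ i"
      using i lin[OF 1] by (simp add: r_def del: index_mult_mat_vec)
    moreover have "rf_z * (a *\<^sub>v qm) $ i \<in> Hminus" "rf_z * bu $ i \<in> Hminus" "qm $ i \<in> Hminus"
      using aqm bu Hstrict_imp_Hminus[of "qm $ i"] q(3) i
      by (simp_all add: vec_in_def Hstrict_def del: index_mult_mat_vec)
    ultimately show "r $ i \<in> Hminus" using Hminus_minus Hminus_closed(2) by metis
  qed
  have "\<forall>i. \<exists>k. i < n \<longrightarrow> r $ i = rf_const k" using r Hplus_Hminus_const by metis
  then obtain k where k: "i < n \<Longrightarrow> r $ i = rf_const (k i)" for i by metis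
  define x where "x = vec n k"
  have rx: "r = map_vec rf_const x" by (rule eq_vecI) (simp_all add: x_def k)
  have "Q *\<^sub>v r = qp" unfolding r_def by (rule resolvent_vec(1)) (simp add: carrier_dim_vec)
  then have mx: "model x = c *\<^sub>v qp" by (simp add: model_def rx)
  have x: "x \<in> carrier_vec n" by (simp add: x_def)
  have "(G *\<^sub>v u) $ i = model x $ i" if i: "i < m" for i
  proof -
    have cqm: "vec_in Hstrict (c *\<^sub>v qm)"
      by (rule vec_in_Hstrict_mult[OF entries_const(3)[OF ring_closed_Hminus] q(3)]) simp_all
    have du: "vec_in Hstrict (d *\<^sub>v u)"
      by (rule vec_in_Hstrict_mult[OF entries_const(4)[OF ring_closed_Hminus] u(2)]) simp_all
    have "(G *\<^sub>v u) $ i - model x $ i = (c *\<^sub>v qm) $ i + (d *\<^sub>v u) $ i"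
      using i unfolding Gu mx by (simp add: mat_vec_simps del: index_mult_mat_vec)
    moreover have "(c *\<^sub>v qm) $ i + (d *\<^sub>v u) $ i \<in> Hstrict"
      using cqm du i by (simp add: vec_in_def Hstrict_add del: index_mult_mat_vec)
    moreover have "(G *\<^sub>v u) $ i - model x $ i \<in> Hplus"
      using f model_Hplus[OF x] i by (simp add: vec_in_def Hplus_minus del: index_mult_mat_vec)
    ultimately show ?thesis using Hplus_Hstrict_zero by (metis eq_iff_diff_eq_0)
  qed
  then have "G *\<^sub>v u = model x" by (intro eq_vecI) simp_all
  then show thesis using x that by blast
qed

lemma model_add:
  "x \<in> carrier_vec n \<Longrightarrow> y \<in> carrier_vec n \<Longrightarrow> model (x + y) = model x + model y"
proof -
  assume "x \<in> carrier_vec n" "y \<in> carrier_vec n"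
  then have [simp]: "dim_vec x = n" "dim_vec y = n" by simp_all
  have "map_vec rf_const (x + y) = map_vec rf_const x + map_vec rf_const y"
    by (rule eq_vecI) (simp_all add: rf_const.hom_add)
  then show ?thesis by (simp add: model_def mat_vec_simps)
qed

lemma model_smult:
  "x \<in> carrier_vec n \<Longrightarrow> model (k \<cdot>\<^sub>v x) = rf_const k \<cdot>\<^sub>v model x"
proof -
  assume "x \<in> carrier_vec n"
  then have [simp]: "dim_vec x = n" by simp
  have "map_vec rf_const (k \<cdot>\<^sub>v x) = rf_const k \<cdot>\<^sub>v map_vec rf_const x"
    by (rule eq_vecI) (simp_all add: rf_const.hom_mult)
  then show ?thesis by (simp add: model_def mat_vec_simps)
qed

lemma model_zero: "model (0\<^sub>v n) = 0\<^sub>v m"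
proof -
  have "0 \<cdot>\<^sub>v 0\<^sub>v n = (0\<^sub>v n :: complex vec)" by (intro eq_vecI) simp_all
  then have "model (0\<^sub>v n) = 0 \<cdot>\<^sub>v model (0\<^sub>v n)" using model_smult[of "0\<^sub>v n" 0] by simp
  also have "\<dots> = 0\<^sub>v m" by (intro eq_vecI) simp_all
  finally show ?thesis .
qed

end

section \<open>The Stein equation and the kernels of the shifted functions\<close>

locale inner_pair =
  V: unitary_realization nv m Av Bv Cv Dv + W: unitary_realization nw m Aw Bw Cw Dw
  for nv nw m Av Bv Cv Dv Aw Bw Cw Dw +
  fixes X
  assumes X: "X \<in> carrier_mat nv nw"
    and stein: "X - Av * X * mat_adjoint Aw = Bv * mat_adjoint Bw"
begin

text \<open>The matrices \<open>A\<^sub>W\<^sup>*\<close> and \<open>[B\<^sub>W\<^sup>*; X A\<^sub>W\<^sup>*]\<close> of the theorem.\<close>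

definition "E = mat_adjoint Aw"

definition "K = mat_adjoint Bw @\<^sub>r (X * E)"

definition "X' = rmat_const X"

text \<open>The function \<open>W\<^sup>* f\<close> for the element \<open>f\<close> of the model space with parameter \<open>x\<close>.\<close>

definition comodel_image :: "complex vec \<Rightarrow> ratfun vec" where
  "comodel_image x = rmat_star W.b *\<^sub>v W.comodel x"

definition strict_part :: "complex vec \<Rightarrow> ratfun vec" where
  "strict_part x = V.c *\<^sub>v (X' *\<^sub>v (rmat_star W.a *\<^sub>v W.comodel x)) + V.d *\<^sub>v comodel_image x"

lemma E_carrier: "E \<in> carrier_mat nw nw"
  using W.dims by (simp add: E_def)

lemma K_carrier: "K \<in> carrier_mat (m + nv) nw"
  unfolding K_def using W.dims X E_carrier by (intro carrier_append_rows) simp_all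

lemma X'_dim [simp]: "dim_row X' = nv" "dim_col X' = nw"
  using X by (simp_all add: X'_def)

lemma dim_image [simp]: "dim_vec (comodel_image x) = m" "dim_vec (strict_part x) = m"
  by (simp_all add: comodel_image_def strict_part_def)

lemma comodel_image_Hstrict:
  assumes "x \<in> carrier_vec nw"
  shows "vec_in Hstrict (comodel_image x)"
  unfolding comodel_image_def
  by (rule vec_in_Hstrict_mult[OF entries_in_star_Hplus[OF W.entries_const(2)[OF ring_closed_Hplus]]
        W.comodel_Hstrict[OF assms]]) simp

lemma strict_part_Hstrict:
  assumes "x \<in> carrier_vec nw"
  shows "vec_in Hstrict (strict_part x)"
proof -
  have 1: "vec_in Hstrict (rmat_star W.a *\<^sub>v W.comodel x)"
    by (rule vec_in_Hstrict_mult[OF entries_in_star_Hplus[OF W.entries_const(1)[OF ring_closed_Hplus]]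
        W.comodel_Hstrict[OF assms]]) simp
  have "entries_in Hminus X'" unfolding X'_def by (rule entries_in_const[OF ring_closed_Hminus])
  then have 2: "vec_in Hstrict (X' *\<^sub>v (rmat_star W.a *\<^sub>v W.comodel x))"
    by (rule vec_in_Hstrict_mult[OF _ 1]) simp
  show ?thesis unfolding strict_part_def
    by (intro vec_in_add Hstrict_add vec_in_Hstrict_mult[OF V.entries_const(3)[OF ring_closed_Hminus] 2]
      vec_in_Hstrict_mult[OF V.entries_const(4)[OF ring_closed_Hminus] comodel_image_Hstrict[OF assms]]) simp_all
qed

lemma stein_vec:
  assumes y: "dim_vec y = nw"
  shows "V.b *\<^sub>v (rmat_star W.b *\<^sub>v y) = X' *\<^sub>v y - V.a *\<^sub>v (X' *\<^sub>v (rmat_star W.a *\<^sub>v y))"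
proof -
  have "rmat_const (X - Av * X * E) = X' - V.a * X' * rmat_star W.a"
  proof -
    have 1: "Av * X * E \<in> carrier_mat nv nw"
      using V.dims X E_carrier by (intro mult_carrier_mat[of _ nv nw] mult_carrier_mat[of _ nv nv])
    have "rmat_const (X - Av * X * E) = rmat_const X - rmat_const (Av * X * E)"
    proof (rule eq_matI)
      fix i j assume "i < dim_row (rmat_const X - rmat_const (Av * X * E))"
        "j < dim_col (rmat_const X - rmat_const (Av * X * E))"
      then have ij: "i < nv" "j < nw" using carrier_matD[OF 1] by simp_all
      define Y where "Y = Av * X * E"
      have "dim_row Y = nv" "dim_col Y = nw" using carrier_matD[OF 1] by (simp_all only: Y_def)
      then show "rmat_const (X - Av * X * E) $$ (i, j) = (rmat_const X - rmat_const (Av * X * E)) $$ (i, j)"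
        unfolding Y_def[symmetric] using X ij by (simp add: rmat_const_def rf_const.hom_minus)
    qed (use carrier_matD[OF 1] carrier_matD[OF V.dims(1)] carrier_matD[OF E_carrier] in simp_all)
    also have "rmat_const (Av * X * E) = rmat_const (Av * X) * rmat_const E"
      using V.dims X E_carrier by (intro rmat_const_mult[of _ nv nw]) (auto intro: mult_carrier_mat)
    also have "rmat_const (Av * X) = rmat_const Av * rmat_const X"
      using V.dims X by (intro rmat_const_mult)
    finally show ?thesis by (simp add: X'_def V.a_def W.a_def E_def rmat_star_const)
  qed
  moreover have "rmat_const (Bv * mat_adjoint Bw) = V.b * rmat_star W.b"
    unfolding V.b_def W.b_def rmat_star_const using V.dims W.dims
    by (intro rmat_const_mult[of _ nv m]) simp_all
  ultimately have eq: "X' - V.a * X' * rmat_star W.a = V.b * rmat_star W.b"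
    using stein by (simp add: E_def)
  have "V.b *\<^sub>v (rmat_star W.b *\<^sub>v y) = (V.b * rmat_star W.b) *\<^sub>v y"
    using y by (simp add: mat_vec_simps)
  also have "\<dots> = X' *\<^sub>v y - V.a *\<^sub>v (X' *\<^sub>v (rmat_star W.a *\<^sub>v y))"
    unfolding eq[symmetric] using y by (simp add: mat_vec_simps)
  finally show ?thesis .
qed

text \<open>The Stein equation allows the state \<open>X A\<^sub>W\<^sup>* w + (I - z A\<^sub>V)\<^sup>-\<^sup>1 X x\<close> for the input \<open>B\<^sub>W\<^sup>* w\<close>, where
  \<open>z w = A\<^sub>W\<^sup>* w + x\<close>. The first summand gives the strictly proper part of the output.\<close>

lemma V_comodel_image:
  assumes x: "x \<in> carrier_vec nw"
  shows "V.G *\<^sub>v comodel_image x = strict_part x + V.model (X *\<^sub>v x)"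
proof -
  define w where "w = W.comodel x"
  have [simp]: "dim_vec x = nw" "dim_vec w = nw" using x by (simp_all add: w_def)
  define q1 where "q1 = X' *\<^sub>v (rmat_star W.a *\<^sub>v w)"
  define q0 where "q0 = V.Q *\<^sub>v map_vec rf_const (X *\<^sub>v x)"
  have [simp]: "dim_vec q1 = nv" "dim_vec q0 = nv" by (simp_all add: q1_def q0_def)
  have Xx: "map_vec rf_const (X *\<^sub>v x) = X' *\<^sub>v map_vec rf_const x"
    unfolding X'_def using rmat_const_mult_vec[OF X x] by simp
  have e0: "q0 - rf_z \<cdot>\<^sub>v (V.a *\<^sub>v q0) = X' *\<^sub>v map_vec rf_const x"
    unfolding q0_def Xx by (rule V.resolvent_vec(2)) (simp add: carrier_dim_vec)
  have "rf_z \<cdot>\<^sub>v (X' *\<^sub>v w) = X' *\<^sub>v (rf_z \<cdot>\<^sub>v w)" by (simp add: mat_vec_simps)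
  also have "\<dots> = X' *\<^sub>v (rmat_star W.a *\<^sub>v w + map_vec rf_const x)"
    unfolding w_def W.z_comodel[OF x] ..
  finally have zX: "rf_z \<cdot>\<^sub>v (X' *\<^sub>v w) = q1 + X' *\<^sub>v map_vec rf_const x"
    by (simp add: mat_vec_simps q1_def)
  have sv: "V.b *\<^sub>v (rmat_star W.b *\<^sub>v w) = X' *\<^sub>v w - V.a *\<^sub>v q1"
    unfolding q1_def by (rule stein_vec) simp
  have "V.G *\<^sub>v (rmat_star W.b *\<^sub>v w) = V.c *\<^sub>v (q1 + q0) + V.d *\<^sub>v (rmat_star W.b *\<^sub>v w)"
  proof (rule V.G_mult_vec)
    show "q1 + q0 - rf_z \<cdot>\<^sub>v (V.a *\<^sub>v (q1 + q0)) = rf_z \<cdot>\<^sub>v (V.b *\<^sub>v (rmat_star W.b *\<^sub>v w))"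
      unfolding sv
    proof (rule eq_vecI)
      fix i assume "i < dim_vec (rf_z \<cdot>\<^sub>v (X' *\<^sub>v w - V.a *\<^sub>v q1))"
      then have i: "i < nv" by simp
      have 1: "q0 $ i - rf_z * (V.a *\<^sub>v q0) $ i = (X' *\<^sub>v map_vec rf_const x) $ i"
        using arg_cong[OF e0, of "\<lambda>v. v $ i"] i by (simp del: index_mult_mat_vec)
      have 2: "rf_z * (X' *\<^sub>v w) $ i = q1 $ i + (X' *\<^sub>v map_vec rf_const x) $ i"
        using arg_cong[OF zX, of "\<lambda>v. v $ i"] i by (simp del: index_mult_mat_vec)
      have lin: "p + q - z * (ap + aq) = z * (w - ap)" if "q - z * aq = y" "z * w = p + y"
        for p q z ap aq w y :: ratfun
      proof -
        have "p + q - z * (ap + aq) = p + (q - z * aq) - z * ap" by (simp add: distrib_left)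
        then show ?thesis using that by (simp add: right_diff_distrib)
      qed
      show "(q1 + q0 - rf_z \<cdot>\<^sub>v (V.a *\<^sub>v (q1 + q0))) $ i = (rf_z \<cdot>\<^sub>v (X' *\<^sub>v w - V.a *\<^sub>v q1)) $ i"
        using i lin[OF 1 2] by (simp add: mat_vec_simps del: index_mult_mat_vec)
    qed simp
  qed (simp_all add: carrier_dim_vec)
  also have "\<dots> = strict_part x + V.model (X *\<^sub>v x)"
  proof (rule eq_vecI)
    fix i assume "i < dim_vec (strict_part x + V.model (X *\<^sub>v x))"
    then show "(V.c *\<^sub>v (q1 + q0) + V.d *\<^sub>v (rmat_star W.b *\<^sub>v w)) $ i = (strict_part x + V.model (X *\<^sub>v x)) $ i"
      by (simp add: strict_part_def V.model_def comodel_image_def mat_vec_simps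
          ac_simps flip: q1_def q0_def w_def del: index_mult_mat_vec)
  qed simp
  finally show ?thesis by (simp add: comodel_image_def w_def)
qed

text \<open>Turns the vanishing of a constant state together with that of the constant term of the output into the two conditions that
  define \<open>Ker K\<close>.\<close>

lemma unitary_kernel:
  assumes p: "p \<in> carrier_vec nv" and y: "y \<in> carrier_vec m"
    and "Av *\<^sub>v p + Bv *\<^sub>v y = 0\<^sub>v nv" "Cv *\<^sub>v p + Dv *\<^sub>v y = 0\<^sub>v m"
  shows "p = 0\<^sub>v nv" "y = 0\<^sub>v m"
proof -
  let ?U = "four_block_mat Av Bv Cv Dv"
  have U: "?U \<in> carrier_mat (nv + m) (nv + m)" using V.dims by simp
  have py: "p @\<^sub>v y \<in> carrier_vec (nv + m)" using p y by simp
  have zz: "0\<^sub>v nv @\<^sub>v 0\<^sub>v m = (0\<^sub>v (nv + m) :: complex vec)" by (intro eq_vecI) auto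
  have "?U *\<^sub>v (p @\<^sub>v y) = (Av *\<^sub>v p + Bv *\<^sub>v y) @\<^sub>v (Cv *\<^sub>v p + Dv *\<^sub>v y)"
    by (rule four_block_mat_mult_vec[OF V.dims p y])
  then have U0: "?U *\<^sub>v (p @\<^sub>v y) = 0\<^sub>v (nv + m)" by (simp only: assms(3,4) zz)
  have "p @\<^sub>v y = (mat_adjoint ?U * ?U) *\<^sub>v (p @\<^sub>v y)"
    using V.unitary py by (simp add: unitary_mat_def)
  also have "\<dots> = mat_adjoint ?U *\<^sub>v (?U *\<^sub>v (p @\<^sub>v y))"
    by (rule assoc_mult_mat_vec[OF _ U py]) (use U in simp)
  also have "\<dots> = 0\<^sub>v (nv + m)" unfolding U0 using carrier_matD[OF U] by (intro eq_vecI) (simp_all add: scalar_prod_def)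
  finally have "p @\<^sub>v y = 0\<^sub>v nv @\<^sub>v 0\<^sub>v m" by (simp only: zz)
  then show "p = 0\<^sub>v nv" "y = 0\<^sub>v m" using append_vec_eq[OF p zero_carrier_vec] by blast+
qed

lemma strict_iff_ker:
  assumes x: "x \<in> carrier_vec nw"
  shows "vec_in Hstrict (V.G *\<^sub>v comodel_image x) \<longleftrightarrow> X *\<^sub>v x = 0\<^sub>v nv"
proof
  have Xx: "X *\<^sub>v x \<in> carrier_vec nv" using X x by (rule mult_mat_vec_carrier)
  assume "vec_in Hstrict (V.G *\<^sub>v comodel_image x)"
  then have "vec_in Hstrict (strict_part x + V.model (X *\<^sub>v x))" by (simp only: V_comodel_image[OF x])
  then have "V.model (X *\<^sub>v x) $ i \<in> Hstrict" if "i < m" for i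
    using strict_part_Hstrict[OF x] Hstrict_minus[of "strict_part x $ i + V.model (X *\<^sub>v x) $ i" "strict_part x $ i"] that
    by (simp add: vec_in_def)
  then show "X *\<^sub>v x = 0\<^sub>v nv" by (intro V.model_observable[OF Xx]) (simp add: vec_in_def)
next
  assume "X *\<^sub>v x = 0\<^sub>v nv"
  then show "vec_in Hstrict (V.G *\<^sub>v comodel_image x)"
    unfolding V_comodel_image[OF x] using strict_part_Hstrict[OF x] by (simp add: vec_in_def V.model_zero)
qed

text \<open>The parameters of the functions in the kernel of the Toeplitz operator with symbol \<open>z\<^sup>k \<Xi>\<close>.\<close>

definition N :: "nat \<Rightarrow> complex vec set" where
  "N k = mat_kernel X \<inter> Ker_k k K E"

lemma mem_K:
  "x \<in> mat_kernel K \<longleftrightarrow> x \<in> carrier_vec nw \<and> mat_adjoint Bw *\<^sub>v x = 0\<^sub>v m \<and> X *\<^sub>v (E *\<^sub>v x) = 0\<^sub>v nv"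
proof (cases "x \<in> carrier_vec nw")
  case x: True
  have "X * E \<in> carrier_mat nv nw" using X E_carrier by (rule mult_carrier_mat)
  moreover have "(X * E) *\<^sub>v x = X *\<^sub>v (E *\<^sub>v x)" using X E_carrier x by (rule assoc_mult_mat_vec)
  ultimately show ?thesis using x mult_append_rows_eq_0[of "mat_adjoint Bw" m nw "X * E" nv x] W.dims
    by (simp add: K_def)
next
  case False
  then show ?thesis using K_carrier by (auto simp: mat_kernel)
qed

text \<open>The constant \<open>g\<close> is the value of \<open>z\<close> times the strictly proper part at infinity.\<close>

lemma strict_part_const:
  assumes x: "x \<in> carrier_vec nw"
  defines "g \<equiv> Cv *\<^sub>v (X *\<^sub>v (E *\<^sub>v x)) + Dv *\<^sub>v (mat_adjoint Bw *\<^sub>v x)"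
  shows "rf_z \<cdot>\<^sub>v strict_part x = strict_part (E *\<^sub>v x) + map_vec rf_const g"
proof -
  have Ex: "E *\<^sub>v x \<in> carrier_vec nw" using E_carrier x by (rule mult_mat_vec_carrier)
  have [simp]: "dim_vec x = nw" using x by simp
  define w where "w = W.comodel x"
  have [simp]: "dim_vec w = nw" by (simp add: w_def)
  have zw: "rf_z \<cdot>\<^sub>v w = rmat_star W.a *\<^sub>v w + map_vec rf_const x" unfolding w_def by (rule W.z_comodel[OF x])
  have wE: "W.comodel (E *\<^sub>v x) = rmat_star W.a *\<^sub>v w"
    unfolding w_def E_def by (rule W.comodel_shift[OF x])
  have zM: "rf_z \<cdot>\<^sub>v (M *\<^sub>v w) = M *\<^sub>v (rmat_star W.a *\<^sub>v w) + M *\<^sub>v map_vec rf_const x"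
    if "dim_col M = nw" for M
    using arg_cong[OF zw, of "\<lambda>v. M *\<^sub>v v"] that by (simp add: mat_vec_simps)
  have XEx: "X' *\<^sub>v (rmat_star W.a *\<^sub>v map_vec rf_const x) = map_vec rf_const (X *\<^sub>v (E *\<^sub>v x))"
    unfolding W.star_a_const[OF x] X'_def E_def[symmetric] by (rule rmat_const_mult_vec[OF X Ex])
  have CXEx: "V.c *\<^sub>v map_vec rf_const (X *\<^sub>v (E *\<^sub>v x)) = map_vec rf_const (Cv *\<^sub>v (X *\<^sub>v (E *\<^sub>v x)))"
    unfolding V.c_def by (rule rmat_const_mult_vec[OF V.dims(3) mult_mat_vec_carrier[OF X Ex]])
  have Bx: "rmat_star W.b *\<^sub>v map_vec rf_const x = map_vec rf_const (mat_adjoint Bw *\<^sub>v x)"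
    unfolding W.b_def rmat_star_const using W.dims x by (intro rmat_const_mult_vec[of _ m nw]) simp_all
  have Bxc: "mat_adjoint Bw *\<^sub>v x \<in> carrier_vec m"
    using W.dims x by (intro mult_mat_vec_carrier[of _ m nw]) simp_all
  have DBx: "V.d *\<^sub>v map_vec rf_const (mat_adjoint Bw *\<^sub>v x) = map_vec rf_const (Dv *\<^sub>v (mat_adjoint Bw *\<^sub>v x))"
    unfolding V.d_def by (rule rmat_const_mult_vec[OF V.dims(4) Bxc])
  have "rf_z \<cdot>\<^sub>v strict_part x =
      V.c *\<^sub>v (X' *\<^sub>v (rmat_star W.a *\<^sub>v (rf_z \<cdot>\<^sub>v w))) + V.d *\<^sub>v (rmat_star W.b *\<^sub>v (rf_z \<cdot>\<^sub>v w))"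
    by (simp add: strict_part_def comodel_image_def mat_vec_simps smult_add_distrib_vec[of _ m] carrier_dim_vec
        flip: w_def)
  also have "\<dots> = (V.c *\<^sub>v (X' *\<^sub>v (rmat_star W.a *\<^sub>v (rmat_star W.a *\<^sub>v w))) + V.c *\<^sub>v map_vec rf_const (X *\<^sub>v (E *\<^sub>v x)))
      + (V.d *\<^sub>v (rmat_star W.b *\<^sub>v (rmat_star W.a *\<^sub>v w)) + V.d *\<^sub>v map_vec rf_const (mat_adjoint Bw *\<^sub>v x))"
    unfolding zw by (simp add: mat_vec_simps XEx Bx carrier_matD[OF X] carrier_matD[OF W.dims(2)])
  also have "\<dots> = strict_part (E *\<^sub>v x) + map_vec rf_const g"
    unfolding CXEx DBx
    by (rule eq_vecI)
      (simp_all add: strict_part_def comodel_image_def wE g_def rf_const.hom_add carrier_matD[OF V.dims(3)]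
         carrier_matD[OF V.dims(4)] del: index_mult_mat_vec add: ac_simps)
  finally show ?thesis .
qed

text \<open>Induction on \<open>k\<close>. If \<open>z\<^sup>k\<^sup>+\<^sup>1\<close> times the function is strictly proper, then so are all lower powers. Power \<open>0\<close> gives \<open>X x = 0\<close>, and
  power \<open>1\<close> makes the constant \<open>g\<close> above vanish. By the Stein equation the unitary system matrix of \<open>V\<close> then annihilates
  \<open>(X A\<^sub>W\<^sup>* x, B\<^sub>W\<^sup>* x)\<close>, so both vectors are \<open>0\<close> and \<open>x\<close> may be replaced by \<open>A\<^sub>W\<^sup>* x\<close> at the cost of one factor \<open>z\<close>.\<close>

lemma strict_iff_N:
  assumes "x \<in> carrier_vec nw"
  shows "vec_in Hstrict (rf_z ^ k \<cdot>\<^sub>v (V.G *\<^sub>v comodel_image x)) \<longleftrightarrow> x \<in> N k"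
  using assms
proof (induct k arbitrary: x)
  case 0
  then show ?case using strict_iff_ker[OF 0] X E_carrier by (simp add: N_def Ker_k_0 mat_kernel[OF X])
next
  case (Suc k)
  note x = Suc.prems
  have Ex: "E *\<^sub>v x \<in> carrier_vec nw" using E_carrier x by (rule mult_mat_vec_carrier)
  have Bxc: "mat_adjoint Bw *\<^sub>v x \<in> carrier_vec m"
    using W.dims x by (intro mult_mat_vec_carrier[of _ m nw]) simp_all
  have XExc: "X *\<^sub>v (E *\<^sub>v x) \<in> carrier_vec nv" using X Ex by (rule mult_mat_vec_carrier)
  let ?F = "\<lambda>x. V.G *\<^sub>v comodel_image x"
  let ?g = "Cv *\<^sub>v (X *\<^sub>v (E *\<^sub>v x)) + Dv *\<^sub>v (mat_adjoint Bw *\<^sub>v x)"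
  have Xx: "X *\<^sub>v x = Av *\<^sub>v (X *\<^sub>v (E *\<^sub>v x)) + Bv *\<^sub>v (mat_adjoint Bw *\<^sub>v x)"
  proof -
    have "Bv *\<^sub>v (mat_adjoint Bw *\<^sub>v x) = (Bv * mat_adjoint Bw) *\<^sub>v x"
      by (rule assoc_mult_mat_vec[symmetric, of _ nv m _ nw]) (use V.dims W.dims x in simp_all)
    also have "\<dots> = X *\<^sub>v x - Av *\<^sub>v (X *\<^sub>v (E *\<^sub>v x))"
      unfolding stein[symmetric] E_def
      by (simp add: mat_vec_simps carrier_matD[OF X] carrier_matD[OF V.dims(1)] carrier_matD[OF W.dims(1)]
          carrier_vecD[OF x])
    finally show ?thesis
      by (simp add: vec_eq_iff carrier_matD[OF X] carrier_matD[OF V.dims(1)] carrier_matD[OF V.dims(2)]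
          del: index_mult_mat_vec)
  qed
  have F: "?F y = strict_part y" if "y \<in> carrier_vec nw" "X *\<^sub>v y = 0\<^sub>v nv" for y
    unfolding V_comodel_image[OF that(1)] that(2) V.model_zero by (simp add: carrier_dim_vec)
  have shift: "rf_z \<cdot>\<^sub>v ?F x = ?F (E *\<^sub>v x)"
    if "X *\<^sub>v x = 0\<^sub>v nv" "X *\<^sub>v (E *\<^sub>v x) = 0\<^sub>v nv" "mat_adjoint Bw *\<^sub>v x = 0\<^sub>v m"
  proof -
    have "map_vec rf_const ?g = 0\<^sub>v m"
      unfolding that(2,3) by (intro eq_vecI) (simp_all add: scalar_prod_def carrier_matD[OF V.dims(3)] carrier_matD[OF V.dims(4)])
    then show ?thesis
      unfolding F[OF x that(1)] F[OF Ex that(2)] strict_part_const[OF x]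
      by (simp only:) (simp add: carrier_dim_vec)
  qed
  have split_power: "rf_z ^ Suc k \<cdot>\<^sub>v v = rf_z ^ k \<cdot>\<^sub>v (rf_z \<cdot>\<^sub>v v)" for v :: "ratfun vec"
    by (simp add: smult_smult_assoc mult.commute)
  show ?case
  proof
    assume s: "vec_in Hstrict (rf_z ^ Suc k \<cdot>\<^sub>v ?F x)"
    have low: "vec_in Hstrict (rf_z ^ j \<cdot>\<^sub>v ?F x)" if "j \<le> Suc k" for j
    proof -
      have "rf_z ^ j = inverse rf_z ^ (Suc k - j) * rf_z ^ Suc k"
        using that by (simp only: power_inverse) (simp add: power_diff field_simps del: power_Suc)
      then have "rf_z ^ j \<cdot>\<^sub>v ?F x = inverse rf_z ^ (Suc k - j) \<cdot>\<^sub>v (rf_z ^ Suc k \<cdot>\<^sub>v ?F x)"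
        by (simp add: smult_smult_assoc)
      then show ?thesis using vec_in_Hstrict_smult[OF inverse_rf_z_power_Hminus s] by simp
    qed
    have X0: "X *\<^sub>v x = 0\<^sub>v nv" using low[of 0] strict_iff_ker[OF x] by simp
    have "vec_in Hstrict (strict_part (E *\<^sub>v x) + map_vec rf_const ?g)"
      using low[of 1] by (simp add: F[OF x X0] strict_part_const[OF x])
    then have "rf_const (?g $ i) \<in> Hstrict" if "i < m" for i
      using strict_part_Hstrict[OF Ex] that V.dims
        Hstrict_minus[of "strict_part (E *\<^sub>v x) $ i + rf_const (?g $ i)" "strict_part (E *\<^sub>v x) $ i"]
      by (simp add: vec_in_def del: index_mult_mat_vec rf_const_Hstrict)
    then have "?g $ i = 0" if "i < m" for i using that by simp
    then have "?g = 0\<^sub>v m"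
      by (intro eq_vecI) (simp_all add: carrier_matD[OF V.dims(4)] del: index_mult_mat_vec(1) index_add_vec(1))
    from unitary_kernel[OF XExc Bxc Xx[symmetric, unfolded X0] this]
    have 0: "X *\<^sub>v (E *\<^sub>v x) = 0\<^sub>v nv" "mat_adjoint Bw *\<^sub>v x = 0\<^sub>v m" .
    have "vec_in Hstrict (rf_z ^ k \<cdot>\<^sub>v ?F (E *\<^sub>v x))"
      using s unfolding split_power shift[OF X0 0] .
    then have "E *\<^sub>v x \<in> N k" using Suc.hyps[OF Ex] by simp
    then show "x \<in> N (Suc k)"
      using 0 x X0 by (simp add: N_def Ker_k_Suc[OF K_carrier E_carrier] mem_K mat_kernel[OF X])
  next
    assume "x \<in> N (Suc k)"
    then have 0: "X *\<^sub>v (E *\<^sub>v x) = 0\<^sub>v nv" "mat_adjoint Bw *\<^sub>v x = 0\<^sub>v m" "X *\<^sub>v x = 0\<^sub>v nv"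
      and "E *\<^sub>v x \<in> Ker_k k K E"
      by (simp_all add: N_def Ker_k_Suc[OF K_carrier E_carrier] mem_K mat_kernel[OF X])
    then have "E *\<^sub>v x \<in> N k" using Ex by (simp add: N_def mat_kernel[OF X])
    then show "vec_in Hstrict (rf_z ^ Suc k \<cdot>\<^sub>v ?F x)"
      unfolding split_power shift[OF 0(3,1,2)] using Suc.hyps[OF Ex] by simp
  qed
qed

lemma linear_subspace_N: "linear_subspace nw (N k)"
proof -
  note D = linear_subspaceD[OF linear_subspace_kernel[OF X]]
    linear_subspaceD[OF linear_subspace_Ker_k[OF E_carrier K_carrier, of k]]
  show ?thesis unfolding N_def by (rule linear_subspaceI) (use D in blast)+
qed

section \<open>Dimensions from a Wiener-Hopf factorization\<close>

text \<open>In the coordinates \<open>p = W\<^sub>+ f\<close>, membership of \<open>f\<close> in the \<open>k\<close>-th space says that every \<open>z\<^sup>k\<^sup>+\<^sup>d\<^sub>i p\<^sub>i\<close> is strictly proper. If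
  \<open>d\<^sub>i \<ge> - k\<close>, this leaves only \<open>p\<^sub>i = 0\<close>. For the other coordinates the values of \<open>z\<^sup>k\<^sup>+\<^sup>1\<^sup>+\<^sup>d\<^sub>i p\<^sub>i\<close> at infinity are
  arbitrary, and they all vanish exactly on the next space; so rank-nullity applies.\<close>

theorem wiener_hopf_dimension:
  fixes d :: "nat \<Rightarrow> int"
  assumes Wm: "Wm \<in> carrier_mat m m" "entries_in Hminus Wm"
    and Wm': "Wm' \<in> carrier_mat m m" "entries_in Hminus Wm'" "Wm' * Wm = 1\<^sub>m m"
    and Wp: "Wp \<in> carrier_mat m m" "entries_in Hplus Wp"
    and Wp': "Wp' \<in> carrier_mat m m" "entries_in Hplus Wp'" "Wp * Wp' = 1\<^sub>m m"
    and fact: "V.G * rmat_star W.G = Wm * mat_diag m (\<lambda>i. rf_z powi d i) * Wp"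
  shows "subspace_dim nw (N k) = subspace_dim nw (N (Suc k)) + card {i. i < m \<and> d i < - int k}"
proof -
  define \<Xi> where "\<Xi> = V.G * rmat_star W.G"
  note Wdim [simp] = carrier_matD[OF Wm(1)] carrier_matD[OF Wm'(1)] carrier_matD[OF Wp(1)] carrier_matD[OF Wp'(1)]
  have \<Xi>_dim [simp]: "dim_row \<Xi> = m" "dim_col \<Xi> = m" by (simp_all add: \<Xi>_def)
  let ?D = "mat_diag m (\<lambda>i. rf_z powi d i)"
  have D_dim [simp]: "dim_row ?D = m" "dim_col ?D = m" by (simp_all add: mat_diag_def)
  have coords: "vec_in Hstrict (rf_z ^ j \<cdot>\<^sub>v (\<Xi> *\<^sub>v f)) \<longleftrightarrow>
      (\<forall>i < m. rf_z powi (int j + d i) * (Wp *\<^sub>v f) $ i \<in> Hstrict)"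
    if f: "dim_vec f = m" for f j
  proof -
    define h where "h = rf_z ^ j \<cdot>\<^sub>v (?D *\<^sub>v (Wp *\<^sub>v f))"
    have [simp]: "dim_vec h = m" by (simp add: h_def)
    have h_ix: "h $ i = rf_z powi (int j + d i) * (Wp *\<^sub>v f) $ i" if "i < m" for i
      using that by (simp add: h_def mat_diag_vec power_int_add mult.assoc del: index_mult_mat_vec(1))
    have 1: "rf_z ^ j \<cdot>\<^sub>v (\<Xi> *\<^sub>v f) = Wm *\<^sub>v h"
      unfolding \<Xi>_def fact h_def using f by (simp add: mat_vec_simps)
    have "Wm' *\<^sub>v (Wm *\<^sub>v h) = (Wm' * Wm) *\<^sub>v h" by (simp add: mat_vec_simps)
    also have "\<dots> = h" unfolding Wm'(3) by (simp add: carrier_dim_vec)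
    finally have 2: "h = Wm' *\<^sub>v (rf_z ^ j \<cdot>\<^sub>v (\<Xi> *\<^sub>v f))" unfolding 1 ..
    have "vec_in Hstrict (rf_z ^ j \<cdot>\<^sub>v (\<Xi> *\<^sub>v f)) \<longleftrightarrow> vec_in Hstrict h"
    proof
      assume "vec_in Hstrict (rf_z ^ j \<cdot>\<^sub>v (\<Xi> *\<^sub>v f))"
      then show "vec_in Hstrict h" unfolding 2 by (rule vec_in_Hstrict_mult[OF Wm'(2)]) simp
    next
      assume "vec_in Hstrict h"
      then show "vec_in Hstrict (rf_z ^ j \<cdot>\<^sub>v (\<Xi> *\<^sub>v f))" unfolding 1 by (rule vec_in_Hstrict_mult[OF Wm(2)]) simp
    qed
    then show ?thesis by (simp add: vec_in_def h_ix)
  qed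
  have \<Xi>_model: "\<Xi> *\<^sub>v W.model x = V.G *\<^sub>v comodel_image x" if x: "x \<in> carrier_vec nw" for x
  proof -
    have "rmat_star W.G *\<^sub>v W.model x = comodel_image x"
      unfolding W.model_comodel[OF x, symmetric] comodel_image_def
      by (rule W.star_G_G_vec) (simp add: carrier_dim_vec)
    then show ?thesis by (simp add: \<Xi>_def mat_vec_simps)
  qed
  define p where "p x = Wp *\<^sub>v W.model x" for x
  have [simp]: "dim_vec (p x) = m" for x by (simp add: p_def)
  have N_iff: "x \<in> N j \<longleftrightarrow> (\<forall>i < m. rf_z powi (int j + d i) * p x $ i \<in> Hstrict)"
    if x: "x \<in> carrier_vec nw" for x j
    unfolding strict_iff_N[OF x, symmetric] \<Xi>_model[OF x, symmetric] p_def by (rule coords) simp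
  have p_Hplus: "p x $ i \<in> Hplus" if "x \<in> carrier_vec nw" "i < m" for x i
    using vec_in_Hplus_mult[OF Wp(2) W.model_Hplus[OF that(1)]] that(2)
    by (simp add: vec_in_def p_def del: index_mult_mat_vec(1))
  have N_carrier: "x \<in> carrier_vec nw" if "x \<in> N j" for x j
    using linear_subspaceD(1)[OF linear_subspace_N] that by blast
  define I where "I = {i. i < m \<and> d i < - int k}"
  define c where "c = card I"
  have "finite I" by (simp add: I_def)
  then obtain e where e: "bij_betw e {0..<c} I" using ex_bij_betw_nat_finite c_def by blast
  have eI: "e j < m" "d (e j) < - int k" if "j < c" for j
    using bij_betwE[OF e] that by (auto simp: I_def)
  \<comment> \<open>One factor \<open>z\<close> more than membership in \<open>N k\<close> provides, so these are only proper.\<close>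
  define r where "r x i = rf_z powi (int (Suc k) + d i) * p x $ i" for x i
  have r_Hminus: "r x i \<in> Hminus" if "x \<in> N k" "i < m" for x i
  proof -
    have "r x i = rf_z * (rf_z powi (int k + d i) * p x $ i)"
      unfolding r_def by (simp add: power_int_add ac_simps)
    then show ?thesis using that N_iff[OF N_carrier[OF that(1)]] by (simp add: Hstrict_def)
  qed
  define \<psi> where "\<psi> x = vec c (\<lambda>j. value_at_infinity (r x (e j)))" for x
  have "subspace_dim nw (N k) = subspace_dim nw {x \<in> N k. \<psi> x = 0\<^sub>v c} + c"
  proof (rule subspace_dim_rank_nullity[OF linear_subspace_N])
    fix x y assume xy: "x \<in> N k" "y \<in> N k"
    have "p (x + y) = p x + p y"
      using xy[THEN N_carrier] by (simp add: p_def W.model_add mat_vec_simps)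
    then have "r (x + y) i = r x i + r y i" if "i < m" for i
      using that by (simp add: r_def distrib_left)
    then show "\<psi> (x + y) = \<psi> x + \<psi> y"
      using xy eI by (intro eq_vecI) (simp_all add: \<psi>_def value_at_infinity_add r_Hminus)
  next
    fix a x assume x: "x \<in> N k"
    have "p (a \<cdot>\<^sub>v x) = rf_const a \<cdot>\<^sub>v p x"
      using x[THEN N_carrier] by (simp add: p_def W.model_smult mat_vec_simps)
    then have "r (a \<cdot>\<^sub>v x) i = rf_const a * r x i" if "i < m" for i
      using that by (simp add: r_def ac_simps)
    then show "\<psi> (a \<cdot>\<^sub>v x) = a \<cdot>\<^sub>v \<psi> x"
      using x eI by (intro eq_vecI) (simp_all add: \<psi>_def value_at_infinity_mult r_Hminus)
  next
    have "v \<in> \<psi> ` N k" if v: "v \<in> carrier_vec c" for v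
    proof -
      \<comment> \<open>Monomials with the prescribed leading coefficients; the exponents are nonnegative for \<open>i \<in> I\<close>.\<close>
      define p0 where "p0 = vec m (\<lambda>i. if i \<in> I
        then rf_const (v $ (the_inv_into {0..<c} e i)) * rf_z powi (- (int (Suc k) + d i)) else 0)"
      have [simp]: "dim_vec p0 = m" by (simp add: p0_def)
      have p0: "vec_in Hplus p0"
        by (auto simp: vec_in_def p0_def I_def intro!: Hplus_closed rf_z_powi_Hplus)
      define f where "f = Wp' *\<^sub>v p0"
      have [simp]: "dim_vec f = m" by (simp add: f_def)
      have f: "vec_in Hplus f" unfolding f_def by (rule vec_in_Hplus_mult[OF Wp'(2) p0]) simp
      have "Wp *\<^sub>v f = (Wp * Wp') *\<^sub>v p0" unfolding f_def by (simp add: mat_vec_simps)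
      then have Wpf: "Wp *\<^sub>v f = p0" unfolding Wp'(3) by (simp add: carrier_dim_vec)
      have p0_strict: "rf_z powi (int k + d i) * p0 $ i \<in> Hstrict" if "i < m" for i
      proof (cases "i \<in> I")
        case True
        have "int k + d i + - (int (Suc k) + d i) = -1" by simp
        then have "rf_z powi (int k + d i) * rf_z powi (- (int (Suc k) + d i)) = inverse rf_z"
          by (metis power_int_add power_int_minus1_right rf_z_nonzero)
        then have "rf_z powi (int k + d i) * p0 $ i = rf_const (v $ (the_inv_into {0..<c} e i)) * inverse rf_z"
          using True that by (simp add: p0_def ac_simps)
        then have "rf_z * (rf_z powi (int k + d i) * p0 $ i) = rf_const (v $ (the_inv_into {0..<c} e i))"
          by (simp only:) (simp add: field_simps)
        then show ?thesis by (simp only: Hstrict_def mem_Collect_eq Hminus_closed(1))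
      qed (use that in \<open>simp add: p0_def\<close>)
      have s: "vec_in Hstrict (rf_z ^ k \<cdot>\<^sub>v (\<Xi> *\<^sub>v f))"
        unfolding coords[OF \<open>dim_vec f = m\<close>] Wpf using p0_strict by blast
      define u where "u = rmat_star W.G *\<^sub>v f"
      have uc: "u \<in> carrier_vec m" by (simp add: u_def carrier_dim_vec)
      have [simp]: "dim_vec u = m" using uc by simp
      have "V.G *\<^sub>v u = \<Xi> *\<^sub>v f" by (simp add: u_def \<Xi>_def mat_vec_simps)
      then have "u = rmat_star V.G *\<^sub>v (\<Xi> *\<^sub>v f)" using V.star_G_G_vec[OF uc] by simp
      also have "\<Xi> *\<^sub>v f = inverse rf_z ^ k \<cdot>\<^sub>v (rf_z ^ k \<cdot>\<^sub>v (\<Xi> *\<^sub>v f))"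
        by (simp add: smult_smult_assoc flip: power_mult_distrib)
      finally have "u = rmat_star V.G *\<^sub>v (inverse rf_z ^ k \<cdot>\<^sub>v (rf_z ^ k \<cdot>\<^sub>v (\<Xi> *\<^sub>v f)))" .
      then have us: "vec_in Hstrict u"
        using vec_in_Hstrict_mult[OF V.entries_G(2) vec_in_Hstrict_smult[OF inverse_rf_z_power_Hminus s]] by simp
      have Gu: "W.G *\<^sub>v u = f" unfolding u_def by (rule W.G_star_G_vec) (simp add: carrier_dim_vec)
      obtain x where x: "x \<in> carrier_vec nw" "f = W.model x"
        using W.model_space[OF uc us] f unfolding Gu by blast
      have px: "p x = p0" using Wpf x(2) by (simp add: p_def)
      have "x \<in> N k" unfolding N_iff[OF x(1)] px using p0_strict by blast
      moreover have "\<psi> x = v"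
      proof (rule eq_vecI)
        fix j assume "j < dim_vec v"
        then have j: "j < c" using v by simp
        have inv: "the_inv_into {0..<c} e (e j) = j"
          using e j by (intro the_inv_into_f_f) (auto simp: bij_betw_def)
        have "e j \<in> I" using eI[OF j] by (simp add: I_def)
        moreover have "rf_z powi (int (Suc k) + d (e j)) * rf_z powi (- (int (Suc k) + d (e j))) = 1"
          by (metis add.right_inverse power_int_0_right power_int_add rf_z_nonzero)
        ultimately have "r x (e j) = rf_const (v $ j)"
          using eI[OF j] by (simp add: r_def px p0_def inv ac_simps)
        then show "\<psi> x $ j = v $ j" using j by (simp add: \<psi>_def value_at_infinity_eqI)
      qed (use v in \<open>simp add: \<psi>_def\<close>)
      ultimately show ?thesis by blast
    qed
    then show "\<psi> ` N k = carrier_vec c" by (auto simp: \<psi>_def)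
  qed
  also have "{x \<in> N k. \<psi> x = 0\<^sub>v c} = N (Suc k)"
  proof (intro equalityI subsetI)
    fix x assume "x \<in> {x \<in> N k. \<psi> x = 0\<^sub>v c}"
    then have x: "x \<in> N k" and \<psi>0: "\<psi> x = 0\<^sub>v c" by auto
    note xc = N_carrier[OF x]
    have "r x i \<in> Hstrict" if i: "i < m" for i
    proof (cases "i \<in> I")
      case True
      then obtain j where j: "j < c" "i = e j" using e by (auto simp: bij_betw_def)
      then have "value_at_infinity (r x i) = 0" using arg_cong[OF \<psi>0, of "\<lambda>v. v $ j"] by (simp add: \<psi>_def)
      then show ?thesis using value_at_infinity_eq_0_iff[OF r_Hminus[OF x i]] by simp
    next
      case False
      have "rf_z powi (int k + d i) * p x $ i \<in> Hstrict" using x N_iff[OF xc] i by blast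
      moreover have "rf_z powi (int k + d i) * p x $ i \<in> Hplus"
        using False i p_Hplus[OF xc i] by (intro Hplus_closed(3) rf_z_powi_Hplus) (auto simp: I_def)
      ultimately have "p x $ i = 0" using Hplus_Hstrict_zero by fastforce
      then show ?thesis by (simp add: r_def)
    qed
    then show "x \<in> N (Suc k)" unfolding N_iff[OF xc] r_def by blast
  next
    fix x assume x: "x \<in> N (Suc k)"
    note xc = N_carrier[OF x]
    have r: "r x i \<in> Hstrict" if "i < m" for i using x that unfolding N_iff[OF xc] r_def by blast
    have "rf_z powi (int k + d i) * p x $ i \<in> Hstrict" if "i < m" for i
    proof -
      have "rf_z powi (int k + d i) * p x $ i = inverse rf_z * r x i"
        unfolding r_def by (simp add: power_int_add mult.assoc[symmetric])
      then show ?thesis using Hstrict_mult[OF inverse_rf_z_Hminus r[OF that]] by simp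
    qed
    then have "x \<in> N k" unfolding N_iff[OF xc] by blast
    moreover have "\<psi> x = 0\<^sub>v c"
      using r eI by (intro eq_vecI) (simp_all add: \<psi>_def value_at_infinity_eqI)
    ultimately show "x \<in> {x \<in> N k. \<psi> x = 0\<^sub>v c}" by blast
  qed
  finally show ?thesis by (simp add: c_def I_def)
qed

end

section \<open>Reading off the indices\<close>

text \<open>Conjugation of partitions: the set on the left is an initial segment of \<open>{1..s}\<close>.\<close>

lemma le_card_antimono_iff:
  fixes \<alpha> :: "nat \<Rightarrow> nat"
  assumes "antimono_on {1..s} \<alpha>" "j \<in> {1..s}"
  shows "j \<le> card {i \<in> {1..s}. k < \<alpha> i} \<longleftrightarrow> k < \<alpha> j"
proof
  assume le: "j \<le> card {i \<in> {1..s}. k < \<alpha> i}"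
  show "k < \<alpha> j"
  proof (rule ccontr)
    assume not: "\<not> k < \<alpha> j"
    have "{i \<in> {1..s}. k < \<alpha> i} \<subseteq> {1..<j}"
    proof
      fix i assume i: "i \<in> {i \<in> {1..s}. k < \<alpha> i}"
      have "\<not> j \<le> i" using monotone_onD[OF assms(1) assms(2), of i] i not by auto
      then show "i \<in> {1..<j}" using i by auto
    qed
    then have "card {i \<in> {1..s}. k < \<alpha> i} \<le> card {1..<j}" by (intro card_mono) auto
    then show False using le assms(2) by auto
  qed
next
  assume "k < \<alpha> j"
  have "{1..j} \<subseteq> {i \<in> {1..s}. k < \<alpha> i}"
  proof
    fix i assume i: "i \<in> {1..j}"
    then have "\<alpha> j \<le> \<alpha> i" using assms(2) by (intro monotone_onD[OF assms(1)]) auto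
    then show "i \<in> {i \<in> {1..s}. k < \<alpha> i}" using i assms(2) \<open>k < \<alpha> j\<close> by auto
  qed
  then have "card {1..j} \<le> card {i \<in> {1..s}. k < \<alpha> i}" by (intro card_mono) auto
  then show "j \<le> card {i \<in> {1..s}. k < \<alpha> i}" by simp
qed

context inner_pair begin

lemma N_0: "N 0 = mat_kernel X"
  using X E_carrier by (auto simp: N_def Ker_k_0 mat_kernel)

lemma Ker_k_1: "Ker_k 1 K E = mat_kernel K"
proof -
  have "x \<in> Ker_k (Suc 0) K E \<longleftrightarrow> x \<in> mat_kernel K" for x
    using E_carrier mult_mat_vec_carrier[OF E_carrier]
    by (auto simp: Ker_k_Suc[OF K_carrier E_carrier] Ker_k_0 mem_K)
  then show ?thesis by auto
qed

text \<open>Immediate from the Stein equation in the form \<open>X = A\<^sub>V (X A\<^sub>W\<^sup>*) + B\<^sub>V B\<^sub>W\<^sup>*\<close>.\<close>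

lemma kernel_K_subset: "mat_kernel K \<subseteq> mat_kernel X"
proof
  fix x assume "x \<in> mat_kernel K"
  then have x: "x \<in> carrier_vec nw" "mat_adjoint Bw *\<^sub>v x = 0\<^sub>v m" "X *\<^sub>v (E *\<^sub>v x) = 0\<^sub>v nv"
    by (simp_all add: mem_K)
  have "(X - Av * X * E) *\<^sub>v x = X *\<^sub>v x - Av *\<^sub>v (X *\<^sub>v (E *\<^sub>v x))"
    by (simp add: mat_vec_simps carrier_matD[OF X] carrier_matD[OF V.dims(1)] carrier_matD[OF E_carrier]
        carrier_vecD[OF x(1)])
  moreover have "(Bv * mat_adjoint Bw) *\<^sub>v x = Bv *\<^sub>v (mat_adjoint Bw *\<^sub>v x)"
    by (rule assoc_mult_mat_vec[of _ nv m _ nw]) (use V.dims W.dims x in simp_all)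
  ultimately have "X *\<^sub>v x - Av *\<^sub>v 0\<^sub>v nv = Bv *\<^sub>v 0\<^sub>v m"
    using stein by (simp add: E_def[symmetric] x)
  moreover have "Av *\<^sub>v 0\<^sub>v nv = 0\<^sub>v nv" "Bv *\<^sub>v 0\<^sub>v m = 0\<^sub>v nv"
    using carrier_matD[OF V.dims(1)] carrier_matD[OF V.dims(2)]
    by (simp_all add: vec_eq_iff scalar_prod_def)
  ultimately have "X *\<^sub>v x = 0\<^sub>v nv"
    using mult_mat_vec_carrier[OF X x(1)] by simp
  then show "x \<in> mat_kernel X" using x(1) by (simp add: mat_kernel[OF X])
qed

lemma N_Suc: "N (Suc k) = Ker_k (Suc k) K E"
  using kernel_K_subset by (auto simp: N_def Ker_k_Suc[OF K_carrier E_carrier])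

text \<open>For \<open>k \<ge> 2\<close> the drop of the dimension is the number of parts of size at least \<open>k\<close>. For \<open>k = 1\<close> it is at least \<open>s\<close>, and every part
  has size at least \<open>1\<close>.\<close>

theorem indices_from_dimensions:
  assumes step: "\<And>k. subspace_dim nw (N k) = subspace_dim nw (N (Suc k)) + card {j \<in> {1..s}. k < \<alpha> j}"
    and pos: "\<forall>j \<in> {1..s}. 0 < \<alpha> j" and anti: "antimono_on {1..s} \<alpha>"
  shows "int s = int (subspace_dim nw (mat_kernel X)) - int (subspace_dim nw (mat_kernel K))"
    "\<And>j. j \<in> {1..s} \<Longrightarrow> \<alpha> j = card {k. 1 \<le> k \<and>
      int (subspace_dim nw (Ker_k (k - 1) K E)) - int (subspace_dim nw (Ker_k k K E)) \<ge> int j}"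
proof -
  have "{j \<in> {1..s}. 0 < \<alpha> j} = {1..s}" using pos by auto
  then have s: "subspace_dim nw (mat_kernel X) = subspace_dim nw (mat_kernel K) + s"
    using step[of 0] by (simp add: N_0 N_Suc Ker_k_1[simplified])
  then show "int s = int (subspace_dim nw (mat_kernel X)) - int (subspace_dim nw (mat_kernel K))" by simp
  fix j assume j: "j \<in> {1..s}"
  let ?d = "\<lambda>k. int (subspace_dim nw (Ker_k k K E))"
  have "1 \<le> k \<and> ?d (k - 1) - ?d k \<ge> int j \<longleftrightarrow> k \<in> {1..\<alpha> j}" for k
  proof (cases k)
    case 0 then show ?thesis by simp
  next
    case (Suc l)
    show ?thesis
    proof (cases l)
      case 0
      have "subspace_dim nw (mat_kernel X) \<le> subspace_dim nw (Ker_k 0 K E)"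
        using linear_subspaceD(1)[OF linear_subspace_kernel[OF X]]
        by (intro subspace_dim_mono linear_subspace_Ker_k[OF E_carrier K_carrier] linear_subspace_kernel[OF X])
          (simp add: Ker_k_0 carrier_matD[OF E_carrier])
      then have "?d 0 - ?d 1 \<ge> int j" using s j by (simp add: Ker_k_1[simplified])
      moreover have "1 \<le> \<alpha> j" using pos j by (simp add: Suc_leI)
      ultimately show ?thesis by (simp add: Suc 0)
    next
      case (Suc i)
      have "?d (Suc i) - ?d (Suc (Suc i)) = int (card {j \<in> {1..s}. Suc i < \<alpha> j})"
        using step[of "Suc i"] by (simp add: N_Suc)
      then have "?d (k - 1) - ?d k \<ge> int j \<longleftrightarrow> Suc i < \<alpha> j"
        using le_card_antimono_iff[OF anti j, of "Suc i"] \<open>k = Suc l\<close> Suc by simp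
      then show ?thesis using \<open>k = Suc l\<close> Suc by auto
    qed
  qed
  then have "{k. 1 \<le> k \<and> ?d (k - 1) - ?d k \<ge> int j} = {1..\<alpha> j}" by blast
  then show "\<alpha> j = card {k. 1 \<le> k \<and> ?d (k - 1) - ?d k \<ge> int j}" by simp
qed

text \<open>The adjoint of the Stein equation is the Stein equation of the pair with \<open>V\<close> and \<open>W\<close> exchanged.\<close>

lemma dual: "inner_pair nw nv m Aw Bw Cw Dw Av Bv Cv Dv (mat_adjoint X)"
proof -
  have "mat_adjoint X - Aw * mat_adjoint X * mat_adjoint Av = Bw * mat_adjoint Bv"
  proof -
    have AXE: "Av * X * mat_adjoint Aw \<in> carrier_mat nv nw"
      using V.dims W.dims X by (intro mult_carrier_mat[of _ nv nw] mult_carrier_mat[of _ nv nv]) simp_all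
    have "mat_adjoint (Bv * mat_adjoint Bw) = mat_adjoint (X - Av * X * mat_adjoint Aw)"
      by (simp only: stein)
    also have "\<dots> = mat_adjoint X - mat_adjoint (Av * X * mat_adjoint Aw)"
      by (rule mat_adjoint_minus[OF X AXE])
    also have "mat_adjoint (Av * X * mat_adjoint Aw) = Aw * mat_adjoint (Av * X)"
      using V.dims W.dims X by (subst mat_adjoint_mult[of _ nv nw _ nw]) (simp_all add: mult_carrier_mat[of _ nv nv])
    also have "mat_adjoint (Av * X) = mat_adjoint X * mat_adjoint Av"
      by (rule mat_adjoint_mult[OF V.dims(1) X])
    also have "Aw * (mat_adjoint X * mat_adjoint Av) = Aw * mat_adjoint X * mat_adjoint Av"
      by (rule assoc_mult_mat[symmetric, of _ nw nw _ nv _ nv]) (use V.dims W.dims X in simp_all)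
    also have "mat_adjoint (Bv * mat_adjoint Bw) = Bw * mat_adjoint Bv"
      using V.dims W.dims by (subst mat_adjoint_mult[of _ nv m _ nw]) simp_all
    finally show ?thesis by simp
  qed
  then show ?thesis
    using V.unitary_realization_axioms W.unitary_realization_axioms X
    by (intro inner_pair.intro inner_pair_axioms.intro) simp_all
qed

end

text \<open>The exponents of the diagonal factor as one integer sequence. A change of sign then describes the adjoint of the
  factor, without a reordering of the diagonal.\<close>

definition WH_exponent :: "nat \<Rightarrow> nat \<Rightarrow> (nat \<Rightarrow> nat) \<Rightarrow> nat \<Rightarrow> (nat \<Rightarrow> nat) \<Rightarrow> nat \<Rightarrow> int" where
  "WH_exponent m s \<alpha> t \<omega> i =
    (if i < s then - int (\<alpha> (i + 1)) else if i < m - t then 0 else int (\<omega> (m - i)))"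

lemma WH_diag_eq: "WH_diag m s \<alpha> t \<omega> = mat_diag m (\<lambda>i. rf_z powi WH_exponent m s \<alpha> t \<omega> i)"
  unfolding WH_diag_def WH_exponent_def
  by (rule arg_cong[of _ _ "mat_diag m"]) (auto simp: power_int_minus power_inverse)

lemma card_WH_exponent:
  assumes "s + t \<le> m"
  shows "card {i. i < m \<and> WH_exponent m s \<alpha> t \<omega> i < - int k} = card {j \<in> {1..s}. k < \<alpha> j}"
    "card {i. i < m \<and> - WH_exponent m s \<alpha> t \<omega> i < - int k} = card {j \<in> {1..t}. k < \<omega> j}"
proof -
  have "bij_betw Suc {i. i < m \<and> WH_exponent m s \<alpha> t \<omega> i < - int k} {j \<in> {1..s}. k < \<alpha> j}"
    by (rule bij_betw_byWitness[of _ "\<lambda>j. j - 1"]) (use assms in \<open>auto simp: WH_exponent_def split: if_splits\<close>)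
  then show "card {i. i < m \<and> WH_exponent m s \<alpha> t \<omega> i < - int k} = card {j \<in> {1..s}. k < \<alpha> j}"
    by (rule bij_betw_same_card)
  have "bij_betw (\<lambda>i. m - i) {i. i < m \<and> - WH_exponent m s \<alpha> t \<omega> i < - int k} {j \<in> {1..t}. k < \<omega> j}"
    by (rule bij_betw_byWitness[of _ "\<lambda>j. m - j"]) (use assms in \<open>auto simp: WH_exponent_def split: if_splits\<close>)
  then show "card {i. i < m \<and> - WH_exponent m s \<alpha> t \<omega> i < - int k} = card {j \<in> {1..t}. k < \<omega> j}"
    by (rule bij_betw_same_card)
qed

theorem theorem3p3:
  fixes m nm np s t :: nat
    and \<alpha> \<omega> :: "nat \<Rightarrow> nat"
    and R \<Xi> V W :: "ratfun mat"
    and A\<^sub>V B\<^sub>V C\<^sub>V D\<^sub>V A\<^sub>W B\<^sub>W C\<^sub>W D\<^sub>W X :: "complex mat"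
  assumes R: "R \<in> carrier_mat m m" "no_poles_zeros_on {z. cmod z = 1} R"
    and Xi: "left_unitary_factor m R \<Xi>"
    and VW: "bi_inner m V" "bi_inner m W" "\<Xi> = V * rmat_star W"
    and dims_V: "A\<^sub>V \<in> carrier_mat nm nm" "B\<^sub>V \<in> carrier_mat nm m"
                "C\<^sub>V \<in> carrier_mat m nm" "D\<^sub>V \<in> carrier_mat m m"
    and dims_W: "A\<^sub>W \<in> carrier_mat np np" "B\<^sub>W \<in> carrier_mat np m"
                "C\<^sub>W \<in> carrier_mat m np" "D\<^sub>W \<in> carrier_mat m m"
    and V: "V = realization nm A\<^sub>V B\<^sub>V C\<^sub>V D\<^sub>V"
    and W: "W = realization np A\<^sub>W B\<^sub>W C\<^sub>W D\<^sub>W"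
    and stable: "stable_mat A\<^sub>V" "stable_mat A\<^sub>W"
    and unitary: "unitary_mat (nm + m) (four_block_mat A\<^sub>V B\<^sub>V C\<^sub>V D\<^sub>V)"
                 "unitary_mat (np + m) (four_block_mat A\<^sub>W B\<^sub>W C\<^sub>W D\<^sub>W)"
    and X: "X \<in> carrier_mat nm np"
           "X - A\<^sub>V * X * mat_adjoint A\<^sub>W = B\<^sub>V * mat_adjoint B\<^sub>W"
    and indices: "right_WH_indices m \<Xi> s \<alpha> t \<omega>"
  shows "let K = mat_adjoint B\<^sub>W @\<^sub>r (X * mat_adjoint A\<^sub>W);
             J = B\<^sub>V @\<^sub>c (A\<^sub>V * X);
             dimKer = (\<lambda>k. int (subspace_dim np (Ker_k k K (mat_adjoint A\<^sub>W))));
             dimIm = (\<lambda>k. int (subspace_dim nm (Im_k k A\<^sub>V J)))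
         in int s = int (subspace_dim np (mat_kernel X)) - int (subspace_dim np (mat_kernel K))
          \<and> (\<forall>j \<in> {1..s}. \<alpha> j = card {k. 1 \<le> k \<and> dimKer (k - 1) - dimKer k \<ge> int j})
          \<and> int t = int (subspace_dim nm (mat_im J)) - int (subspace_dim nm (mat_im X))
          \<and> (\<forall>j \<in> {1..t}. \<omega> j = card {k. 1 \<le> k \<and> dimIm k - dimIm (k - 1) \<ge> int j})"
proof -
  interpret P: inner_pair nm np m A\<^sub>V B\<^sub>V C\<^sub>V D\<^sub>V A\<^sub>W B\<^sub>W C\<^sub>W D\<^sub>W X
    using dims_V dims_W stable unitary X
    by (intro inner_pair.intro unitary_realization.intro inner_pair_axioms.intro)
  interpret S: inner_pair np nm m A\<^sub>W B\<^sub>W C\<^sub>W D\<^sub>W A\<^sub>V B\<^sub>V C\<^sub>V D\<^sub>V "mat_adjoint X" by (rule P.dual)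
  let ?d = "WH_exponent m s \<alpha> t \<omega>"
  obtain Wm Wp where st: "s + t \<le> m"
    and \<alpha>: "\<forall>j \<in> {1..s}. 0 < \<alpha> j" "antimono_on {1..s} \<alpha>"
    and \<omega>: "\<forall>j \<in> {1..t}. 0 < \<omega> j" "antimono_on {1..t} \<omega>"
    and Wc: "Wm \<in> carrier_mat m m" "Wp \<in> carrier_mat m m"
    and Wm: "no_poles_zeros_on {z. cmod z \<ge> 1} Wm" "\<not> rmat_pole_inf Wm" "\<not> rmat_zero_inf Wm"
    and Wp: "no_poles_zeros_on {z. cmod z \<le> 1} Wp"
    and fact: "P.V.G * rmat_star P.W.G = Wm * mat_diag m (\<lambda>i. rf_z powi ?d i) * Wp"
    using indices[unfolded VW(3) V W, folded P.V.G_def P.W.G_def, unfolded right_WH_indices_def WH_diag_eq]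
    by (elim conjE exE) (rule that; assumption)
  note Wm_entries = no_poles_zeros_exterior[OF Wm] and Wp_entries = no_poles_zeros_disc[OF Wp]
  have "rmat_regular Wm" "rmat_regular Wp" using Wm(1) Wp by (simp_all add: no_poles_zeros_on_def)
  note Wm_inv = rmat_inv[OF Wc(1) this(1)] and Wp_inv = rmat_inv[OF Wc(2) this(2)]
  have neg: "subspace_dim np (P.N k) = subspace_dim np (P.N (Suc k)) + card {j \<in> {1..s}. k < \<alpha> j}" for k
    by (rule P.wiener_hopf_dimension[OF Wc(1) Wm_entries(1) Wm_inv(1) Wm_entries(2) Wm_inv(3)
        Wc(2) Wp_entries(1) Wp_inv(1) Wp_entries(2) Wp_inv(2) fact,
        unfolded card_WH_exponent[OF st]])
  \<comment> \<open>The transfer functions of \<open>S\<close> are those of \<open>P\<close> with their names exchanged.\<close>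
  have fact': "P.W.G * rmat_star P.V.G =
      rmat_star Wp * mat_diag m (\<lambda>i. rf_z powi (- ?d i)) * rmat_star Wm"
  proof -
    have D: "mat_diag m (\<lambda>i. rf_z powi ?d i) \<in> carrier_mat m m" by simp
    have "P.W.G * rmat_star P.V.G = rmat_star (P.V.G * rmat_star P.W.G)"
      by (simp only: rmat_star_mult[OF P.V.G_carrier rmat_star_carrier[THEN iffD2, OF P.W.G_carrier]] rmat_star_star)
    also have "\<dots> = rmat_star Wp * (rmat_star (mat_diag m (\<lambda>i. rf_z powi ?d i)) * rmat_star Wm)"
      unfolding fact
      by (simp only: rmat_star_mult[OF mult_carrier_mat[OF Wc(1) D] Wc(2)] rmat_star_mult[OF Wc(1) D])
    also have "\<dots> = rmat_star Wp * rmat_star (mat_diag m (\<lambda>i. rf_z powi ?d i)) * rmat_star Wm"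
      by (rule assoc_mult_mat[symmetric, of _ m m _ m _ m]) (use Wc D in simp_all)
    finally show ?thesis by (simp only: rmat_star_mat_diag_powi)
  qed
  have star_inv: "rmat_star (rmat_inv Wp) * rmat_star Wp = 1\<^sub>m m" "rmat_star Wm * rmat_star (rmat_inv Wm) = 1\<^sub>m m"
    unfolding rmat_star_mult[OF Wc(2) Wp_inv(1), symmetric] rmat_star_mult[OF Wm_inv(1) Wc(1), symmetric]
      Wp_inv(2) Wm_inv(3) by (rule rmat_star_one)+
  have Wc': "rmat_star Wp \<in> carrier_mat m m" "rmat_star (rmat_inv Wp) \<in> carrier_mat m m"
    "rmat_star Wm \<in> carrier_mat m m" "rmat_star (rmat_inv Wm) \<in> carrier_mat m m"
    unfolding rmat_star_carrier by (fact Wc Wp_inv Wm_inv)+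
  have pos: "subspace_dim nm (S.N k) = subspace_dim nm (S.N (Suc k)) + card {j \<in> {1..t}. k < \<omega> j}" for k
    by (rule S.wiener_hopf_dimension[OF Wc'(1) entries_in_star_Hplus[OF Wp_entries(1)]
        Wc'(2) entries_in_star_Hplus[OF Wp_entries(2)] star_inv(1)
        Wc'(3) entries_in_star_Hminus[OF Wm_entries(1)]
        Wc'(4) entries_in_star_Hminus[OF Wm_entries(2)] star_inv(2) fact',
        unfolded card_WH_exponent[OF st]])
  define J where "J = B\<^sub>V @\<^sub>c (A\<^sub>V * X)"
  have AX: "A\<^sub>V * X \<in> carrier_mat nm np" by (rule mult_carrier_mat[OF P.V.dims(1) P.X])
  have J: "J \<in> carrier_mat nm (m + np)"
    unfolding J_def append_cols_def
    by (simp add: carrier_mat_dims carrier_matD[OF P.V.dims(1)] carrier_matD[OF P.V.dims(2)] carrier_matD[OF P.X])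
  have SK: "S.K = mat_adjoint J"
    unfolding S.K_def S.E_def J_def mat_adjoint_append_cols[OF P.V.dims(2) AX]
      mat_adjoint_mult[OF P.V.dims(1) P.X] ..
  note neg_indices = P.indices_from_dimensions[OF neg \<alpha>, unfolded P.K_def P.E_def]
  note pos_indices = S.indices_from_dimensions[OF pos \<omega>, unfolded SK S.E_def]
  have dim_ker: "int (subspace_dim nm (Ker_k k (mat_adjoint J) (mat_adjoint A\<^sub>V))) =
      int nm - int (subspace_dim nm (Im_k k A\<^sub>V J))" for k
    using subspace_dim_Im_k[OF P.V.dims(1) J, of k] by linarith
  have "int t = int (subspace_dim nm (mat_im J)) - int (subspace_dim nm (mat_im X))"
    using pos_indices(1) subspace_dim_mat_im[OF J] subspace_dim_mat_im[OF P.X] by linarith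
  moreover have "\<omega> j = card {k. 1 \<le> k \<and>
      int (subspace_dim nm (Im_k k A\<^sub>V J)) - int (subspace_dim nm (Im_k (k - 1) A\<^sub>V J)) \<ge> int j}"
    if "j \<in> {1..t}" for j
    using pos_indices(2)[OF that] unfolding dim_ker by (simp add: algebra_simps)
  ultimately show ?thesis
    using neg_indices unfolding Let_def J_def[symmetric] by blast
qed

end
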